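(* There exists a dense $G_\delta$ set $A\subset\mathbb R$ such that if $\alpha\in A$, $\beta\in\mathbb Q\setminus\{0\}$, and if $\phi^t$ is a reparametrized linear flow (in the sense of the context) with angle $\alpha$ and with stopping points at $(0,0)$ and $(0,\beta)$, then $\phi^t$ has an extreme historic behaviour.
   Context: Let $\mathbb T^2=\mathbb R^2/\mathbb Z^2$, and let $\lambda^2$ be Lebesgue (Haar) measure on $\mathbb T^2$. A reparametrized linear flow with angle $\alpha$ and stopping points at $\mathbf p$ and $\mathbf q$ is the flow $\phi^t$ on $\mathbb T^2$ generated by a vector field $X=\varphi X_0$ such that: $X_0=(1,\alpha)$ with $\alpha\in\mathbb R$ irrational; $\varphi:\mathbb T^2\to[0,\infty)$ is of class $C^3$; $\varphi$ vanishes at two distinct points $\mathbf p,\mathbf q$ of $\mathbb T^2$ and is positive elsewhere; the Hessians $D^2\varphi(\mathbf p)$ and $D^2\varphi(\mathbf q)$ are positive definite. (In particular the two stopping points must be distinct points of $\mathbb T^2$.) For $\mathbf x\in\mathbb T^2$ and $t>0$ the empirical measure $\mu^t_{\mathbf x}$ is the Borel probability with $\int f\,d\mu^t_{\mathbf x}=\frac1t\int_0^t f(\phi^s(\mathbf x))\,ds$ for continuous $f$, and $p\omega(\mathbf x)=\bigcap_{T>0}\overline{\{\mu^t_{\mathbf x}:t\ge T\}}$ (weak-* closure). The flow has an extreme historic behaviour if $p\omega(\mathbf x)=\{s\delta_{\mathbf p}+(1-s)\delta_{\mathbf q}:0\le s\le1\}$ for $\lambda^2$-a.e. $\mathbf x$.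 *)

theory Defs
  imports "HOL-Probability.Probability"
begin

definition torus_rel :: "real \<times> real \<Rightarrow> real \<times> real \<Rightarrow> bool" where
  "torus_rel x y \<longleftrightarrow> fst x - fst y \<in> \<int> \<and> snd x - snd y \<in> \<int>"

lemma equivp_torus_rel: "equivp torus_rel"
proof (rule equivpI)
  show "reflp torus_rel"
    by (simp add: reflp_def torus_rel_def)
  show "symp torus_rel"
    unfolding symp_def torus_rel_def by (metis Ints_minus minus_diff_eq)
  show "transp torus_rel"
  proof (rule transpI)
    fix x y z assume "torus_rel x y" "torus_rel y z"
    then have "(fst x - fst y) + (fst y - fst z) \<in> \<int>" "(snd x - snd y) + (snd y - snd z) \<in> \<int>"
      unfolding torus_rel_def by (blast intro: Ints_add)+
    then show "torus_rel x z"
      by (simp add: torus_rel_def)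
  qed
qed

text \<open>The two-dimensional torus as the quotient of the plane by the integer lattice; the projection
  is \<open>abs_torus\<close>. It carries the quotient topology.\<close>

quotient_type torus = "real \<times> real" / torus_rel
  by (rule equivp_torus_rel)

instantiation torus :: topological_space
begin

definition open_torus :: "torus set \<Rightarrow> bool" where
  "open_torus U \<longleftrightarrow> open (abs_torus -` U)"

instance
  by standard (auto simp: open_torus_def vimage_Union intro: open_Int)

end

lemma continuous_on_abs_torus: "continuous_on UNIV abs_torus"
  by (simp add: continuous_on_open_vimage open_torus_def)

text \<open>Normalised Lebesgue measure on the torus, obtained from the fundamental domain.\<close>

definition torus_lebesgue :: "torus measure" where
  "torus_lebesgue = distr (restrict_space lborel ({0..<1} \<times> {0..<1})) borel abs_torus"

primrec C_k :: "nat \<Rightarrow> ('a::euclidean_space \<Rightarrow> 'b::euclidean_space) \<Rightarrow> bool" where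
  "C_k 0 f \<longleftrightarrow> continuous_on UNIV f"
| "C_k (Suc k) f \<longleftrightarrow> (\<forall>x. f differentiable at x) \<and> (\<forall>v. C_k k (\<lambda>x. frechet_derivative f (at x) v))"

definition hessian :: "('a::euclidean_space \<Rightarrow> real) \<Rightarrow> 'a \<Rightarrow> 'a \<Rightarrow> 'a \<Rightarrow> real" where
  "hessian f x v w = frechet_derivative (\<lambda>y. frechet_derivative f (at y) v) (at x) w"

definition positive_definite :: "('a::euclidean_space \<Rightarrow> 'a \<Rightarrow> real) \<Rightarrow> bool" where
  "positive_definite B \<longleftrightarrow> (\<forall>v. v \<noteq> 0 \<longrightarrow> 0 < B v v)"

definition is_flow :: "(real \<Rightarrow> 'a::topological_space \<Rightarrow> 'a) \<Rightarrow> bool" where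
  "is_flow \<Phi> \<longleftrightarrow> continuous_on UNIV (\<lambda>(t, x). \<Phi> t x) \<and> (\<forall>x. \<Phi> 0 x = x) \<and>
     (\<forall>s t x. \<Phi> (s + t) x = \<Phi> s (\<Phi> t x))"

text \<open>The tangent bundle of the torus is trivial, so a vector field is a map into the plane.
  Velocities are computed on lifts of orbits to the plane.\<close>

definition flow_generated_by :: "(torus \<Rightarrow> real \<times> real) \<Rightarrow> (real \<Rightarrow> torus \<Rightarrow> torus) \<Rightarrow> bool" where
  "flow_generated_by X \<Phi> \<longleftrightarrow> is_flow \<Phi> \<and>
     (\<forall>x. \<exists>c. \<forall>t. abs_torus (c t) = \<Phi> t x \<and> (c has_vector_derivative X (\<Phi> t x)) (at t))"

text \<open>Regularity and the Hessian of a function on the torus are those of its periodic lift.\<close>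

definition reparametrized_linear_flow ::
    "real \<Rightarrow> torus \<Rightarrow> torus \<Rightarrow> (real \<Rightarrow> torus \<Rightarrow> torus) \<Rightarrow> bool" where
  "reparametrized_linear_flow \<alpha> p q \<Phi> \<longleftrightarrow> \<alpha> \<notin> \<rat> \<and> p \<noteq> q \<and>
     (\<exists>\<phi> :: torus \<Rightarrow> real.
        C_k 3 (\<lambda>z. \<phi> (abs_torus z)) \<and>
        \<phi> p = 0 \<and> \<phi> q = 0 \<and> (\<forall>x. x \<noteq> p \<longrightarrow> x \<noteq> q \<longrightarrow> 0 < \<phi> x) \<and>
        (\<forall>z. abs_torus z \<in> {p, q} \<longrightarrow> positive_definite (hessian (\<lambda>z. \<phi> (abs_torus z)) z)) \<and>
        flow_generated_by (\<lambda>x. \<phi> x *\<^sub>R (1, \<alpha>)) \<Phi>)"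

definition borel_probs :: "'a::topological_space measure set" where
  "borel_probs = {\<mu>. sets \<mu> = sets borel \<and> prob_space \<mu>}"

definition weak_star_topology :: "'a::topological_space measure topology" where
  "weak_star_topology = topology_generated_by
     {{\<mu> \<in> borel_probs. (\<integral>x. f x \<partial>\<mu>) \<in> U} | (f :: 'a \<Rightarrow> real) U. continuous_on UNIV f \<and> open U}"

definition is_empirical_measure ::
    "(real \<Rightarrow> 'a::topological_space \<Rightarrow> 'a) \<Rightarrow> real \<Rightarrow> 'a \<Rightarrow> 'a measure \<Rightarrow> bool" where
  "is_empirical_measure \<Phi> t x \<mu> \<longleftrightarrow> \<mu> \<in> borel_probs \<and>
     (\<forall>f :: 'a \<Rightarrow> real. continuous_on UNIV f \<longrightarrow>
        (\<integral>y. f y \<partial>\<mu>) = 1 / t * integral {0..t} (\<lambda>s. f (\<Phi> s x)))"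

definition p_omega :: "(real \<Rightarrow> 'a::topological_space \<Rightarrow> 'a) \<Rightarrow> 'a \<Rightarrow> 'a measure set" where
  "p_omega \<Phi> x =
     (\<Inter>T\<in>{0<..}. weak_star_topology closure_of {\<mu>. \<exists>t\<ge>T. is_empirical_measure \<Phi> t x \<mu>})"

text \<open>In the library, \<open>return borel p\<close> is the Dirac measure at \<open>p\<close>. Convex combinations of
  measures are described setwise, as there is no addition on the type of measures.\<close>

definition dirac_segment :: "'a::topological_space \<Rightarrow> 'a \<Rightarrow> 'a measure set" where
  "dirac_segment p q = {\<mu> \<in> borel_probs. \<exists>s\<in>{0..1}. \<forall>B\<in>sets borel.
     measure \<mu> B = s * measure (return borel p) B + (1 - s) * measure (return borel q) B}"

definition extreme_historic_behaviour :: "torus \<Rightarrow> torus \<Rightarrow> (real \<Rightarrow> torus \<Rightarrow> torus) \<Rightarrow> bool" where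
  "extreme_historic_behaviour p q \<Phi> \<longleftrightarrow> (AE x in torus_lebesgue. p_omega \<Phi> x = dirac_segment p q)"

end

theory Submission
  imports Defs "HOL-Real_Asymp.Real_Asymp" "HOL-Number_Theory.Cong"
begin

text \<open>The orbits are straight lines, traversed at speed \<open>\<phi>\<close>. Since \<open>\<phi>\<close> vanishes quadratically and
  nondegenerately at the stopping points, \<open>1 / \<phi>\<close> is comparable to \<open>1 / P + 1 / Q\<close>, where \<open>P\<close> and
  \<open>Q\<close> are explicit trigonometric squared distances to the two points. A line that crosses the
  vertical circle through the stopping points at distance \<open>d\<close> from one of them loses there a time of
  order \<open>1 / d\<close>.

  The angles are those with \<open>0 < q \<alpha> - p < exp (- q\<^sup>3)\<close> for infinitely many primes \<open>q\<close>. For such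
  \<open>q\<close> the crossing heights are nearly \<open>q\<close>-periodic and drift slowly upwards modulo \<open>1 / q\<close>. The two
  stopping points determine two different cosets of \<open>\<int> / q\<close>, because \<open>q\<close> does not divide the
  denominator of \<open>\<beta>\<close>. When the drift first takes the heights to one of the cosets, the time lost
  near the corresponding point is of order \<open>q\<^sup>3 / (q \<alpha> - p)\<close>, by a logarithmic sum, while the
  time lost near the other one is only of order \<open>q\<^sup>2 / (q \<alpha> - p)\<close>. For either coset, the initial
  conditions which meet it first form a set that has at scale \<open>1 / q\<close> a density bounded from below;
  so almost every orbit is, at suitable times, almost entirely concentrated near either point.\<close>

section \<open>Lattice distance along a line\<close>

text \<open>The cube in \<open>exp (- (real q ^ 3))\<close> is dictated by two competing estimates.
  The upper one is crude: until the grid is met, the relative height of the other point, multiplied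
  by \<open>q\<close>, stays \<open>1 / (2 b)\<close> away from the integers, where \<open>b\<close>
  is a denominator of \<beta>. The height itself is thus only known to be \<open>1 / (2 b q)\<close>
  away, and each unit of length is charged the inverse square of this, a factor of order
  \<open>q\<close> squared. The lower one gains the logarithm of the number of blocks of length
  \<open>q\<close> that precede the meeting. The angle makes that number at least about exp(q^3 /
  2), so the gain is of order \<open>q\<close> cubed and wins whatever the constants are.

  The band between \<open>1 / (4 b)\<close> and \<open>1 / (2 b)\<close> in \<open>approach\<close>
  has two purposes: its upper end keeps the drift away from the other grid, its lower end makes the
  drift last long.

  Along an orbit the time average of the speed \<phi> is the mean horizontal displacement. Every
  window of \<open>q\<close> crossings already costs a time of order \<open>q\<close> times ln
  \<open>q\<close>, whatever the phase, so this average tends to 0. Hence limit measures charge only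
  the two stopping points.\<close>

lemma abs_sin_pi_le: "\<bar>sin (pi * x)\<bar> \<le> pi * \<bar>x\<bar>" for x :: real
  using abs_sin_x_le_abs_x[of "pi * x"] by (simp add: abs_mult)

lemma sin_pi_int_cancel: "sin (pi * (x + of_int m)) = (if even m then sin (pi * x) else - sin (pi * x))" for x :: real
proof -
  have "sin (pi * of_int m) = 0" using sin_integer_2pi sin_int_times_real
    by (metis mult.commute sin_npi_int)
  moreover have "cos (pi * of_int m) = (if even m then 1 else -1)"
    by (metis cos_npi_int mult.commute)
  ultimately show ?thesis by (simp add: distrib_left sin_add)
qed

lemma abs_sin_pi_int_cancel: "\<bar>sin (pi * (x + of_int m))\<bar> = \<bar>sin (pi * x)\<bar>" for x :: real
  by (simp add: sin_pi_int_cancel)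

lemma abs_sin_pi_le_int: "\<bar>sin (pi * x)\<bar> \<le> pi * \<bar>x - of_int m\<bar>" for x :: real
  using abs_sin_pi_le[of "x - of_int m"] abs_sin_pi_int_cancel[of "x - of_int m" m] by simp

lemma abs_sin_add_le: "\<bar>sin (x + y)\<bar> \<le> \<bar>sin x\<bar> + \<bar>sin y\<bar>" for x y :: real
proof -
  have "\<bar>sin (x + y)\<bar> \<le> \<bar>sin x * cos y\<bar> + \<bar>cos x * sin y\<bar>"
    by (simp add: sin_add)
  also have "\<bar>sin x * cos y\<bar> \<le> \<bar>sin x\<bar> * 1" unfolding abs_mult by (intro mult_left_mono) auto
  also have "\<bar>cos x * sin y\<bar> \<le> 1 * \<bar>sin y\<bar>" unfolding abs_mult by (intro mult_right_mono) auto
  finally show ?thesis by simp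
qed

lemma abs_sin_mult_le: "\<bar>sin (real n * x)\<bar> \<le> real n * \<bar>sin x\<bar>"
proof (induction n)
  case (Suc n)
  have "\<bar>sin (real (Suc n) * x)\<bar> \<le> \<bar>sin (real n * x)\<bar> + \<bar>sin x\<bar>"
    using abs_sin_add_le[of "real n * x" x] by (simp add: algebra_simps)
  with Suc show ?case by (simp add: algebra_simps)
qed simp

text \<open>Up to \<open>1 / 3\<close> the cosine is at least \<open>1 / 2\<close>, so
  \<open>sin t - t / 2\<close> increases, and \<open>pi / 2\<close> exceeds 1. Beyond
  \<open>1 / 3\<close> the sine is already at least \<open>sin (pi / 6) = 1 / 2\<close>.\<close>

lemma abs_sin_pi_ge:
  fixes x :: real assumes "\<bar>x\<bar> \<le> 1 / 2" shows "\<bar>x\<bar> \<le> \<bar>sin (pi * x)\<bar>"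
proof -
  have *: "y \<le> sin (pi * y)" if "0 \<le> y" "y \<le> 1/2" for y :: real
  proof (cases "y \<le> 1 / 3")
    case True
    have "sin 0 - 0 / 2 \<le> sin (pi * y) - pi * y / 2"
    proof (rule DERIV_nonneg_imp_nondecreasing[of 0 "pi * y" "\<lambda>t. sin t - t / 2"])
      fix t assume t: "0 \<le> t" "t \<le> pi * y"
      have "pi * y \<le> pi * (1 / 3)" using True by (intro mult_left_mono) auto
      then have "t \<le> pi / 3" using t by linarith
      then have "cos (pi / 3) \<le> cos t" using t by (intro cos_monotone_0_pi_le) auto
      then have "0 \<le> cos t - 1 / 2" by (simp add: cos_60)
      moreover have "((\<lambda>t. sin t - t / 2) has_real_derivative cos t - 1 / 2) (at t)"
        by (rule derivative_eq_intros refl | simp)+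
      ultimately show "\<exists>D. ((\<lambda>t. sin t - t / 2) has_real_derivative D) (at t) \<and> 0 \<le> D"
        by blast
    next
      show "0 \<le> pi * y" using that by simp
    qed
    moreover have "2 * y \<le> pi * y" using that by (intro mult_right_mono pi_ge_two)
    ultimately show ?thesis by simp
  next
    case False
    have "sin (pi / 6) \<le> sin (pi * y)"
    proof (rule sin_monotone_2pi_le)
      have "pi * (1 / 6) \<le> pi * y" using False by (intro mult_left_mono) auto
      then show "pi / 6 \<le> pi * y" by simp
      have "pi * y \<le> pi * (1 / 2)" using that by (intro mult_left_mono) auto
      then show "pi * y \<le> pi / 2" by simp
      show "- (pi / 2) \<le> pi / 6" using pi_gt_zero by linarith
    qed
    then show ?thesis using that by (simp add: sin_30)
  qed
  show ?thesis
  proof (cases "x \<ge> 0")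
    case True then show ?thesis using *[of x] assms by auto
  next
    case False then show ?thesis using *[of "-x"] assms by auto
  qed
qed

lemma abs_sin_pi_ge_round: "\<bar>x - of_int (round x)\<bar> \<le> \<bar>sin (pi * x)\<bar>" for x :: real
  using abs_sin_pi_ge[of "x - of_int (round x)"] of_int_round_abs_le[of x]
    abs_sin_pi_int_cancel[of "x - of_int (round x)" "round x"] by (simp add: abs_minus_commute)

text \<open>On the line through \<open>(0, \<eta>)\<close> with slope \<open>\<alpha>\<close>, a smooth substitute for the squared distance
  to the integer lattice.\<close>

definition lat :: "real \<Rightarrow> real \<Rightarrow> real \<Rightarrow> real" where
  "lat \<eta> \<alpha> x = (sin (pi * x))\<^sup>2 + (sin (pi * (\<eta> + \<alpha> * x)))\<^sup>2"

lemma lat_nonneg: "0 \<le> lat \<eta> \<alpha> x" by (simp add: lat_def)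

lemma continuous_on_lat [continuous_intros]: "continuous_on A (lat \<eta> \<alpha>)"
  unfolding lat_def by (intro continuous_intros)

lemma lat_pos_iff:
  "0 < lat \<eta> \<alpha> x \<longleftrightarrow> \<not> (x \<in> \<int> \<and> \<eta> + \<alpha> * x \<in> \<int>)"
proof -
  have *: "sin (pi * y) = 0 \<longleftrightarrow> y \<in> \<int>" for y :: real
    by (auto simp: sin_zero_iff_int2 Ints_def)
  have "lat \<eta> \<alpha> x = 0 \<longleftrightarrow> (x \<in> \<int> \<and> \<eta> + \<alpha> * x \<in> \<int>)"
    unfolding lat_def by (simp add: sum_power2_eq_zero_iff *)
  then show ?thesis using lat_nonneg[of \<eta> \<alpha> x] by linarith
qed

lemma lat_pos:
  assumes "\<And>k :: nat. k \<ge> 1 \<Longrightarrow> \<eta> + \<alpha> * real k \<notin> \<int>" "0 < x"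
  shows "0 < lat \<eta> \<alpha> x"
proof -
  have "\<not> (x \<in> \<int> \<and> \<eta> + \<alpha> * x \<in> \<int>)"
  proof (intro notI, elim conjE)
    assume "x \<in> \<int>" and 2: "\<eta> + \<alpha> * x \<in> \<int>"
    then obtain k :: nat where "x = real k"
      by (metis Ints_cases assms(2) less_eq_real_def of_int_0_le_iff of_int_of_nat_eq zero_le_imp_eq_int)
    then show False using assms 2 by (metis One_nat_def Suc_leI of_nat_0_less_iff)
  qed
  then show ?thesis by (simp add: lat_pos_iff)
qed

lemma integrable_inverse_lat:
  assumes "\<And>x. x \<in> {a..b} \<Longrightarrow> 0 < lat \<eta> \<alpha> x"
  shows "(\<lambda>x. 1 / lat \<eta> \<alpha> x) integrable_on {a..b}"
  by (intro integrable_continuous_interval continuous_intros) (use assms in force)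

lemma integral_inverse_lat_mono:
  assumes "\<And>x. x \<in> {a..b} \<Longrightarrow> 0 < lat \<eta> \<alpha> x" "a \<le> c" "d \<le> b"
  shows "integral {c..d} (\<lambda>x. 1 / lat \<eta> \<alpha> x) \<le> integral {a..b} (\<lambda>x. 1 / lat \<eta> \<alpha> x)"
  by (intro integral_subset_le integrable_inverse_lat) (use assms in \<open>auto simp: lat_nonneg\<close>)

text \<open>One constant for both directions: \<open>lat_le\<close> uses it to bound
  \<open>lat\<close> above near a crossing, \<open>lat_ge\<close> to bound it below by the nearest
  crossing height. The factor \<open>2 + \<bar>\<alpha>\<bar>\<close> absorbs the change of height
  between \<open>x\<close> and an integer.\<close>

definition lat_const :: "real \<Rightarrow> real" where "lat_const \<alpha> = 2 * pi\<^sup>2 * (2 + \<bar>\<alpha>\<bar>)\<^sup>2"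

lemma lat_const_pos: "0 < lat_const \<alpha>"
  unfolding lat_const_def by (intro mult_pos_pos) (auto simp: abs_add_one_gt_zero add_pos_nonneg)

lemma lat_le:
  assumes "\<bar>\<eta> + \<alpha> * of_int k - of_int m\<bar> \<le> d" "\<bar>x - of_int k\<bar> \<le> d / 2"
  shows "2 * lat \<eta> \<alpha> x \<le> lat_const \<alpha> * d\<^sup>2"
proof -
  have "\<bar>sin (pi * x)\<bar>\<^sup>2 \<le> (pi * (d / 2))\<^sup>2"
    using order.trans[OF abs_sin_pi_le_int[of x k] mult_left_mono[OF assms(2) pi_ge_zero]]
    by (intro power_mono abs_ge_zero)
  moreover have "\<bar>sin (pi * (\<eta> + \<alpha> * x))\<bar> \<le> pi * (d + \<bar>\<alpha>\<bar> * (d / 2))"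
  proof -
    have "\<eta> + \<alpha> * x - of_int m = (\<eta> + \<alpha> * of_int k - of_int m) + \<alpha> * (x - of_int k)"
      by (simp add: algebra_simps)
    then have "\<bar>\<eta> + \<alpha> * x - of_int m\<bar> \<le> d + \<bar>\<alpha>\<bar> * \<bar>x - of_int k\<bar>"
      using assms(1) abs_triangle_ineq[of "\<eta> + \<alpha> * of_int k - of_int m" "\<alpha> * (x - of_int k)"]
      by (simp add: abs_mult)
    also have "\<dots> \<le> d + \<bar>\<alpha>\<bar> * (d / 2)" using assms(2) by (intro add_left_mono mult_left_mono) auto
    finally have "pi * \<bar>\<eta> + \<alpha> * x - of_int m\<bar> \<le> pi * (d + \<bar>\<alpha>\<bar> * (d / 2))"
      by (intro mult_left_mono pi_ge_zero)
    then show ?thesis using abs_sin_pi_le_int[of "\<eta> + \<alpha> * x" m] by linarith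
  qed
  then have "\<bar>sin (pi * (\<eta> + \<alpha> * x))\<bar>\<^sup>2 \<le> (pi * (d + \<bar>\<alpha>\<bar> * (d / 2)))\<^sup>2"
    by (intro power_mono) auto
  ultimately have "lat \<eta> \<alpha> x \<le> (pi * (d / 2))\<^sup>2 + (pi * (d + \<bar>\<alpha>\<bar> * (d / 2)))\<^sup>2"
    by (simp add: lat_def)
  also have "\<dots> = pi\<^sup>2 * d\<^sup>2 * (1 + (2 + \<bar>\<alpha>\<bar>)\<^sup>2) / 4"
    by (simp add: power2_eq_square algebra_simps)
  also have "\<dots> \<le> pi\<^sup>2 * d\<^sup>2 * (4 * (2 + \<bar>\<alpha>\<bar>)\<^sup>2) / 4"
  proof -
    have "1\<^sup>2 \<le> (2 + \<bar>\<alpha>\<bar>)\<^sup>2" by (intro power_mono) auto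
    then have "1 + (2 + \<bar>\<alpha>\<bar>)\<^sup>2 \<le> 4 * (2 + \<bar>\<alpha>\<bar>)\<^sup>2" unfolding one_power2 by linarith
    then show ?thesis by (intro divide_right_mono mult_left_mono) auto
  qed
  finally have "2 * lat \<eta> \<alpha> x \<le> 2 * (pi\<^sup>2 * d\<^sup>2 * (4 * (2 + \<bar>\<alpha>\<bar>)\<^sup>2) / 4)" by simp
  also have "\<dots> = lat_const \<alpha> * d\<^sup>2" by (simp add: lat_const_def)
  finally show ?thesis .
qed

text \<open>A crossing that misses the lattice by \<open>d\<close> costs a time of order
  \<open>1 / d\<close>: on the interval of length \<open>d / 2\<close> behind it the integrand is at
  least \<open>2 / (lat_const \<alpha> * d^2)\<close>. The bound \<open>d \<le> 2\<close> keeps this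
  interval inside the unit interval.\<close>

lemma integral_unit_ge:
  assumes "0 < d" "d \<le> 2" "\<bar>\<eta> + \<alpha> * of_int k - of_int m\<bar> \<le> d"
    and pos: "\<And>x. x \<in> {of_int k..of_int k + 1} \<Longrightarrow> 0 < lat \<eta> \<alpha> x"
  shows "1 / (lat_const \<alpha> * d) \<le> integral {of_int k..of_int k + 1} (\<lambda>x. 1 / lat \<eta> \<alpha> x)"
proof -
  let ?f = "\<lambda>x. 1 / lat \<eta> \<alpha> x" and ?I = "{of_int k..of_int k + d / 2} :: real set"
  have K: "0 < lat_const \<alpha>" by (rule lat_const_pos)
  have "1 / (lat_const \<alpha> * d) = integral ?I (\<lambda>x. 2 / (lat_const \<alpha> * d\<^sup>2))"
    using assms(1) by (simp add: power2_eq_square field_simps)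
  also have "\<dots> \<le> integral ?I ?f"
  proof (rule integral_le)
    show "?f integrable_on ?I" using assms by (intro integrable_inverse_lat) auto
    fix x :: real assume "x \<in> ?I"
    then have "0 < lat \<eta> \<alpha> x" "2 * lat \<eta> \<alpha> x \<le> lat_const \<alpha> * d\<^sup>2"
      using assms lat_le[of \<eta> \<alpha> k m d x] by auto
    then show "2 / (lat_const \<alpha> * d\<^sup>2) \<le> ?f x"
      using K assms(1) by (simp add: field_simps)
  qed (simp add: integrable_const_ivl)
  also have "\<dots> \<le> integral {of_int k..of_int k + 1} ?f"
    using assms by (intro integral_inverse_lat_mono pos) auto
  finally show ?thesis .
qed

text \<open>Sliding along the line to the nearest integer \<open>k\<close> changes the height by
  \<open>\<alpha> * (k - x)\<close>, and \<open>\<bar>x - k\<bar>\<close> is at most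
  \<open>\<bar>sin (pi * x)\<bar>\<close>. Lower bounds for \<open>lat\<close> are thereby reduced
  to integer abscissas.\<close>

lemma lat_ge:
  assumes k: "k = round x"
  shows "(sin (pi * (\<eta> + \<alpha> * of_int k)))\<^sup>2 \<le> lat_const \<alpha> * lat \<eta> \<alpha> x"
proof -
  define A where "A = \<bar>sin (pi * (\<eta> + \<alpha> * x))\<bar>"
  define B where "B = \<bar>sin (pi * x)\<bar>"
  have 1: "\<bar>x - of_int k\<bar> \<le> B" using abs_sin_pi_ge_round[of x] by (simp add: k B_def)
  have "\<bar>sin (pi * (\<eta> + \<alpha> * of_int k))\<bar> \<le> A + \<bar>sin (pi * (\<alpha> * (of_int k - x)))\<bar>"
    using abs_sin_add_le[of "pi * (\<eta> + \<alpha> * x)" "pi * (\<alpha> * (of_int k - x))"]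
    by (simp add: A_def algebra_simps)
  also have "\<bar>sin (pi * (\<alpha> * (of_int k - x)))\<bar> \<le> pi * \<bar>\<alpha>\<bar> * \<bar>x - of_int k\<bar>"
    using abs_sin_pi_le[of "\<alpha> * (of_int k - x)"] by (simp add: abs_mult abs_minus_commute mult.assoc)
  also have "\<dots> \<le> pi * \<bar>\<alpha>\<bar> * B" using 1 by (intro mult_left_mono) auto
  finally have "\<bar>sin (pi * (\<eta> + \<alpha> * of_int k))\<bar> \<le> A + pi * \<bar>\<alpha>\<bar> * B" by simp
  also have "\<dots> \<le> pi * (2 + \<bar>\<alpha>\<bar>) * A + pi * (2 + \<bar>\<alpha>\<bar>) * B"
  proof -
    have "1 * A \<le> pi * (2 + \<bar>\<alpha>\<bar>) * A"
      using pi_ge_two mult_mono[of 1 pi 1 "2 + \<bar>\<alpha>\<bar>"] by (intro mult_right_mono) (auto simp: A_def)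
    moreover have "pi * \<bar>\<alpha>\<bar> * B \<le> pi * (2 + \<bar>\<alpha>\<bar>) * B"
      by (intro mult_right_mono mult_left_mono) (auto simp: B_def)
    ultimately show ?thesis by linarith
  qed
  also have "\<dots> = pi * (2 + \<bar>\<alpha>\<bar>) * (A + B)" by (simp add: algebra_simps)
  finally have "\<bar>sin (pi * (\<eta> + \<alpha> * of_int k))\<bar>\<^sup>2 \<le> (pi * (2 + \<bar>\<alpha>\<bar>) * (A + B))\<^sup>2"
    by (intro power_mono) auto
  also have "\<dots> = pi\<^sup>2 * (2 + \<bar>\<alpha>\<bar>)\<^sup>2 * (A + B)\<^sup>2" by (simp add: power_mult_distrib)
  also have "\<dots> \<le> pi\<^sup>2 * (2 + \<bar>\<alpha>\<bar>)\<^sup>2 * (2 * (A\<^sup>2 + B\<^sup>2))"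
    using sum_squares_ge_zero[of "A - B" 0]
    by (intro mult_left_mono) (auto simp: power2_eq_square algebra_simps)
  also have "\<dots> = lat_const \<alpha> * lat \<eta> \<alpha> x"
    by (simp add: lat_const_def lat_def A_def B_def)
  finally show ?thesis by simp
qed

lemma integral_inverse_lat_le:
  assumes s: "0 < s" "\<And>k. k \<le> N \<Longrightarrow> s \<le> \<bar>sin (pi * (\<eta> + \<alpha> * real k))\<bar>" and x: "0 \<le> x0" "x0 \<le> real N"
  shows "integral {x0..real N} (\<lambda>x. 1 / lat \<eta> \<alpha> x) \<le> lat_const \<alpha> / s\<^sup>2 * real N"
proof -
  have K: "0 < lat_const \<alpha>" by (rule lat_const_pos)
  have *: "s\<^sup>2 \<le> lat_const \<alpha> * lat \<eta> \<alpha> x" if "x \<in> {x0..real N}" for x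
  proof -
    have r: "round x \<ge> 0" "round x \<le> int N"
      using that x round_mono[of 0 x] round_mono[of x "real N"] by auto
    then have "of_int (round x) = real (nat (round x))" by simp
    then have "s \<le> \<bar>sin (pi * (\<eta> + \<alpha> * of_int (round x)))\<bar>"
      using s(2)[of "nat (round x)"] r by simp
    then have "s\<^sup>2 \<le> \<bar>sin (pi * (\<eta> + \<alpha> * of_int (round x)))\<bar>\<^sup>2"
      using s(1) by (intro power_mono) simp_all
    then show ?thesis using lat_ge[OF refl, of \<eta> \<alpha> x] by simp
  qed
  have pos: "0 < lat \<eta> \<alpha> x" if "x \<in> {x0..real N}" for x
  proof -
    have "0 < lat_const \<alpha> * lat \<eta> \<alpha> x" using *[OF that] s(1) by (auto intro: less_le_trans[rotated])
    then show ?thesis using K by (simp add: zero_less_mult_iff)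
  qed
  have "integral {x0..real N} (\<lambda>x. 1 / lat \<eta> \<alpha> x) \<le> integral {x0..real N} (\<lambda>x. lat_const \<alpha> / s\<^sup>2)"
  proof (rule integral_le)
    fix x assume x: "x \<in> {x0..real N}"
    show "1 / lat \<eta> \<alpha> x \<le> lat_const \<alpha> / s\<^sup>2"
      using *[OF x] pos[OF x] s(1) by (simp add: field_simps)
  qed (use pos in \<open>auto intro: integrable_inverse_lat\<close>)
  also have "\<dots> = lat_const \<alpha> / s\<^sup>2 * (real N - x0)" using x by simp
  also have "\<dots> \<le> lat_const \<alpha> / s\<^sup>2 * real N" using x K by (intro mult_left_mono) auto
  finally show ?thesis .
qed

section \<open>Drift of the crossing heights\<close>

text \<open>With an inverse \<open>r\<close> of \<open>p\<close> modulo \<open>q\<close>, the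
  solutions are the residue class of \<open>- l * r\<close>, which meets every block of
  \<open>q\<close> consecutive integers.\<close>

lemma exists_residue:
  fixes p a l :: int
  assumes "coprime p (int q)" "0 < q"
  shows "\<exists>k\<in>{a..<a + int q}. int q dvd k * p + l"
proof -
  obtain r where r: "[p * r = 1] (mod int q)"
    using cong_solve_coprime_int[OF assms(1)] by auto
  define k where "k = a + (- l * r - a) mod int q"
  have "[k = a + (- l * r - a)] (mod int q)"
    unfolding k_def by (intro cong_add cong_refl) (simp add: cong_def)
  then have "[k * p + l = (- l * r) * p + l] (mod int q)"
    by (intro cong_add cong_mult cong_refl) simp_all
  also have "(- l * r) * p + l = - l * (p * r) + l" by simp
  also have "[- l * (p * r) + l = - l * 1 + l] (mod int q)"
    using r by (intro cong_add cong_mult cong_refl)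
  finally have "int q dvd k * p + l" by (simp add: cong_0_iff)
  moreover have "k \<in> {a..<a + int q}" using assms(2) by (auto simp: k_def)
  ultimately show ?thesis by blast
qed

text \<open>Here \<sigma> is the drift of \<open>q\<close> times the height per crossing and \<rho>
  the initial gap to the integer \<open>j\<close>, so \<open>N\<close> is the last crossing before
  the gap closes. If \<open>q\<close> divides \<open>k * p + j\<close>, the height at
  \<open>k\<close> misses an integer by \<open>(\<rho> - k * \<sigma>) / q\<close>. Blocks of length
  \<open>q\<close> are counted backwards from \<open>N\<close>; the one numbered
  \<open>Suc J\<close> contains such a \<open>k\<close>, with a miss of at most
  \<open>2 * Suc J * \<sigma>\<close>. The costs are thus proportional to \<open>1 / Suc J\<close>,
  and their sum is the harmonic number that supplies the logarithm.\<close>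

lemma drift_integral_ge:
  fixes \<eta> \<alpha> \<sigma> \<rho> :: real and p j :: int
  assumes q: "0 < q" "coprime p (int q)" and \<sigma>: "\<sigma> = real q * \<alpha> - of_int p" "0 < \<sigma>"
    and \<rho>: "real q * \<eta> = of_int j - \<rho>" "\<rho> \<le> 1" and N: "real N * \<sigma> \<le> \<rho>" "\<rho> < (real N + 1) * \<sigma>"
    and pos: "\<And>x. 0 < x \<Longrightarrow> 0 < lat \<eta> \<alpha> x" and J: "J * q < N"
  shows "harm J / (2 * lat_const \<alpha> * \<sigma>) \<le> integral {real (N - J * q)..real N} (\<lambda>x. 1 / lat \<eta> \<alpha> x)"
  using J
proof (induction J)
  case 0
  then show ?case by (simp add: harm_def)
next
  case (Suc J)
  let ?f = "\<lambda>x. 1 / lat \<eta> \<alpha> x"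
  define a where "a = N - Suc J * q"
  have a: "a \<ge> 1" "N - J * q = a + q" "a + Suc J * q = N" using Suc.prems by (auto simp: a_def)
  obtain k where k: "k \<in> {int a..<int a + int q}" "int q dvd k * p + j"
    using exists_residue[OF q(2,1)] by blast
  then obtain m where m: "k * p + j = int q * m" by blast
  have m': "of_int k * of_int p + of_int j = real q * of_int m"
    using arg_cong[OF m, of real_of_int] by simp
  have eq: "\<eta> + \<alpha> * of_int k - of_int m = (of_int k * \<sigma> - \<rho>) / real q"
  proof -
    have "real q * (\<eta> + \<alpha> * of_int k - of_int m) = of_int k * \<sigma> - \<rho>"
      using m' \<rho>(1) by (simp add: \<sigma> algebra_simps)
    then show ?thesis using q by (simp add: field_simps)
  qed
  have k1: "real_of_int k \<le> real N" "real_of_int k \<ge> real a" "real_of_int k + 1 \<le> real (a + q)"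
    using k(1) a by (auto simp: le_diff_eq)
  \<comment> \<open>The \<open>+ 1\<close> stems from \<open>\<rho> < (N + 1) * \<sigma>\<close>;
    since \<open>Suc J * q\<close> is at least 1, doubling absorbs it.\<close>
  have Nk: "real N - real_of_int k + 1 \<le> 2 * (real (Suc J) * real q)"
  proof -
    have "real N = real a + real (Suc J) * real q" using a(3) by (metis of_nat_add of_nat_mult)
    moreover have "1 * 1 \<le> real (Suc J) * real q" using q by (intro mult_mono) auto
    ultimately show ?thesis using k1(2) by linarith
  qed
  have le: "real_of_int k * \<sigma> \<le> \<rho>"
    using k1(1) \<sigma>(2) N(1) mult_right_mono[of "real_of_int k" "real N" \<sigma>] by linarith
  have "\<rho> - real_of_int k * \<sigma> \<le> (real N - real_of_int k + 1) * \<sigma>"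
    using N(2) by (simp add: algebra_simps)
  also have "\<dots> \<le> 2 * (real (Suc J) * real q) * \<sigma>" using Nk \<sigma>(2) by (intro mult_right_mono) auto
  finally have "(\<rho> - real_of_int k * \<sigma>) / real q \<le> 2 * real (Suc J) * \<sigma>"
    using q by (simp add: field_simps)
  then have d: "\<bar>\<eta> + \<alpha> * of_int k - of_int m\<bar> \<le> 2 * real (Suc J) * \<sigma>"
    unfolding eq using le q by (simp add: abs_divide abs_of_nonpos)
  have "real (Suc J) * \<sigma> \<le> real N * \<sigma>"
  proof (intro mult_right_mono)
    have "Suc J * 1 \<le> Suc J * q" using q by (intro mult_left_mono) auto
    then show "real (Suc J) \<le> real N" using Suc.prems by simp
  qed (use \<sigma> in auto)
  then have d2: "2 * real (Suc J) * \<sigma> \<le> 2" using N(1) \<rho>(2) by linarith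
  have "1 / (lat_const \<alpha> * (2 * real (Suc J) * \<sigma>)) \<le> integral {of_int k..of_int k + 1} ?f"
    using d d2 \<sigma>(2) k1(2) a(1) by (intro integral_unit_ge pos) auto
  also have "\<dots> \<le> integral {real a..real (a + q)} ?f"
    using k1 a(1) by (intro integral_inverse_lat_mono pos) auto
  finally have 1: "1 / (lat_const \<alpha> * (2 * real (Suc J) * \<sigma>)) \<le> integral {real a..real (a + q)} ?f" .
  have "integral {real a..real N} ?f = integral {real a..real (a + q)} ?f + integral {real (a + q)..real N} ?f"
    using a Suc.prems by (intro Henstock_Kurzweil_Integration.integral_combine[symmetric] integrable_inverse_lat pos) auto
  moreover have "harm J / (2 * lat_const \<alpha> * \<sigma>) \<le> integral {real (a + q)..real N} ?f"
    using Suc.IH Suc.prems a(2) by simp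
  moreover have "harm (Suc J) / (2 * lat_const \<alpha> * \<sigma>)
      = harm J / (2 * lat_const \<alpha> * \<sigma>) + 1 / (lat_const \<alpha> * (2 * real (Suc J) * \<sigma>))"
    by (simp add: harm_Suc add_divide_distrib inverse_eq_divide mult_ac)
  ultimately show ?case using 1 by (simp add: a_def)
qed

text \<open>Multiplied by \<open>q\<close>, the heights at \<open>a + i\<close> are
  \<open>l + r + i * p + i * \<sigma>\<close>, where \<open>r\<close> and
  \<open>i * \<sigma>\<close> lie between 0 and 1. The integers \<open>i * p + l\<close> run once
  through all residues \<open>c\<close> modulo \<open>q\<close>, so the misses are at most
  \<open>(c + 2) / q\<close>, and the reciprocals sum to a logarithm. The bound holds for every
  phase \<eta> and every position \<open>a \<ge> 1\<close> of the window.\<close>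

lemma window_integral_ge:
  fixes \<eta> \<alpha> \<sigma> :: real and p :: int
  assumes q: "0 < q" "coprime p (int q)" and \<sigma>: "\<sigma> = real q * \<alpha> - of_int p" "0 < \<sigma>" "real q * \<sigma> \<le> 1"
    and pos: "\<And>x. 0 < x \<Longrightarrow> 0 < lat \<eta> \<alpha> x" and a: "1 \<le> a"
  shows "real q * (ln (real q + 2) - 1) / lat_const \<alpha> \<le> integral {real a..real (a + q)} (\<lambda>x. 1 / lat \<eta> \<alpha> x)"
proof -
  let ?f = "\<lambda>x. 1 / lat \<eta> \<alpha> x"
  define l where "l = \<lfloor>real q * (\<eta> + \<alpha> * real a)\<rfloor>"
  define c where "c i = nat ((int i * p + l) mod int q)" for i :: nat
  have inj: "inj_on c {..<q}"
  proof (rule inj_onI)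
    fix i i' assume *: "i \<in> {..<q}" "i' \<in> {..<q}" "c i = c i'"
    then have "[int i * p + l = int i' * p + l] (mod int q)"
      using q by (simp add: c_def cong_def nat_eq_iff)
    then have "[int i * p = int i' * p] (mod int q)" by (simp add: cong_add_rcancel)
    then have "[int i = int i'] (mod int q)" using q(2) by (simp add: cong_mult_rcancel)
    then show "i = i'" using * by (simp add: cong_def)
  qed
  have "c ` {..<q} \<subseteq> {..<q}" using q by (auto simp: c_def nat_less_iff)
  then have bij: "bij_betw c {..<q} {..<q}"
    using inj by (simp add: bij_betw_def endo_inj_surj)
  have unit: "real q / (lat_const \<alpha> * (real (c i) + 2))
      \<le> integral {real (a + i)..real (a + i) + 1} ?f" if i: "i < q" for i
  proof -
    obtain m where m: "int i * p + l = int q * m + int (c i)"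
      using q by (metis c_def mult_div_mod_eq nat_0_le of_nat_0_less_iff pos_mod_sign)
    define r where "r = frac (real q * (\<eta> + \<alpha> * real a))"
    have r: "0 \<le> r" "r < 1" by (auto simp: r_def frac_lt_1)
    have l: "real q * (\<eta> + \<alpha> * real a) = of_int l + r" by (simp add: r_def l_def frac_def)
    have m': "real i * of_int p + of_int l = real q * of_int m + real (c i)"
      using arg_cong[OF m, of real_of_int] by simp
    have i\<sigma>: "0 \<le> real i * \<sigma>" "real i * \<sigma> \<le> 1"
    proof -
      have "real i * \<sigma> \<le> real q * \<sigma>" using i \<sigma>(2) by (intro mult_right_mono) auto
      then show "real i * \<sigma> \<le> 1" using \<sigma>(3) by linarith
      show "0 \<le> real i * \<sigma>" using \<sigma>(2) by simp
    qed
    have eq: "real q * (\<eta> + \<alpha> * of_int (int (a + i)) - of_int m) = real (c i) + r + real i * \<sigma>"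
      using l m' by (simp add: \<sigma> algebra_simps)
    have "real q * \<bar>\<eta> + \<alpha> * of_int (int (a + i)) - of_int m\<bar> = \<bar>real (c i) + r + real i * \<sigma>\<bar>"
      unfolding eq[symmetric] by (simp add: abs_mult)
    also have "\<dots> \<le> real (c i) + 2" using r i\<sigma> by simp
    finally have d: "\<bar>\<eta> + \<alpha> * of_int (int (a + i)) - of_int m\<bar> \<le> (real (c i) + 2) / real q"
      using q by (simp add: field_simps)
    have "c i < q" using \<open>c ` {..<q} \<subseteq> {..<q}\<close> i by auto
    then have d2: "(real (c i) + 2) / real q \<le> 2" using q by (simp add: field_simps)
    have "1 / (lat_const \<alpha> * ((real (c i) + 2) / real q)) \<le> integral {of_int (int (a + i))..of_int (int (a + i)) + 1} ?f"
      using q a by (intro integral_unit_ge[OF _ d2 d] pos) auto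
    then show ?thesis by simp
  qed
  have split: "integral {real a..real (a + n)} ?f = (\<Sum>i<n. integral {real (a + i)..real (a + i) + 1} ?f)" for n
  proof (induction n)
    case (Suc n)
    have "integral {real a..real (a + Suc n)} ?f = integral {real a..real (a + n)} ?f + integral {real (a + n)..real (a + Suc n)} ?f"
      using a by (intro Henstock_Kurzweil_Integration.integral_combine[symmetric] integrable_inverse_lat pos) auto
    with Suc show ?case by (simp add: add.commute add.left_commute)
  qed simp
  have harm: "(\<Sum>j<q. 1 / (real j + 2)) = harm (Suc q) - 1" for q
  proof (induction q)
    case (Suc q)
    then show ?case using harm_Suc[of "Suc q", where ?'a = real] by (simp add: inverse_eq_divide add.commute)
  qed (simp add: harm_def)
  have "real q * (ln (real q + 2) - 1) / lat_const \<alpha> \<le> real q / lat_const \<alpha> * (harm (Suc q) - 1)"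
    using harm_ge_ln[of "Suc q"] lat_const_pos[of \<alpha>]
    by (simp add: divide_right_mono mult_left_mono add.commute)
  also have "\<dots> = real q / lat_const \<alpha> * (\<Sum>i<q. 1 / (real (c i) + 2))"
    unfolding harm[symmetric] by (subst sum.reindex_bij_betw[OF bij]) simp
  also have "\<dots> = (\<Sum>i<q. real q / (lat_const \<alpha> * (real (c i) + 2)))"
    by (simp add: sum_distrib_left)
  also have "\<dots> \<le> integral {real a..real (a + q)} ?f"
    unfolding split by (intro sum_mono unit) auto
  finally show ?thesis .
qed

definition well_approximated :: "nat \<Rightarrow> int \<Rightarrow> real \<Rightarrow> bool" where
  "well_approximated q p \<alpha> \<longleftrightarrow> prime q \<and> coprime p (int q) \<and>
     0 < real q * \<alpha> - of_int p \<and> real q * \<alpha> - of_int p < exp (- (real q ^ 3))"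

lemma well_approximated_le:
  assumes "well_approximated q p \<alpha>"
  shows "real q * (real q * \<alpha> - of_int p) \<le> 1"
proof -
  have "real q * (real q * \<alpha> - of_int p) \<le> real q * exp (- (real q ^ 3))"
    using assms by (intro mult_left_mono) (auto simp: well_approximated_def)
  also have "\<dots> \<le> 1"
  proof -
    have "q \<le> q ^ 3" by (cases "q = 0") (auto intro: self_le_power)
    then have "real q \<le> real q ^ 3" by (metis of_nat_le_iff of_nat_power)
    then have "real q \<le> exp (real q ^ 3)" using exp_ge_add_one_self[of "real q ^ 3"] by linarith
    then show ?thesis by (simp add: exp_minus field_simps)
  qed
  finally show ?thesis .
qed

text \<open>A single \<open>q\<close> with \<open>ln (q + 2)\<close> large against \<open>M\<close>
  is enough: the line is tiled by windows of length \<open>q\<close>, each worth at least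
  \<open>2 * M * q\<close>. The factor 2 pays for the incomplete last window.\<close>

lemma integral_inverse_lat_superlinear:
  assumes \<alpha>: "\<And>n. \<exists>q\<ge>n. \<exists>p. well_approximated q p \<alpha>"
    and pos: "\<And>x. 0 < x \<Longrightarrow> 0 < lat \<eta> \<alpha> x" and x0: "0 < x0" "x0 \<le> 1" and M: "0 \<le> M"
  shows "\<exists>X0. \<forall>X\<ge>X0. M * X \<le> integral {x0..X} (\<lambda>x. 1 / lat \<eta> \<alpha> x)"
proof -
  let ?f = "\<lambda>x. 1 / lat \<eta> \<alpha> x"
  have K: "0 < lat_const \<alpha>" by (rule lat_const_pos)
  obtain n :: nat where n: "real n \<ge> exp (2 * M * lat_const \<alpha> + 1)" using real_arch_simple by blast
  obtain q p where "q \<ge> n" and q: "well_approximated q p \<alpha>" using \<alpha> by blast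
  have q0: "0 < q" using q by (simp add: well_approximated_def prime_gt_0_nat)
  have "2 * M * lat_const \<alpha> + 1 \<le> ln (real q + 2)"
    using n \<open>q \<ge> n\<close> by (subst ln_ge_iff) auto
  then have "2 * M \<le> (ln (real q + 2) - 1) / lat_const \<alpha>" using K by (simp add: field_simps)
  then have "real q * (2 * M) \<le> real q * ((ln (real q + 2) - 1) / lat_const \<alpha>)"
    by (intro mult_left_mono) auto
  then have big: "2 * M * real q \<le> real q * (ln (real q + 2) - 1) / lat_const \<alpha>"
    by (simp add: mult_ac)
  have win: "2 * M * real q * real i \<le> integral {1..real (1 + i * q)} ?f" for i
  proof (induction i)
    case (Suc i)
    have "2 * M * real q \<le> integral {real (1 + i * q)..real (1 + i * q + q)} ?f"
      using q q0 well_approximated_le[OF q] 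
      by (intro order.trans[OF big] window_integral_ge[OF _ _ refl] pos) (auto simp: well_approximated_def)
    moreover have "integral {1..real (1 + Suc i * q)} ?f = integral {1..real (1 + i * q)} ?f
        + integral {real (1 + i * q)..real (1 + Suc i * q)} ?f"
      by (intro Henstock_Kurzweil_Integration.integral_combine[symmetric] integrable_inverse_lat pos) auto
    ultimately show ?case using Suc by (simp add: algebra_simps)
  qed simp
  show ?thesis
  proof (intro exI allI impI)
    \<comment> \<open>From this threshold on, the complete windows cover at least half of
      \<open>X\<close>.\<close>
    fix X assume X: "2 * real q + 2 \<le> X"
    define i where "i = nat \<lfloor>(X - 1) / real q\<rfloor>"
    have "0 \<le> (X - 1) / real q" using X q0 by auto
    then have "real i \<le> (X - 1) / real q" "(X - 1) / real q < real i + 1"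
      by (auto simp: i_def)
    then have i: "real i * real q \<le> X - 1" "X - 1 < real i * real q + real q"
      using q0 by (auto simp: field_simps)
    have "X \<le> 2 * real q * real i" using i X by (simp add: mult.commute)
    then have "M * X \<le> 2 * M * real q * real i" using M mult_left_mono[of X "2 * q * i" M] by (simp add: mult_ac)
    also have "\<dots> \<le> integral {1..real (1 + i * q)} ?f" by (rule win)
    also have "\<dots> \<le> integral {x0..X} ?f"
      using x0 i by (intro integral_inverse_lat_mono pos) auto
    finally show "M * X \<le> integral {x0..X} ?f" .
  qed
qed

text \<open>For \<open>\<eta>\<close> in this set the heights \<open>\<eta> + \<alpha> k\<close>, which drift upwards modulo \<open>1 / q\<close> at speed
  \<open>\<alpha> - p / q\<close>, meet the grid \<open>\<int> / q\<close> before they come close to any grid \<open>\<beta> + \<int> / q\<close> with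
  \<open>b \<beta> \<in> \<int>\<close>, \<open>q \<beta> \<notin> \<int>\<close>.\<close>

definition approach :: "nat \<Rightarrow> nat \<Rightarrow> real set" where
  "approach b q = {\<eta>. \<exists>j :: int. 1 / (4 * real b) < of_int j - real q * \<eta> \<and> of_int j - real q * \<eta> < 1 / (2 * real b)}"

text \<open>An integer height at \<open>k\<close> would make \<open>\<rho> - k * \<sigma>\<close> an
  integer, where \<rho> is the gap in \<open>approach\<close>. But \<rho> exceeds
  \<open>1 / (4 b)\<close>, the drift up to \<open>k\<close> is smaller than that, and \<rho> is
  below 1, so the number lies strictly between 0 and 1.\<close>

lemma approach_imp_not_Ints:
  assumes \<alpha>: "well_approximated q p \<alpha>" and \<eta>: "\<eta> \<in> approach b q" and b: "1 \<le> b"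
    and k: "real k * exp (- (real q ^ 3)) < 1 / (4 * real b)"
  shows "\<eta> + \<alpha> * real k \<notin> \<int>"
proof
  assume "\<eta> + \<alpha> * real k \<in> \<int>"
  then obtain m where m: "\<eta> + \<alpha> * real k = of_int m" by (auto elim: Ints_cases)
  obtain j :: int where j: "1 / (4 * real b) < of_int j - real q * \<eta>" "of_int j - real q * \<eta> < 1 / (2 * real b)"
    using \<eta> by (auto simp: approach_def)
  define \<sigma> where "\<sigma> = real q * \<alpha> - of_int p"
  have \<sigma>: "0 < \<sigma>" "\<sigma> < exp (- (real q ^ 3))" using \<alpha> by (auto simp: \<sigma>_def well_approximated_def)
  then have "real k * \<sigma> \<le> real k * exp (- (real q ^ 3))" by (intro mult_left_mono) auto
  then have "real k * \<sigma> < 1 / (4 * real b)" "0 \<le> real k * \<sigma>" using k \<sigma> by auto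
  moreover have "of_int j - real q * \<eta> - real k * \<sigma> = of_int (j - int q * m + int k * p)"
    using arg_cong[OF m, of "\<lambda>x. real q * x"] by (simp add: \<sigma>_def algebra_simps)
  moreover have "1 / (2 * real b) \<le> 1" using b by (simp add: field_simps)
  ultimately have "0 < real_of_int (j - int q * m + int k * p)" "real_of_int (j - int q * m + int k * p) < 1"
    using j by linarith+
  then show False unfolding of_int_0_less_iff of_int_less_1_iff by linarith
qed

text \<open>A nonintegral multiple of \<open>1 / b\<close> is at least \<open>1 / b\<close> away
  from every integer; half of this survives an offset of at most \<open>1 / (2 b)\<close>, which
  explains the upper end of the band in \<open>approach\<close>.\<close>

lemma abs_sin_pi_offset_ge:
  assumes b: "1 \<le> b" "real b * y \<in> \<int>" "y \<notin> \<int>" and \<theta>: "0 \<le> \<theta>" "\<theta> \<le> 1 / (2 * real b)"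
  shows "1 / (2 * real b) \<le> \<bar>sin (pi * (y + \<theta>))\<bar>"
proof -
  define m where "m = round (y + \<theta>)"
  obtain c where c: "real b * y = of_int c" using b by (auto elim: Ints_cases)
  have "c - int b * m \<noteq> 0"
  proof
    assume "c - int b * m = 0"
    then have "real b * y = real b * of_int m" using c by simp
    then have "y = of_int m" using b by simp
    then show False using b by simp
  qed
  then have "1 \<le> \<bar>real_of_int (c - int b * m)\<bar>" by linarith
  also have "real_of_int (c - int b * m) = real b * (y - of_int m)" using c by (simp add: algebra_simps)
  finally have "1 / real b \<le> \<bar>y - of_int m\<bar>" using b by (simp add: abs_mult pos_divide_le_eq mult.commute)
  then have "1 / real b - 1 / (2 * real b) \<le> \<bar>y + \<theta> - of_int m\<bar>" using \<theta> by linarith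
  moreover have "1 / real b - 1 / (2 * real b) = 1 / (2 * real b)" using b by (simp add: field_simps)
  ultimately show ?thesis using abs_sin_pi_ge_round[of "y + \<theta>"] by (simp add: m_def)
qed

text \<open>Both integrals are compared at \<open>X = N\<close>, the last crossing before the drift
  closes the gap to the grid of the first point. They are of orders \<open>q^2 / \<sigma>\<close> at
  most and \<open>q^3 / \<sigma>\<close> at least, so a large \<open>q\<close> beats any
  \<epsilon>.\<close>

lemma integral_inverse_lat_dominates:
  assumes b: "1 \<le> b" "real b * \<beta> \<in> \<int>" and \<epsilon>: "0 < \<epsilon>"
    and freq: "\<And>n. \<exists>q\<ge>n. \<exists>p. well_approximated q p \<alpha> \<and> real q * \<beta> \<notin> \<int> \<and> \<eta> \<in> approach b q"
    and pos: "\<And>x. 0 < x \<Longrightarrow> 0 < lat \<eta> \<alpha> x" and x0: "0 < x0" "x0 \<le> 1"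
  shows "\<exists>X\<ge>X0. integral {x0..X} (\<lambda>x. 1 / lat (\<eta> - \<beta>) \<alpha> x) \<le> \<epsilon> * integral {x0..X} (\<lambda>x. 1 / lat \<eta> \<alpha> x)"
proof -
  let ?f = "\<lambda>x. 1 / lat \<eta> \<alpha> x"
  define K where "K = lat_const \<alpha>"
  have K: "0 < K" by (simp add: K_def lat_const_pos)
  define B where "B = real b"
  have B: "1 \<le> B" using b by (simp add: B_def)
  \<comment> \<open>Three demands on \<open>q\<close>: \<open>N\<close> passes \<open>X0\<close>,
    the number of blocks is, up to one, at least \<open>exp (q^3 / 2)\<close>, and half the cube
    outweighs the constants collected in the final chain of inequalities.\<close>
  have "eventually (\<lambda>q :: nat. exp (real q ^ 3) / (4 * B) - 2 \<ge> X0 + 2) at_top"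
    using B by real_asymp
  moreover have "eventually (\<lambda>q :: nat. (exp (real q ^ 3) / (4 * B) - 2) / real q \<ge> exp (real q ^ 3 / 2)) at_top"
    using B by real_asymp
  moreover have "eventually (\<lambda>q :: nat. 8 * K\<^sup>2 * B\<^sup>2 * real q ^ 2 \<le> \<epsilon> * (real q ^ 3 / 2)) at_top"
    using B K \<epsilon> by real_asymp
  ultimately have "eventually (\<lambda>q :: nat. exp (real q ^ 3) / (4 * B) - 2 \<ge> X0 + 2 \<and>
      (exp (real q ^ 3) / (4 * B) - 2) / real q \<ge> exp (real q ^ 3 / 2) \<and>
      8 * K\<^sup>2 * B\<^sup>2 * real q ^ 2 \<le> \<epsilon> * (real q ^ 3 / 2)) at_top"
    by (intro eventually_conj)
  then obtain n where n: "\<And>q. q \<ge> n \<Longrightarrow> exp (real q ^ 3) / (4 * B) - 2 \<ge> X0 + 2 \<and>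
      (exp (real q ^ 3) / (4 * B) - 2) / real q \<ge> exp (real q ^ 3 / 2) \<and>
      8 * K\<^sup>2 * B\<^sup>2 * real q ^ 2 \<le> \<epsilon> * (real q ^ 3 / 2)"
    unfolding eventually_at_top_linorder by auto
  obtain q p where q: "q \<ge> n" "well_approximated q p \<alpha>" "real q * \<beta> \<notin> \<int>" "\<eta> \<in> approach b q"
    using freq by blast
  have q0: "0 < q" "coprime p (int q)" using q by (auto simp: well_approximated_def prime_gt_0_nat)
  define \<sigma> where "\<sigma> = real q * \<alpha> - of_int p"
  have \<sigma>: "0 < \<sigma>" "\<sigma> < exp (- (real q ^ 3))" using q by (auto simp: \<sigma>_def well_approximated_def)
  obtain j :: int where j: "1 / (4 * B) < of_int j - real q * \<eta>" "of_int j - real q * \<eta> < 1 / (2 * B)"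
    using q(4) by (auto simp: approach_def B_def)
  define \<rho> where "\<rho> = of_int j - real q * \<eta>"
  have \<rho>: "1 / (4 * B) < \<rho>" "\<rho> < 1 / (2 * B)" using j by (auto simp: \<rho>_def)
  have \<rho>0: "0 < \<rho>" "\<rho> \<le> 1"
  proof -
    have "0 < 1 / (4 * B)" "1 / (2 * B) \<le> 1" using B by (auto simp: field_simps)
    then show "0 < \<rho>" "\<rho> \<le> 1" using \<rho> by linarith+
  qed
  define N where "N = nat \<lfloor>\<rho> / \<sigma>\<rfloor>"
  have "real N \<le> \<rho> / \<sigma>" "\<rho> / \<sigma> < real N + 1" using \<rho>0 \<sigma> by (auto simp: N_def)
  then have N: "real N * \<sigma> \<le> \<rho>" "\<rho> < (real N + 1) * \<sigma>" using \<sigma> by (auto simp: field_simps)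
  have "exp (real q ^ 3) / (4 * B) \<le> \<rho> / \<sigma>"
  proof -
    have "exp (real q ^ 3) * \<sigma> \<le> exp (real q ^ 3) * exp (- (real q ^ 3))"
      using \<sigma> by (intro mult_left_mono) auto
    then have "exp (real q ^ 3) \<le> 1 / \<sigma>" using \<sigma> by (simp add: field_simps flip: exp_add)
    then have "exp (real q ^ 3) * (1 / (4 * B)) \<le> 1 / \<sigma> * \<rho>" using \<rho> \<sigma> B by (intro mult_mono) auto
    then show ?thesis by simp
  qed
  then have Nge: "exp (real q ^ 3) / (4 * B) - 1 \<le> real N" using \<open>\<rho> / \<sigma> < real N + 1\<close> by linarith
  \<comment> \<open>Taking \<open>N - 1\<close> makes \<open>J * q < N\<close> strict, so that the
    blocks stay to the right of 1 and hence of \<open>x0\<close>.\<close>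
  define J where "J = (N - 1) div q"
  have N1: "1 \<le> real N" "X0 \<le> real N"
  proof -
    have "0 < (exp (real q ^ 3) / (4 * B) - 2) / real q"
      using n[OF q(1)] exp_gt_zero[of "real q ^ 3 / 2"] by linarith
    then have "0 < exp (real q ^ 3) / (4 * B) - 2" using q0 by (simp add: zero_less_divide_iff)
    then show "1 \<le> real N" "X0 \<le> real N" using Nge n[OF q(1)] by linarith+
  qed
  then have "N \<ge> 1" by simp
  have J: "J * q < N"
    using \<open>N \<ge> 1\<close> by (metis J_def One_nat_def Suc_le_lessD Suc_pred div_times_less_eq_dividend less_Suc_eq_le)
  have JJ: "real q ^ 3 / 2 \<le> harm J"
  proof -
    have "N - 1 < (J + 1) * q" using q0 unfolding J_def
      by (metis Suc_eq_plus1 dividend_less_div_times mult.commute mult_Suc_right add.commute)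
    then have "real (N - 1) \<le> (real J + 1) * real q"
      by (metis (no_types, lifting) less_imp_le of_nat_1 of_nat_add of_nat_le_iff of_nat_mult)
    then have "real N - 1 \<le> (real J + 1) * real q" using \<open>N \<ge> 1\<close> by (simp add: of_nat_diff)
    then have "(exp (real q ^ 3) / (4 * B) - 2) / real q \<le> real J + 1"
      using Nge q0 by (simp add: divide_le_eq)
    then have "exp (real q ^ 3 / 2) \<le> real J + 1" using n[OF q(1)] by linarith
    then have "real q ^ 3 / 2 \<le> ln (real J + 1)" by (subst ln_ge_iff) auto
    then show ?thesis using harm_ge_ln[of J] by linarith
  qed
  have lower: "harm J / (2 * K * \<sigma>) \<le> integral {x0..real N} ?f"
  proof -
    have "harm J / (2 * K * \<sigma>) \<le> integral {real (N - J * q)..real N} ?f"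
      unfolding K_def by (rule drift_integral_ge[OF q0 \<sigma>_def \<sigma>(1) _ \<rho>0(2) N pos J]) (simp add: \<rho>_def)
    also have "\<dots> \<le> integral {x0..real N} ?f"
    proof (intro integral_inverse_lat_mono pos)
      have "1 \<le> N - J * q" using J by simp
      then have "1 \<le> real (N - J * q)" by linarith
      then show "x0 \<le> real (N - J * q)" using x0 by linarith
    qed (use x0 in auto)
    finally show ?thesis .
  qed
  \<comment> \<open>With \<theta> the part of the gap still open after \<open>k\<close> crossings,
    \<open>q\<close> times the relative height is \<open>- (q * \<beta> + \<theta>)\<close> up to an
    integer. That number is bounded away from the integers, and \<open>abs_sin_mult_le\<close>
    transfers the bound to the height at the price of a factor \<open>q\<close>.\<close>
  have s: "1 / (2 * B * real q) \<le> \<bar>sin (pi * (\<eta> - \<beta> + \<alpha> * real k))\<bar>" if "k \<le> N" for k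
  proof -
    define \<theta> where "\<theta> = \<rho> - real k * \<sigma>"
    have "real k * \<sigma> \<le> real N * \<sigma>" using that \<sigma> by (intro mult_right_mono) auto
    moreover have "0 \<le> real k * \<sigma>" using \<sigma> by simp
    ultimately have \<theta>: "0 \<le> \<theta>" "\<theta> \<le> 1 / (2 * real b)"
      using N(1) \<rho> unfolding \<theta>_def B_def by linarith+
    have "1 / (2 * B) \<le> \<bar>sin (pi * (real q * \<beta> + \<theta>))\<bar>"
      unfolding B_def
    proof (rule abs_sin_pi_offset_ge[OF b(1) _ q(3) \<theta>])
      show "real b * (real q * \<beta>) \<in> \<int>"
        using Ints_mult[OF Ints_of_nat[of q] b(2)] by (simp add: mult_ac)
    qed
    also have "real q * \<beta> + \<theta> = - (real q * (\<eta> - \<beta> + \<alpha> * real k)) + of_int (j + int k * p)"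
      by (simp add: \<theta>_def \<rho>_def \<sigma>_def algebra_simps)
    also have "\<bar>sin (pi * \<dots>)\<bar> = \<bar>sin (real q * (pi * (\<eta> - \<beta> + \<alpha> * real k)))\<bar>"
      unfolding abs_sin_pi_int_cancel by (simp add: mult_ac)
    also have "\<dots> \<le> real q * \<bar>sin (pi * (\<eta> - \<beta> + \<alpha> * real k))\<bar>" by (rule abs_sin_mult_le)
    finally show ?thesis using q0 B by (simp add: field_simps)
  qed
  have "integral {x0..real N} (\<lambda>x. 1 / lat (\<eta> - \<beta>) \<alpha> x) \<le> K / (1 / (2 * B * real q))\<^sup>2 * real N"
    unfolding K_def using s x0 N1 q0 B by (intro integral_inverse_lat_le) auto
  also have "\<dots> = 4 * K * B\<^sup>2 * real q ^ 2 * real N" by (simp add: power_divide power_mult_distrib)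
  also have "\<dots> \<le> 4 * K * B\<^sup>2 * real q ^ 2 * (1 / \<sigma>)"
    using N \<rho>0 \<sigma> K by (intro mult_left_mono) (auto simp: field_simps)
  also have "\<dots> = (8 * K\<^sup>2 * B\<^sup>2 * real q ^ 2) / (2 * K * \<sigma>)" using K by (simp add: field_simps power2_eq_square)
  also have "\<dots> \<le> (\<epsilon> * (real q ^ 3 / 2)) / (2 * K * \<sigma>)"
    using n[OF q(1)] K \<sigma> by (intro divide_right_mono) auto
  also have "\<dots> \<le> (\<epsilon> * harm J) / (2 * K * \<sigma>)"
    using JJ \<epsilon> K \<sigma> by (intro divide_right_mono mult_left_mono) auto
  also have "\<dots> \<le> \<epsilon> * integral {x0..real N} ?f" using mult_left_mono[OF lower, of \<epsilon>] \<epsilon> by simp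
  finally show ?thesis using N1 by blast
qed

section \<open>Full measure of the drifting phases\<close>

text \<open>A substitute for the density theorem. A bounded piece \<open>S\<close> is covered by
  nonoverlapping intervals of total length at most \<open>measure S + e\<close>; thinness in each of
  them gives \<open>measure S \<le> (1 - \<kappa>) * (measure S + e)\<close>, and letting
  \<open>e\<close> tend to 0 forces measure zero.\<close>

lemma locally_thin_imp_null:
  fixes B :: "real set"
  assumes B: "B \<in> sets lebesgue" and \<kappa>: "0 < \<kappa>" "\<kappa> \<le> 1"
    and thin: "\<And>c d. c \<le> d \<Longrightarrow> measure lebesgue (B \<inter> {c..d}) \<le> (1 - \<kappa>) * (d - c)"
  shows "B \<in> null_sets lebesgue"
proof -
  have "negligible (B \<inter> cbox a b)" for a b
  proof -
    define S where "S = B \<inter> cbox a b"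
    have S: "S \<in> lmeasurable" "S \<subseteq> cbox a b"
      unfolding S_def using fmeasurable_Int_fmeasurable[OF lmeasurable_cbox B] by (auto simp: Int_commute)
    have "measure lebesgue S \<le> (1 - \<kappa>) * (measure lebesgue S + e)" if e: "0 < e" for e
    proof -
      have "\<exists>\<D>. countable \<D> \<and> (\<forall>K\<in>\<D>. K \<subseteq> cbox a b \<and> K \<noteq> {} \<and> (\<exists>c d. K = cbox c d)) \<and>
        pairwise (\<lambda>A B. interior A \<inter> interior B = {}) \<D> \<and> S \<subseteq> \<Union>\<D> \<and> \<Union>\<D> \<in> lmeasurable \<and>
        measure lebesgue (\<Union>\<D>) \<le> measure lebesgue S + e"
      proof (rule measurable_outer_intervals_bounded[OF S e], goal_cases)
        case (1 \<D>)
        have "\<forall>K\<in>\<D>. K \<subseteq> cbox a b \<and> K \<noteq> {} \<and> (\<exists>c d. K = cbox c d)" using 1(2) by (intro ballI)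
        with 1(1,3,6,7,8) show ?case by (intro exI[of _ \<D>] conjI)
      qed
      then obtain \<D> where \<D>: "countable \<D>" "\<forall>K\<in>\<D>. K \<subseteq> cbox a b \<and> K \<noteq> {} \<and> (\<exists>c d. K = cbox c d)"
        "pairwise (\<lambda>A B. interior A \<inter> interior B = {}) \<D>"
        "S \<subseteq> \<Union>\<D>" "\<Union>\<D> \<in> lmeasurable" "measure lebesgue (\<Union>\<D>) \<le> measure lebesgue S + e"
        by (elim exE conjE)
      \<comment> \<open>The bound is uniform in the finite subfamily \<open>F\<close>, so it passes
        to the countable cover.\<close>
      have fin: "measure lebesgue (\<Union>K\<in>F. S \<inter> K) \<le> (1 - \<kappa>) * (measure lebesgue S + e)"
        if F: "F \<subseteq> \<D>" "finite F" for F
      proof -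
        have K: "measure lebesgue (S \<inter> K) \<le> (1 - \<kappa>) * measure lebesgue K" if "K \<in> F" for K
        proof -
          have "K \<in> \<D>" using that F by auto
          with \<D>(2) obtain c d where cd: "K = cbox c d" "K \<noteq> {}" "K \<subseteq> cbox a b"
            by (elim ballE[of _ _ K] exE conjE) auto
          then have "S \<inter> K = B \<inter> {c..d}" "c \<le> d" unfolding S_def by auto
          then show ?thesis using thin[of c d] cd(1) by simp
        qed
        have meas: "K \<in> lmeasurable" if "K \<in> F" for K 
        proof -
          have "K \<in> \<D>" using that F by auto
          with \<D>(2) show ?thesis by (elim ballE[of _ _ K] exE conjE) auto
        qed
        have div: "F division_of \<Union>F"
        proof (rule division_ofI)
          fix K assume "K \<in> F"
          then have K: "K \<in> \<D>" using F by auto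
          show "K \<subseteq> \<Union>F" using \<open>K \<in> F\<close> by auto
          show "K \<noteq> {}" "\<exists>a b. K = cbox a b" using bspec[OF \<D>(2) K] by simp_all
        next
          fix K K' assume "K \<in> F" "K' \<in> F" "K \<noteq> K'"
          then show "interior K \<inter> interior K' = {}"
            using F pairwiseD[OF \<D>(3)] by (meson subsetD)
        qed (use F in auto)
        have "measure lebesgue (\<Union>K\<in>F. S \<inter> K) \<le> (\<Sum>K\<in>F. measure lebesgue (S \<inter> K))"
          using F S meas by (intro measure_UNION_le) (auto intro: fmeasurableD)
        also have "\<dots> \<le> (\<Sum>K\<in>F. (1 - \<kappa>) * measure lebesgue K)" by (intro sum_mono K)
        also have "\<dots> = (1 - \<kappa>) * measure lebesgue (\<Union>F)"
          using content_division[OF div] by (simp flip: sum_distrib_left)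
        also have "\<dots> \<le> (1 - \<kappa>) * measure lebesgue (\<Union>\<D>)"
        proof (intro mult_left_mono measure_mono_fmeasurable)
          show "\<Union>F \<in> sets lebesgue" using F meas by (intro sets.finite_Union) (auto intro: fmeasurableD)
        qed (use F \<D> \<kappa> in auto)
        also have "\<dots> \<le> (1 - \<kappa>) * (measure lebesgue S + e)"
          using \<D>(6) \<kappa> by (intro mult_left_mono) auto
        finally show ?thesis .
      qed
      have "S = (\<Union>K\<in>\<D>. S \<inter> K)" using \<D>(4) by auto
      also have "measure lebesgue \<dots> \<le> (1 - \<kappa>) * (measure lebesgue S + e)"
      proof (rule measure_UN_bound[OF \<D>(1) _ fin])
        fix K assume "K \<in> \<D>"
        from bspec[OF \<D>(2) this] show "S \<inter> K \<in> lmeasurable"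
        proof (elim exE conjE)
          fix c d assume "K = cbox c d"
          then show ?thesis using S(1) lmeasurable_cbox[of c d] by (simp add: fmeasurable.Int)
        qed
      qed
      finally show ?thesis .
    qed
    then have *: "measure lebesgue S \<le> (1 - \<kappa>) * (measure lebesgue S + e)" if "0 < e" for e
      using that by blast
    have "measure lebesgue S * \<kappa> \<le> 0 + e" if "0 < e" for e
    proof -
      have "(1 - \<kappa>) * e \<le> 1 * e" using \<kappa> that by (intro mult_right_mono) auto
      then show ?thesis using *[OF that] by (simp add: algebra_simps)
    qed
    then have "measure lebesgue S * \<kappa> \<le> 0" by (rule field_le_epsilon)
    then have "measure lebesgue S = 0" using \<kappa> by (simp add: mult_le_0_iff measure_le_0_iff)
    then show ?thesis using S(1) by (simp add: S_def negligible_iff_measure0)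
  qed
  then have "negligible B" using negligible_on_intervals by blast
  then show ?thesis by (simp add: negligible_iff_null_sets)
qed

lemma open_approach: "open (approach b q)"
proof -
  have "approach b q = (\<Union>j :: int. {\<eta>. 1 / (4 * real b) < of_int j - real q * \<eta>} \<inter> {\<eta>. of_int j - real q * \<eta> < 1 / (2 * real b)})"
    by (auto simp: approach_def)
  also have "open \<dots>" by (intro open_UN ballI open_Int open_Collect_less continuous_intros)
  finally show ?thesis .
qed

lemma approach_add_int: "\<eta> + of_int m \<in> approach b q \<longleftrightarrow> \<eta> \<in> approach b q"
proof -
  have *: "\<eta> + of_int m \<in> approach b q" if \<eta>: "\<eta> \<in> approach b q" for \<eta> m
  proof -
    obtain j :: int where "1 / (4 * real b) < of_int j - real q * \<eta>" "of_int j - real q * \<eta> < 1 / (2 * real b)"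
      using \<eta> by (auto simp: approach_def)
    then show ?thesis unfolding approach_def mem_Collect_eq
      by (intro exI[of _ "j + int q * m"]) (simp add: algebra_simps)
  qed
  show ?thesis using *[of \<eta> m] *[of "\<eta> + of_int m" "- m"] by auto
qed

text \<open>Every period of length \<open>1 / q\<close> contributes an interval of length
  \<open>1 / (4 b q)\<close>, and at least \<open>q * (d - c) - 2\<close> periods fit. The two that
  may be lost at the ends produce the subtracted term.\<close>

lemma measure_Int_approach_ge:
  assumes b: "1 \<le> b" and q: "1 \<le> q"
  shows "(d - c) / (4 * real b) - 1 / (2 * real b * real q) \<le> measure lebesgue (approach b q \<inter> {c..d})"
proof -
  define I where "I j = {(of_int j - 1 / (2 * real b)) / real q <..< (of_int j - 1 / (4 * real b)) / real q}" for j :: int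
  \<comment> \<open>The interval \<open>I j\<close> lies in the period that ends at
    \<open>j / q\<close>, hence the shift by one at the left end only.\<close>
  define J where "J = {\<lceil>real q * c\<rceil> + 1..\<lfloor>real q * d\<rfloor>}"
  have I: "I j \<subseteq> {(of_int j - 1) / real q<..<of_int j / real q}" for j
  proof
    fix x assume "x \<in> I j"
    then have "of_int j - 1 / (2 * real b) < x * real q" "x * real q < of_int j - 1 / (4 * real b)"
      using q unfolding I_def by (auto simp: pos_less_divide_eq pos_divide_less_eq)
    moreover have "1 / (2 * real b) \<le> 1" "0 < 1 / (4 * real b)" using b by (auto simp: field_simps)
    ultimately have "of_int j - 1 < x * real q" "x * real q < of_int j" by linarith+
    then show "x \<in> {(of_int j - 1) / real q<..<of_int j / real q}"
      using q by (auto simp: pos_less_divide_eq pos_divide_less_eq)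
  qed
  have meas: "measure lebesgue (I j) = 1 / (4 * real b * real q)" for j
  proof -
    have "1 / (4 * real b) \<le> 1 / (2 * real b)" using b by (simp add: field_simps)
    then have "(of_int j - 1 / (2 * real b)) / real q \<le> (of_int j - 1 / (4 * real b)) / real q"
      using q by (intro divide_right_mono) auto
    then show ?thesis using b q by (simp add: I_def field_simps)
  qed
  have sub: "(\<Union>j\<in>J. I j) \<subseteq> approach b q \<inter> {c..d}"
  proof (intro UN_least Int_greatest subsetI)
    fix j x assume j: "j \<in> J" and x: "x \<in> I j"
    then show "x \<in> approach b q" using q
      by (auto simp: I_def approach_def pos_less_divide_eq pos_divide_less_eq mult.commute intro!: exI[of _ j])
    have "(of_int j - 1) / real q < x" "x < of_int j / real q" using subsetD[OF I x] by auto
    then have "of_int j - 1 < real q * x" "real q * x < of_int j"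
      using q by (auto simp: pos_less_divide_eq pos_divide_less_eq mult.commute)
    moreover have "real q * c \<le> of_int j - 1" "of_int j \<le> real q * d"
      using j unfolding J_def by (auto simp: le_floor_iff) linarith
    ultimately have "real q * c \<le> real q * x" "real q * x \<le> real q * d" by linarith+
    then show "x \<in> {c..d}" using q by simp
  qed
  have disj: "disjoint_family_on I J"
  proof (unfold disjoint_family_on_def, intro ballI impI)
    fix j j' :: int assume "j \<noteq> j'"
    have False if "x \<in> I j" "x \<in> I j'" for x
    proof -
      have "of_int j - 1 < real q * x" "real q * x < of_int j" "of_int j' - 1 < real q * x" "real q * x < of_int j'"
        using I[of j] I[of j'] that q by (auto simp: pos_less_divide_eq pos_divide_less_eq mult.commute)
      then have "j = j'" by linarith
      then show False using \<open>j \<noteq> j'\<close> by simp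
    qed
    then show "I j \<inter> I j' = {}" by blast
  qed
  have fin: "emeasure lebesgue (I j) \<noteq> \<infinity>" for j
    using emeasure_bounded_finite[of "I j"] by (auto simp: I_def)
  have "real q * d - real q * c - 2 \<le> of_int (\<lfloor>real q * d\<rfloor> - \<lceil>real q * c\<rceil>)" by linarith
  also have "\<dots> \<le> real (card J)" by (simp add: J_def)
  finally have card: "real q * d - real q * c - 2 \<le> real (card J)" .
  have "(d - c) / (4 * real b) - 1 / (2 * real b * real q) = (real q * d - real q * c - 2) * (1 / (4 * real b * real q))"
    using b q by (simp add: field_simps)
  also have "\<dots> \<le> real (card J) * (1 / (4 * real b * real q))" using card by (intro mult_right_mono) auto
  also have "\<dots> = measure lebesgue (\<Union>j\<in>J. I j)"
    by (subst measure_finite_Union) (use disj fin in \<open>simp_all add: J_def meas, auto simp: I_def\<close>)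
  also have "\<dots> \<le> measure lebesgue (approach b q \<inter> {c..d})"
  proof (rule measure_mono_fmeasurable[OF sub])
    show "(\<Union>j\<in>J. I j) \<in> sets lebesgue" by (auto simp: J_def I_def)
    show "approach b q \<inter> {c..d} \<in> lmeasurable"
      using open_approach[of b q] fmeasurable_Int_fmeasurable[of "{c..d}" lebesgue "approach b q"] lmeasurable_cbox[of c d]
      by (simp add: Int_commute lborelD)
  qed
  finally show ?thesis .
qed

text \<open>The points that avoid \<open>approach b q\<close> for all admissible
  \<open>q \<ge> n\<close> fill at most the proportion \<open>1 - 1 / (4 b)\<close> of any interval:
  for a fixed interval the boundary error \<open>1 / (2 b q)\<close> becomes arbitrarily small as
  \<open>q\<close> grows. So they form a null set.\<close>

lemma AE_frequently_approach:
  assumes b: "1 \<le> b" and Q: "\<And>n. \<exists>q\<ge>n. q \<in> Q"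
  shows "AE \<eta> in lborel. \<forall>n. \<exists>q\<ge>n. q \<in> Q \<and> \<eta> \<in> approach b q"
proof -
  have "AE \<eta> in lborel. \<exists>q\<ge>n. q \<in> Q \<and> \<eta> \<in> approach b q" for n
  proof -
    define B where "B = (\<Inter>q\<in>Q \<inter> {n..}. - approach b q)"
    have B: "closed B" unfolding B_def using open_approach by (intro closed_INT) auto
    then have Bs: "B \<in> sets borel" by simp
    have "B \<in> null_sets lebesgue"
    proof (rule locally_thin_imp_null[of B "1 / (4 * real b)"])
      fix c d :: real assume cd: "c \<le> d"
      have 1: "measure lebesgue (B \<inter> {c..d}) \<le> (d - c) - (d - c) / (4 * real b) + e" if "e > 0" for e
      proof -
        obtain N :: nat where N: "real N > 1 / e" using reals_Archimedean2 by blast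
        obtain q where q: "q \<ge> max n (Suc N)" "q \<in> Q" using Q by blast
        have q1: "1 \<le> q" "real q > 1 / e" using q N by auto
        have "1 / (2 * real b * real q) \<le> 1 / (1 * real q)"
          using b q1 by (intro divide_left_mono mult_right_mono) auto
        also have "\<dots> \<le> e" using q1 that by (simp add: field_simps)
        finally have e: "1 / (2 * real b * real q) \<le> e" .
        have m: "approach b q \<inter> {c..d} \<in> lmeasurable" 
          using open_approach[of b q] fmeasurable_Int_fmeasurable[of "{c..d}" lebesgue "approach b q"] lmeasurable_cbox[of c d]
          by (simp add: Int_commute lborelD)
        have "measure lebesgue (B \<inter> {c..d}) \<le> measure lebesgue ({c..d} - (approach b q \<inter> {c..d}))"
        proof (rule measure_mono_fmeasurable)
          show "B \<inter> {c..d} \<subseteq> {c..d} - (approach b q \<inter> {c..d})" using q by (auto simp: B_def)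
          show "{c..d} - (approach b q \<inter> {c..d}) \<in> lmeasurable"
            using m lmeasurable_cbox[of c d] by (intro fmeasurable.Diff) auto
        qed (use Bs in auto)
        also have "\<dots> = (d - c) - measure lebesgue (approach b q \<inter> {c..d})"
          using cd m lmeasurable_cbox[of c d] by (subst measurable_measure_Diff) (auto intro: fmeasurableD)
        also have "\<dots> \<le> (d - c) - (d - c) / (4 * real b) + e"
          using measure_Int_approach_ge[OF b q1(1), of d c] e by linarith
        finally show ?thesis .
      qed
      have "measure lebesgue (B \<inter> {c..d}) \<le> (d - c) - (d - c) / (4 * real b)"
        using field_le_epsilon[OF 1] by simp
      then show "measure lebesgue (B \<inter> {c..d}) \<le> (1 - 1 / (4 * real b)) * (d - c)"
        by (simp add: algebra_simps)
    qed (use b Bs in \<open>auto simp: field_simps\<close>)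
    then have "B \<in> null_sets lborel" using Bs by (simp add: null_sets_def)
    then have "AE \<eta> in lborel. \<eta> \<notin> B" by (rule AE_not_in)
    then show ?thesis by eventually_elim (auto simp: B_def)
  qed
  then show ?thesis by (simp add: AE_all_countable)
qed

lemma AE_lborel_shift:
  fixes c :: real
  assumes "AE x in lborel. P x"
  shows "AE x in lborel. P (x + c)"
proof -
  obtain N where N: "N \<in> null_sets lborel" "{x. \<not> P x} \<subseteq> N"
    using assms unfolding eventually_ae_filter by auto
  then have "AE x in distr lborel borel (\<lambda>x. c + x). x \<notin> N"
    by (subst lborel_distr_plus) (auto intro: AE_not_in)
  then have "AE x in lborel. c + x \<notin> N"
    using N by (subst (asm) AE_distr_iff) (auto simp: null_sets_def)
  then show ?thesis by eventually_elim (use N in \<open>auto simp: add.commute\<close>)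
qed

section \<open>Nondegenerate minima\<close>

text \<open>A finite subcover suffices, and the local constants may be summed because
  \<open>g\<close> is nonnegative. The summand \<open>h\<close> is 0 when the speed is compared with
  its model, and a small constant when a test function is dominated.\<close>

lemma compact_local_bound:
  fixes f h g :: "'a::topological_space \<Rightarrow> real"
  assumes "compact K" and g: "\<And>z. 0 \<le> g z"
    and loc: "\<And>z. z \<in> K \<Longrightarrow> \<exists>C. \<forall>\<^sub>F w in nhds z. f w \<le> h w + C * g w"
  shows "\<exists>C>0. \<forall>z\<in>K. f z \<le> h z + C * g z"
proof -
  have "\<exists>U C. open U \<and> z \<in> U \<and> (\<forall>w\<in>U. f w \<le> h w + C * g w)" if "z \<in> K" for z
    using loc[OF that] unfolding eventually_nhds by blast
  then obtain U C where U: "\<And>z. z \<in> K \<Longrightarrow> open (U z)" "\<And>z. z \<in> K \<Longrightarrow> z \<in> U z"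
      "\<And>z w. z \<in> K \<Longrightarrow> w \<in> U z \<Longrightarrow> f w \<le> h w + C z * g w"
    by metis
  obtain T where T: "T \<subseteq> K" "finite T" "K \<subseteq> (\<Union>z\<in>T. U z)"
    by (rule compactE_image[OF \<open>compact K\<close>, of K U]) (use U in auto)
  have "f w \<le> h w + (1 + (\<Sum>z\<in>T. \<bar>C z\<bar>)) * g w" if w: "w \<in> K" for w
  proof -
    obtain z where z: "z \<in> T" "w \<in> U z" using T(3) w by auto
    have "C z \<le> \<bar>C z\<bar>" by simp
    also have "\<dots> \<le> 1 + (\<Sum>z\<in>T. \<bar>C z\<bar>)"
      using member_le_sum[of z T "\<lambda>z. \<bar>C z\<bar>"] z T(2) by auto
    finally have "C z * g w \<le> (1 + (\<Sum>z\<in>T. \<bar>C z\<bar>)) * g w" using g by (intro mult_right_mono)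
    then show ?thesis using U(3)[of z w] z T(1) by auto
  qed
  moreover have "1 + (\<Sum>z\<in>T. \<bar>C z\<bar>) > 0" by (intro add_pos_nonneg sum_nonneg) auto
  ultimately show ?thesis by blast
qed

lemma C_k_imp_continuous_on:
  assumes "C_k k f"
  shows "continuous_on UNIV f"
proof (cases k)
  case (Suc j)
  then have "f differentiable at z" for z using assms by simp
  then show ?thesis by (intro differentiable_imp_continuous_on) (simp add: differentiable_on_def)
qed (use assms in simp)

text \<open>The function is followed along rays: the derivative of
  \<open>f (x0 + t *\<^sub>R z)\<close> in \<open>t\<close> differs from \<open>t * H z z\<close> by
  at most \<open>t * m / 2 * (norm z)^2\<close>, where \<open>m\<close> is the minimum of the
  Hessian form on the unit sphere, positive by compactness. Integrating in \<open>t\<close> gives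
  both bounds.\<close>

lemma quadratic_minimum_bounds:
  fixes f :: "'a::euclidean_space \<Rightarrow> real"
  assumes f: "C_k 3 f" and f0: "f x0 = 0" "\<And>x. 0 \<le> f x" and pd: "positive_definite (hessian f x0)"
  shows "\<exists>r>0. \<exists>c>0. \<exists>C. \<forall>z. norm z < r \<longrightarrow> c * (norm z)\<^sup>2 \<le> f (x0 + z) \<and> f (x0 + z) \<le> C * (norm z)\<^sup>2"
proof -
  define D where "D y v = frechet_derivative f (at y) v" for y v
  have C1: "f differentiable at y" and C2: "(\<lambda>y. D y v) differentiable at y" for y v
    using f by (simp_all add: numeral_3_eq_3 D_def)
  have D: "(f has_derivative D y) (at y)" for y
    using C1[of y] unfolding D_def by (simp add: frechet_derivative_works)
  have Dlin: "linear (D y)" for y using D by (rule has_derivative_linear)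
  define H where "H v w = hessian f x0 v w" for v w
  have H: "((\<lambda>y. D y v) has_derivative H v) (at x0)" for v
    using C2[of v x0] unfolding H_def hessian_def D_def by (simp add: frechet_derivative_works)
  have Hlin: "linear (H v)" for v using H by (rule has_derivative_linear)
  have Dsum: "D y v = (\<Sum>i\<in>Basis. (v \<bullet> i) * D y i)" for y v
    using linear_sum[OF Dlin[of y], of "\<lambda>i. (v \<bullet> i) *\<^sub>R i" Basis] linear_cmul[OF Dlin[of y]]
    by (simp add: euclidean_representation)
  \<comment> \<open>Linearity in the first slot is not visible in \<open>hessian\<close>; it follows
    from uniqueness of the derivative of a linear combination of the partial derivatives.\<close>
  have Hsum: "H v w = (\<Sum>i\<in>Basis. (v \<bullet> i) * H i w)" for v w
  proof -
    have "((\<lambda>y. \<Sum>i\<in>Basis. (v \<bullet> i) * D y i) has_derivative (\<lambda>w. \<Sum>i\<in>Basis. (v \<bullet> i) * H i w)) (at x0)"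
      by (intro has_derivative_sum has_derivative_mult_right H)
    then have "((\<lambda>y. D y v) has_derivative (\<lambda>w. \<Sum>i\<in>Basis. (v \<bullet> i) * H i w)) (at x0)"
      by (simp flip: Dsum)
    then have "H v = (\<lambda>w. \<Sum>i\<in>Basis. (v \<bullet> i) * H i w)" by (rule has_derivative_unique[OF H])
    then show ?thesis by metis
  qed
  have D0: "D x0 = (\<lambda>v. 0)"
    using D f0 by (intro differential_zero_maxmin[of x0 UNIV f]) auto
  have cont: "continuous_on UNIV (\<lambda>v. H v v)"
  proof -
    have "continuous_on UNIV (H i)" for i using Hlin by (rule linear_continuous_on[OF linear_conv_bounded_linear[THEN iffD1]])
    then have "continuous_on UNIV (\<lambda>v. \<Sum>i\<in>Basis. (v \<bullet> i) * H i v)" by (intro continuous_intros)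
    moreover have "(\<lambda>v. H v v) = (\<lambda>v. \<Sum>i\<in>Basis. (v \<bullet> i) * H i v)" by (rule ext) (rule Hsum)
    ultimately show ?thesis by (rule ssubst[rotated])
  qed
  have scale: "H (t *\<^sub>R v) (t *\<^sub>R v) = t\<^sup>2 * H v v" for t v
  proof -
    have "H (t *\<^sub>R v) w = t * H v w" for w
      using Hsum[of "t *\<^sub>R v" w] Hsum[of v w] by (simp add: sum_distrib_left mult_ac)
    then show ?thesis using linear_cmul[OF Hlin] by (simp add: power2_eq_square)
  qed
  have "sphere (0::'a) 1 \<noteq> {}" by simp
  then obtain v1 where v1: "v1 \<in> sphere 0 1" "\<And>v. v \<in> sphere 0 1 \<Longrightarrow> H v1 v1 \<le> H v v"
    using continuous_attains_inf[OF compact_sphere, of 0 1 "\<lambda>v. H v v"] continuous_on_subset[OF cont] by auto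
  obtain v2 where v2: "\<And>v. v \<in> sphere 0 1 \<Longrightarrow> H v v \<le> H v2 v2"
    using continuous_attains_sup[OF compact_sphere, of 0 1 "\<lambda>v. H v v"] continuous_on_subset[OF cont]
      \<open>sphere (0::'a) 1 \<noteq> {}\<close> by (metis subset_UNIV)
  define m M where "m = H v1 v1" and "M = H v2 v2"
  have "v1 \<noteq> 0" using v1 by auto
  then have m: "0 < m" using pd by (simp add: m_def H_def positive_definite_def)
  have Hb: "m * (norm v)\<^sup>2 \<le> H v v" "H v v \<le> M * (norm v)\<^sup>2" for v
  proof -
    have *: "H v v = (norm v)\<^sup>2 * H (v /\<^sub>R norm v) (v /\<^sub>R norm v)" if "v \<noteq> 0"
      using scale[of "norm v" "v /\<^sub>R norm v"] that by simp
    have 0: "H 0 0 = 0" using linear_0[OF Hlin] by simp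
    have s: "v /\<^sub>R norm v \<in> sphere 0 1" if "v \<noteq> 0" using that by simp
    show "m * (norm v)\<^sup>2 \<le> H v v" using * v1(2)[OF s] 0 by (cases "v = 0") (auto simp: m_def mult.commute intro!: mult_right_mono)
    show "H v v \<le> M * (norm v)\<^sup>2" using * v2[OF s] 0 by (cases "v = 0") (auto simp: M_def mult.commute intro!: mult_right_mono)
  qed
  \<comment> \<open>The errors of the \<open>DIM('a)\<close> partial derivatives then add up to
    \<open>m / 2\<close>, which leaves half of the lower bound for the Hessian form.\<close>
  define e where "e = m / (2 * DIM('a))"
  have e: "e > 0" using m by (simp add: e_def)
  have "\<exists>r>0. \<forall>z. norm z < r \<longrightarrow> \<bar>D (x0 + z) i - H i z\<bar> \<le> e * norm z" for i
  proof -
    obtain r where r: "0 < r" "\<And>y. norm (y - x0) < r \<Longrightarrow> norm (D y i - D x0 i - H i (y - x0)) \<le> e * norm (y - x0)"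
      using H[of i] e unfolding has_derivative_at_alt by blast
    have "\<bar>D (x0 + z) i - H i z\<bar> \<le> e * norm z" if "norm z < r" for z
      using r(2)[of "x0 + z"] that D0 by simp
    then show ?thesis using r(1) by blast
  qed
  then obtain R where R: "\<And>i. 0 < R i" "\<And>i z. norm z < R i \<Longrightarrow> \<bar>D (x0 + z) i - H i z\<bar> \<le> e * norm z"
    by metis
  define r where "r = Min (R ` (Basis :: 'a set))"
  have r: "0 < r" "\<And>i. i \<in> Basis \<Longrightarrow> r \<le> R i" using R(1) by (auto simp: r_def)
  have approx: "\<bar>D (x0 + z) v - H v z\<bar> \<le> m / 2 * norm z * norm v" if "norm z < r" for z v
  proof -
    have "D (x0 + z) v - H v z = (\<Sum>i\<in>Basis. (v \<bullet> i) * (D (x0 + z) i - H i z))"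
      by (subst Dsum, subst Hsum) (simp add: sum_subtractf algebra_simps)
    then have "\<bar>D (x0 + z) v - H v z\<bar> \<le> (\<Sum>i\<in>Basis. \<bar>(v \<bullet> i) * (D (x0 + z) i - H i z)\<bar>)"
      using sum_abs by metis
    also have "\<dots> \<le> (\<Sum>i\<in>(Basis::'a set). norm v * (e * norm z))"
    proof (intro sum_mono)
      fix i :: 'a assume i: "i \<in> Basis"
      have "norm z < R i" using r(2)[OF i] that by simp
      then show "\<bar>(v \<bullet> i) * (D (x0 + z) i - H i z)\<bar> \<le> norm v * (e * norm z)"
        unfolding abs_mult using R(2)[of z i] Basis_le_norm[OF i, of v] by (intro mult_mono) auto
    qed
    also have "\<dots> = m / 2 * norm z * norm v" by (simp add: e_def)
    finally show ?thesis .
  qed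
  have main: "m / 4 * (norm z)\<^sup>2 \<le> f (x0 + z) \<and> f (x0 + z) \<le> (M + m) / 2 * (norm z)\<^sup>2" if z: "norm z < r" for z
  proof -
    define g where "g t = f (x0 + t *\<^sub>R z)" for t
    define g' where "g' t = D (x0 + t *\<^sub>R z) z" for t
    have g: "(g has_real_derivative g' t) (at t)" for t
    proof -
      have "((\<lambda>t. x0 + t *\<^sub>R z) has_derivative (\<lambda>s. s *\<^sub>R z)) (at t)"
        by (auto intro!: derivative_eq_intros)
      then have "(g has_derivative (\<lambda>s. D (x0 + t *\<^sub>R z) (s *\<^sub>R z))) (at t)"
        unfolding g_def by (rule has_derivative_compose) (rule D)
      moreover have "(\<lambda>s. D (x0 + t *\<^sub>R z) (s *\<^sub>R z)) = (*) (g' t)"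
        by (rule ext) (simp add: linear_cmul[OF Dlin] g'_def)
      ultimately show ?thesis unfolding has_field_derivative_def by simp
    qed
    have b: "t * (m / 2 * (norm z)\<^sup>2) \<le> g' t" "g' t \<le> t * ((M + m) * (norm z)\<^sup>2)" if t: "0 \<le> t" "t \<le> 1" for t
    proof -
      have "norm (t *\<^sub>R z) \<le> norm z" using t mult_right_mono[of t 1 "norm z"] by simp
      then have "\<bar>g' t - H z (t *\<^sub>R z)\<bar> \<le> m / 2 * norm (t *\<^sub>R z) * norm z"
        unfolding g'_def using z by (intro approx) auto
      then have "\<bar>g' t - t * H z z\<bar> \<le> t * (m / 2 * (norm z)\<^sup>2)"
        using t by (simp add: linear_cmul[OF Hlin] power2_eq_square mult_ac)
      then have "g' t - t * H z z \<le> t * (m / 2 * (norm z)\<^sup>2)" "t * H z z - g' t \<le> t * (m / 2 * (norm z)\<^sup>2)"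
        by linarith+
      moreover have "t * (m * (norm z)\<^sup>2) \<le> t * H z z" "t * H z z \<le> t * (M * (norm z)\<^sup>2)"
        using t Hb by (auto intro: mult_left_mono)
      moreover have "0 \<le> t * (m * (norm z)\<^sup>2)" using t m by simp
      ultimately show "t * (m / 2 * (norm z)\<^sup>2) \<le> g' t" "g' t \<le> t * ((M + m) * (norm z)\<^sup>2)"
        by (simp_all add: algebra_simps)
    qed
    have sq: "((\<lambda>t. t\<^sup>2 / 2 * K) has_real_derivative t * K) (at t)" for t K :: real
      by (auto intro!: derivative_eq_intros)
    have "g 0 - 0\<^sup>2 / 2 * (m / 2 * (norm z)\<^sup>2) \<le> g 1 - 1\<^sup>2 / 2 * (m / 2 * (norm z)\<^sup>2)"
    proof (rule DERIV_nonneg_imp_nondecreasing[of 0 1 "\<lambda>t. g t - t\<^sup>2 / 2 * (m / 2 * (norm z)\<^sup>2)"])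
      fix t :: real assume "0 \<le> t" "t \<le> 1"
      then show "\<exists>y. ((\<lambda>t. g t - t\<^sup>2 / 2 * (m / 2 * (norm z)\<^sup>2)) has_real_derivative y) (at t) \<and> 0 \<le> y"
        using b(1)[of t] by (intro exI[of _ "g' t - t * (m / 2 * (norm z)\<^sup>2)"] conjI[OF DERIV_diff[OF g sq]]) linarith
    qed simp
    moreover have "1\<^sup>2 / 2 * ((M + m) * (norm z)\<^sup>2) - g 1 \<ge> 0\<^sup>2 / 2 * ((M + m) * (norm z)\<^sup>2) - g 0"
    proof (rule DERIV_nonneg_imp_nondecreasing[of 0 1 "\<lambda>t. t\<^sup>2 / 2 * ((M + m) * (norm z)\<^sup>2) - g t"])
      fix t :: real assume "0 \<le> t" "t \<le> 1"
      then show "\<exists>y. ((\<lambda>t. t\<^sup>2 / 2 * ((M + m) * (norm z)\<^sup>2) - g t) has_real_derivative y) (at t) \<and> 0 \<le> y"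
        using b(2)[of t] by (intro exI[of _ "t * ((M + m) * (norm z)\<^sup>2) - g' t"] conjI[OF DERIV_diff[OF sq g]]) linarith
    qed simp
    ultimately show ?thesis by (simp add: g_def f0)
  qed
  show ?thesis using r(1) m main by (intro exI[of _ r] conjI exI[of _ "m / 4"] exI[of _ "(M + m) / 2"]) auto
qed

section \<open>Functions on the torus\<close>

lemma abs_torus_eq_iff: "abs_torus z = abs_torus w \<longleftrightarrow> fst z - fst w \<in> \<int> \<and> snd z - snd w \<in> \<int>"
  by (simp add: torus.abs_eq_iff torus_rel_def)

lemma torus_lift:
  obtains z where "x = abs_torus z" "z \<in> {0..<1} \<times> {0..<1}"
proof -
  obtain w where w: "x = abs_torus w" using torus.abs_induct[of "\<lambda>x. \<exists>w. x = abs_torus w" x] by blast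
  have "x = abs_torus (frac (fst w), frac (snd w))"
    by (simp add: w abs_torus_eq_iff frac_def)
  then show ?thesis by (rule that) (simp add: frac_lt_1)
qed

lemma compact_torus: "compact (UNIV :: torus set)"
proof -
  have "abs_torus ` cbox (0, 0) (1, 1) = UNIV"
  proof (intro equalityI subsetI UNIV_I)
    fix x :: torus
    obtain z where "x = abs_torus z" "z \<in> {0..<1} \<times> {0..<1}" by (rule torus_lift)
    then show "x \<in> abs_torus ` cbox (0, 0) (1, 1)"
      by (cases z) (auto simp: cbox_Pair_eq intro!: image_eqI)
  qed
  moreover have "compact (abs_torus ` cbox (0, 0) (1, 1))"
    by (intro compact_continuous_image continuous_on_subset[OF continuous_on_abs_torus] compact_cbox) auto
  ultimately show ?thesis by simp
qed

lemma continuous_on_torusI: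
  fixes f :: "torus \<Rightarrow> 'a::topological_space"
  assumes "continuous_on UNIV (\<lambda>z. f (abs_torus z))"
  shows "continuous_on UNIV f"
proof -
  have "open (f -` B)" if "open B" for B
    using assms that by (simp add: continuous_on_open_vimage[OF open_UNIV] open_torus_def vimage_def)
  then show ?thesis by (simp add: continuous_on_open_vimage[OF open_UNIV])
qed

text \<open>The saturation of an open set is the union of its integer translates. Openness of the
  projection later shows that a set of good points on the torus is Borel.\<close>

lemma open_abs_torus_image:
  assumes "open U"
  shows "open (abs_torus ` U)"
proof -
  have "abs_torus -` abs_torus ` U = (\<Union>m::int. \<Union>n::int. (+) (of_int m, of_int n) ` U)"
  proof (intro equalityI subsetI)
    fix z assume "z \<in> abs_torus -` abs_torus ` U"
    then obtain w where w: "w \<in> U" "fst z - fst w \<in> \<int>" "snd z - snd w \<in> \<int>"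
      by (auto simp: abs_torus_eq_iff)
    then obtain m n where "fst z - fst w = of_int m" "snd z - snd w = of_int n" by (auto elim!: Ints_cases)
    then have "z = (of_int m, of_int n) + w" by (simp add: prod_eq_iff)
    then show "z \<in> (\<Union>m::int. \<Union>n::int. (+) (of_int m, of_int n) ` U)" using w(1) by blast
  next
    fix z assume "z \<in> (\<Union>m::int. \<Union>n::int. (+) (of_int m, of_int n) ` U)"
    then obtain m n :: int and w where w: "z = (of_int m, of_int n) + w" "w \<in> U" by blast
    then have "abs_torus z = abs_torus w" by (simp add: abs_torus_eq_iff)
    then show "z \<in> abs_torus -` abs_torus ` U" using w(2) by auto
  qed
  also have "open \<dots>" using assms by (intro open_UN ballI open_translation)
  finally show ?thesis by (simp add: open_torus_def)
qed

section \<open>Periodic squared distances to the stopping points, and the speed in terms of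
  them\<close>

definition lattice_form :: "real \<Rightarrow> real \<times> real \<Rightarrow> real" where
  "lattice_form b z = (sin (pi * fst z))\<^sup>2 + (sin (pi * (snd z - b)))\<^sup>2"

lemma lat_eq_lattice_form: "lat (\<eta> - b) \<alpha> x = lattice_form b (x, \<eta> + \<alpha> * x)"
  by (simp add: lat_def lattice_form_def algebra_simps)

lemma lattice_form_bounds: "0 \<le> lattice_form b z" "lattice_form b z \<le> 2"
proof -
  have "(sin t)\<^sup>2 \<le> 1" for t :: real using abs_sin_le_one[of t] by (simp add: abs_square_le_1)
  from add_mono[OF this this] show "lattice_form b z \<le> 2" by (simp add: lattice_form_def)
qed (simp add: lattice_form_def)

lemma continuous_on_lattice_form [continuous_intros]: "continuous_on A (lattice_form b)"
  unfolding lattice_form_def by (intro continuous_intros)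

lemma lattice_form_eq_0_iff: "lattice_form b z = 0 \<longleftrightarrow> abs_torus z = abs_torus (0, b)"
proof -
  have *: "sin (pi * y) = 0 \<longleftrightarrow> y \<in> \<int>" for y :: real
    by (auto simp: sin_zero_iff_int2 Ints_def)
  show ?thesis unfolding lattice_form_def by (simp add: sum_power2_eq_zero_iff * abs_torus_eq_iff)
qed

lemma lattice_form_cong: "abs_torus z = abs_torus w \<Longrightarrow> lattice_form b z = lattice_form b w"
proof -
  assume "abs_torus z = abs_torus w"
  then obtain m n where "fst z - fst w = of_int m" "snd z - snd w = of_int n"
    unfolding abs_torus_eq_iff by (auto elim!: Ints_cases)
  then have z: "fst z = fst w + of_int m" "snd z - b = snd w - b + of_int n" by simp_all
  have "(sin (pi * (x + of_int k)))\<^sup>2 = (sin (pi * x))\<^sup>2" for x :: real and k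
    by (simp add: sin_pi_int_cancel)
  then show ?thesis unfolding lattice_form_def z by simp
qed

lemma lattice_form_near:
  assumes z0: "lattice_form b z0 = 0" and u: "norm u \<le> 1 / 2"
  shows "(norm u)\<^sup>2 \<le> lattice_form b (z0 + u)" "lattice_form b (z0 + u) \<le> pi\<^sup>2 * (norm u)\<^sup>2"
proof -
  have n: "(norm u)\<^sup>2 = (fst u)\<^sup>2 + (snd u)\<^sup>2" by (simp add: norm_prod_def)
  have u': "\<bar>fst u\<bar> \<le> 1 / 2" "\<bar>snd u\<bar> \<le> 1 / 2"
    using u norm_fst_le[of "fst u" "snd u"] norm_snd_le[of "snd u" "fst u"] by auto
  have "abs_torus (z0 + u) = abs_torus ((0, b) + u)"
    using z0 by (simp add: lattice_form_eq_0_iff abs_torus_eq_iff)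
  then have eq: "lattice_form b (z0 + u) = (sin (pi * fst u))\<^sup>2 + (sin (pi * snd u))\<^sup>2"
    using lattice_form_cong[of "z0 + u" "(0, b) + u" b] by (simp add: lattice_form_def)
  have sq: "x\<^sup>2 \<le> (sin (pi * x))\<^sup>2" "(sin (pi * x))\<^sup>2 \<le> pi\<^sup>2 * x\<^sup>2" if "\<bar>x\<bar> \<le> 1 / 2" for x
  proof -
    show "x\<^sup>2 \<le> (sin (pi * x))\<^sup>2" using abs_sin_pi_ge[OF that] by (simp add: abs_le_square_iff)
    have "\<bar>sin (pi * x)\<bar> \<le> \<bar>pi * x\<bar>" using abs_sin_pi_le[of x] by (simp add: abs_mult)
    then show "(sin (pi * x))\<^sup>2 \<le> pi\<^sup>2 * x\<^sup>2" by (simp add: abs_le_square_iff power_mult_distrib)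
  qed
  show "(norm u)\<^sup>2 \<le> lattice_form b (z0 + u)" "lattice_form b (z0 + u) \<le> pi\<^sup>2 * (norm u)\<^sup>2"
    unfolding n eq using sq[OF u'(1)] sq[OF u'(2)] by (auto simp: algebra_simps)
qed

lemma vanishing_comparable_near:
  fixes F :: "real \<times> real \<Rightarrow> real"
  assumes F: "C_k 3 F" "F z0 = 0" "\<And>x. 0 \<le> F x" "positive_definite (hessian F z0)" and z0: "lattice_form b z0 = 0"
  shows "\<exists>C>0. \<forall>\<^sub>F w in nhds z0. lattice_form b w \<le> C * F w \<and> F w \<le> C * lattice_form b w"
proof -
  obtain r c C where r: "0 < r" "0 < c" and
    b: "\<And>u. norm u < r \<Longrightarrow> c * (norm u)\<^sup>2 \<le> F (z0 + u) \<and> F (z0 + u) \<le> C * (norm u)\<^sup>2"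
    using quadratic_minimum_bounds[OF F] by blast
  define K where "K = \<bar>C\<bar> + pi\<^sup>2 / c"
  have "0 < pi\<^sup>2 / c" using r by simp
  then have K: "0 < K" "C \<le> K" unfolding K_def by linarith+
  have "pi\<^sup>2 / c \<le> K" unfolding K_def by simp
  then have "pi\<^sup>2 \<le> K * c" using r by (simp add: divide_le_eq)
  note K = K this
  have "lattice_form b w \<le> K * F w \<and> F w \<le> K * lattice_form b w" if w: "dist w z0 < min r (1 / 2)" for w
  proof -
    define u where "u = w - z0"
    have u: "norm u < r" "norm u \<le> 1 / 2" "w = z0 + u" using w by (auto simp: u_def dist_norm)
    have "lattice_form b w \<le> pi\<^sup>2 * (norm u)\<^sup>2" using lattice_form_near[OF z0 u(2)] u(3) by simp
    also have "\<dots> \<le> K * c * (norm u)\<^sup>2" using K by (intro mult_right_mono) auto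
    also have "\<dots> = K * (c * (norm u)\<^sup>2)" by simp
    also have "\<dots> \<le> K * F w" using b[OF u(1)] u(3) K by (intro mult_left_mono) auto
    finally have 1: "lattice_form b w \<le> K * F w" .
    have "F w \<le> C * (norm u)\<^sup>2" using b[OF u(1)] u(3) by simp
    also have "\<dots> \<le> K * (norm u)\<^sup>2" using K by (intro mult_right_mono) auto
    also have "\<dots> \<le> K * lattice_form b w"
      using lattice_form_near[OF z0 u(2)] u(3) K by (intro mult_left_mono) auto
    finally show ?thesis using 1 by blast
  qed
  then show ?thesis using K(1) r unfolding eventually_nhds_metric
    by (intro exI[of _ K] conjI exI[of _ "min r (1 / 2)"]) auto
qed

lemma continuous_on_UNIV_tendsto_nhds:
  fixes f :: "'a::topological_space \<Rightarrow> 'b::topological_space"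
  assumes "continuous_on UNIV f"
  shows "(f \<longlongrightarrow> f z) (nhds z)"
proof (rule topological_tendstoI)
  fix S assume "open S" "f z \<in> S"
  then have "open (f -` S)" "z \<in> f -` S"
    using assms by (auto simp: continuous_on_open_vimage[OF open_UNIV])
  then show "\<forall>\<^sub>F w in nhds z. f w \<in> S" unfolding eventually_nhds by blast
qed

lemma eventually_gt_half:
  fixes f :: "'a::topological_space \<Rightarrow> real"
  assumes "continuous_on UNIV f" "0 < f z"
  shows "\<forall>\<^sub>F w in nhds z. f z / 2 < f w"
proof -
  have "(f \<longlongrightarrow> f z) (nhds z)" using assms(1) by (rule continuous_on_UNIV_tendsto_nhds)
  then show ?thesis using assms(2) by (intro order_tendstoD(1)) auto
qed

text \<open>Near a zero of one form the other stays between a positive constant and 2, so only the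
  vanishing factor matters, and it is comparable to \<open>F\<close> by nondegeneracy.\<close>

lemma product_comparable_near:
  fixes F :: "real \<times> real \<Rightarrow> real"
  assumes F: "C_k 3 F" "F z0 = 0" "\<And>x. 0 \<le> F x" "positive_definite (hessian F z0)"
    and z0: "lattice_form b z0 = 0" "lattice_form b' z0 \<noteq> 0"
  shows "\<exists>C. \<forall>\<^sub>F w in nhds z0. lattice_form b w * lattice_form b' w \<le> 0 + C * F w"
    "\<exists>C. \<forall>\<^sub>F w in nhds z0. F w \<le> 0 + C * (lattice_form b w * lattice_form b' w)"
proof -
  obtain C where C: "C > 0" "\<forall>\<^sub>F w in nhds z0. lattice_form b w \<le> C * F w \<and> F w \<le> C * lattice_form b w"
    using vanishing_comparable_near[OF F z0(1)] by blast
  define s where "s = lattice_form b' z0 / 2"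
  have s: "0 < s" using z0(2) lattice_form_bounds(1)[of b' z0] by (simp add: s_def)
  have ev: "\<forall>\<^sub>F w in nhds z0. s < lattice_form b' w"
    unfolding s_def using z0(2) lattice_form_bounds(1)[of b' z0]
    by (intro eventually_gt_half continuous_on_lattice_form) auto
  have "\<forall>\<^sub>F w in nhds z0. lattice_form b w * lattice_form b' w \<le> 0 + (2 * C) * F w"
    using C(2)
  proof eventually_elim
    case (elim w)
    have "lattice_form b w * lattice_form b' w \<le> (C * F w) * 2"
      using elim lattice_form_bounds[of b w] lattice_form_bounds[of b' w] C(1) F(3)[of w] by (intro mult_mono) auto
    then show ?case by simp
  qed
  then show "\<exists>C. \<forall>\<^sub>F w in nhds z0. lattice_form b w * lattice_form b' w \<le> 0 + C * F w" by blast
  have "\<forall>\<^sub>F w in nhds z0. F w \<le> 0 + (C / s) * (lattice_form b w * lattice_form b' w)"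
    using C(2) ev
  proof eventually_elim
    case (elim w)
    have "F w \<le> C * lattice_form b w" using elim by simp
    also have "\<dots> = C / s * (lattice_form b w * s)" using s by simp
    also have "\<dots> \<le> C / s * (lattice_form b w * lattice_form b' w)"
      using elim C(1) s lattice_form_bounds(1)[of b w] by (intro mult_left_mono) auto
    finally show ?case by simp
  qed
  then show "\<exists>C. \<forall>\<^sub>F w in nhds z0. F w \<le> 0 + C * (lattice_form b w * lattice_form b' w)" by blast
qed

lemma continuous_bound_near:
  fixes f g :: "'a::topological_space \<Rightarrow> real"
  assumes "continuous_on UNIV f" "continuous_on UNIV g" "0 < g z"
  shows "\<exists>C. \<forall>\<^sub>F w in nhds z. f w \<le> 0 + C * g w"
proof -
  have "(f \<longlongrightarrow> f z) (nhds z)" using assms(1) by (rule continuous_on_UNIV_tendsto_nhds)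
  then have "\<forall>\<^sub>F w in nhds z. f w < \<bar>f z\<bar> + 1" by (intro order_tendstoD(2)) auto
  moreover have "\<forall>\<^sub>F w in nhds z. g z / 2 < g w" by (rule eventually_gt_half[OF assms(2,3)])
  ultimately have "\<forall>\<^sub>F w in nhds z. f w \<le> 0 + ((\<bar>f z\<bar> + 1) * 2 / g z) * g w"
  proof eventually_elim
    case (elim w)
    have "f w \<le> (\<bar>f z\<bar> + 1) * 2 / g z * (g z / 2)" using elim assms(3) by simp
    also have "\<dots> \<le> (\<bar>f z\<bar> + 1) * 2 / g z * g w" using elim assms(3) by (intro mult_left_mono) auto
    finally show ?case by simp
  qed
  then show ?thesis by blast
qed

text \<open>The product is the convenient model: one form divided by the speed is at most a multiple
  of the inverse of the other form, so weighting time by a form removes the singularity at its own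
  point. Local comparisons extend to the unit square by compactness and to the plane by
  periodicity.\<close>

lemma speed_comparable:
  fixes \<phi> :: "torus \<Rightarrow> real"
  assumes \<phi>: "C_k 3 (\<lambda>z. \<phi> (abs_torus z))" "\<phi> (abs_torus (0, 0)) = 0" "\<phi> (abs_torus (0, \<beta>)) = 0"
    "\<And>x. x \<noteq> abs_torus (0, 0) \<Longrightarrow> x \<noteq> abs_torus (0, \<beta>) \<Longrightarrow> 0 < \<phi> x"
    "\<And>z. abs_torus z \<in> {abs_torus (0, 0), abs_torus (0, \<beta>)} \<Longrightarrow> positive_definite (hessian (\<lambda>z. \<phi> (abs_torus z)) z)"
    and \<beta>: "abs_torus (0, 0) \<noteq> abs_torus (0, \<beta>)"
  shows "\<exists>C>0. \<forall>z. lattice_form 0 z * lattice_form \<beta> z \<le> C * \<phi> (abs_torus z) \<and>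
    \<phi> (abs_torus z) \<le> C * (lattice_form 0 z * lattice_form \<beta> z)"
proof -
  define F where "F z = \<phi> (abs_torus z)" for z
  define G where "G z = lattice_form 0 z * lattice_form \<beta> z" for z
  have F0: "0 \<le> \<phi> x" for x using \<phi>(2,3) \<phi>(4)[of x] by (cases "x = abs_torus (0, 0)"; cases "x = abs_torus (0, \<beta>)") auto
  have G0: "0 \<le> G z" for z by (simp add: G_def lattice_form_bounds)
  have cF: "continuous_on UNIV F" unfolding F_def using \<phi>(1) by (rule C_k_imp_continuous_on)
  have cG: "continuous_on UNIV G" unfolding G_def by (intro continuous_intros)
  have loc: "(\<exists>C. \<forall>\<^sub>F w in nhds z. G w \<le> 0 + C * F w) \<and> (\<exists>C. \<forall>\<^sub>F w in nhds z. F w \<le> 0 + C * G w)" for z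
  proof -
    consider "abs_torus z = abs_torus (0, 0)" | "abs_torus z = abs_torus (0, \<beta>)"
      | "abs_torus z \<noteq> abs_torus (0, 0)" "abs_torus z \<noteq> abs_torus (0, \<beta>)" by blast
    then show ?thesis
    proof cases
      case 1
      show ?thesis unfolding G_def F_def
        by (intro conjI product_comparable_near) (use 1 \<phi> F0 \<beta> in \<open>simp_all add: lattice_form_eq_0_iff\<close>)
    next
      case 2
      show ?thesis unfolding G_def F_def mult.commute[of "lattice_form 0 _"]
        by (intro conjI product_comparable_near) (use 2 \<phi> F0 \<beta> in \<open>simp_all add: lattice_form_eq_0_iff\<close>)
    next
      case 3
      then have "0 < F z" "G z \<noteq> 0" using \<phi>(4) by (simp_all add: F_def G_def lattice_form_eq_0_iff)
      then have "0 < F z" "0 < G z" using G0[of z] by auto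
      then show ?thesis using continuous_bound_near[OF cF cG] continuous_bound_near[OF cG cF] by blast
    qed
  qed
  obtain C1 where C1: "C1 > 0" "\<And>z. z \<in> cbox (0, 0) (1, 1) \<Longrightarrow> G z \<le> C1 * F z"
    using compact_local_bound[OF compact_cbox, of F "(0, 0)" "(1, 1)" G "\<lambda>_. 0"] loc F0 by (auto simp: F_def)
  obtain C2 where C2: "C2 > 0" "\<And>z. z \<in> cbox (0, 0) (1, 1) \<Longrightarrow> F z \<le> C2 * G z"
    using compact_local_bound[OF compact_cbox, of G "(0, 0)" "(1, 1)" F "\<lambda>_. 0"] loc G0 by auto
  have "G z \<le> (C1 + C2) * F z \<and> F z \<le> (C1 + C2) * G z" for z
  proof -
    obtain w where w: "abs_torus z = abs_torus w" "w \<in> {0..<1} \<times> {0..<1}" by (rule torus_lift)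
    then have wc: "w \<in> cbox (0, 0) (1, 1)" by (cases w) (auto simp: cbox_Pair_eq)
    have eq: "F z = F w" "G z = G w" using w(1) lattice_form_cong[OF w(1)] by (simp_all add: F_def G_def)
    have "C1 * F w \<le> (C1 + C2) * F w" "C2 * G w \<le> (C1 + C2) * G w"
      using C1(1) C2(1) F0[of "abs_torus w"] G0[of w] by (simp_all add: F_def mult_right_mono)
    then show ?thesis using C1(2)[OF wc] C2(2)[OF wc] eq by auto
  qed
  then show ?thesis using C1(1) C2(1) unfolding F_def G_def by (intro exI[of _ "C1 + C2"]) auto
qed

section \<open>Time averages along an orbit\<close>

text \<open>Position replaces time as the variable of integration. For \<open>k = 1\<close> the last
  claim expresses the elapsed time as the integral of \<open>1 / g\<close>; for \<open>k\<close> a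
  form it computes the quantity to be averaged. The solution cannot remain below \<open>X\<close>,
  because \<open>g\<close> has a positive minimum between \<open>\<xi> 0\<close> and
  \<open>X\<close>.\<close>

lemma autonomous_ode_facts:
  fixes \<xi> g :: "real \<Rightarrow> real"
  assumes \<xi>: "\<And>t. (\<xi> has_real_derivative g (\<xi> t)) (at t)" and g: "continuous_on UNIV g"
    "\<And>x. 0 \<le> g x" "\<And>x. \<xi> 0 \<le> x \<Longrightarrow> 0 < g x"
  shows "s \<le> t \<Longrightarrow> \<xi> s \<le> \<xi> t" and "\<exists>t\<ge>0. X \<le> \<xi> t"
    and "continuous_on UNIV k \<Longrightarrow> 0 \<le> t \<Longrightarrow> integral {0..t} (\<lambda>s. k (\<xi> s)) = integral {\<xi> 0..\<xi> t} (\<lambda>x. k x / g x)"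
proof -
  show mono: "\<xi> s \<le> \<xi> t" if "s \<le> t" for s t
    using that \<xi> g(2) by (intro DERIV_nonneg_imp_nondecreasing[of s t \<xi>]) blast+
  show "\<exists>t\<ge>0. X \<le> \<xi> t"
  proof (rule ccontr)
    assume "\<not> (\<exists>t\<ge>0. X \<le> \<xi> t)"
    then have b: "\<xi> t < X" if "0 \<le> t" for t using that by (meson not_le)
    have "{\<xi> 0..X} \<noteq> {}" using b[of 0] by auto
    then obtain x where x: "x \<in> {\<xi> 0..X}" "\<And>y. y \<in> {\<xi> 0..X} \<Longrightarrow> g x \<le> g y"
      using continuous_attains_inf[of "{\<xi> 0..X}" g] continuous_on_subset[OF g(1)] by auto
    have m: "0 < g x" using x g(3) by auto
    have lin: "\<xi> 0 + g x * t \<le> \<xi> t" if t: "0 \<le> t" for t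
    proof -
      have "\<xi> 0 - g x * 0 \<le> \<xi> t - g x * t"
      proof (rule DERIV_nonneg_imp_nondecreasing[of 0 t "\<lambda>t. \<xi> t - g x * t"])
        fix s assume s: "0 \<le> s" "s \<le> t"
        have "((\<lambda>t. \<xi> t - g x * t) has_real_derivative g (\<xi> s) - g x) (at s)"
          using \<xi> by (auto intro!: derivative_eq_intros)
        moreover have "g x \<le> g (\<xi> s)" using mono[of 0 s] b[of s] s by (intro x(2)) auto
        ultimately show "\<exists>y. ((\<lambda>t. \<xi> t - g x * t) has_real_derivative y) (at s) \<and> 0 \<le> y" by force
      qed (use t in auto)
      then show ?thesis by simp
    qed
    define t where "t = (X - \<xi> 0) / g x"
    have "0 \<le> t" using m b[of 0] by (simp add: t_def)
    then have "\<xi> 0 + g x * t \<le> \<xi> t" "\<xi> t < X" by (auto intro: lin b)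
    then show False using m by (simp add: t_def)
  qed
  show "integral {0..t} (\<lambda>s. k (\<xi> s)) = integral {\<xi> 0..\<xi> t} (\<lambda>x. k x / g x)"
    if k: "continuous_on UNIV k" and t: "0 \<le> t"
  proof -
    have "((\<lambda>s. g (\<xi> s) *\<^sub>R (k (\<xi> s) / g (\<xi> s))) has_integral integral {\<xi> 0..\<xi> t} (\<lambda>x. k x / g x)) {0..t}"
    proof (rule has_integral_substitution[where c = "\<xi> 0" and d = "\<xi> t"])
      show "continuous_on {\<xi> 0..\<xi> t} (\<lambda>x. k x / g x)"
        using g(3) by (intro continuous_intros continuous_on_subset[OF k] continuous_on_subset[OF g(1)]) (auto simp: less_imp_neq[symmetric])
      show "(\<xi> has_real_derivative g (\<xi> s)) (at s within {0..t})" for s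
        using \<xi> by (rule has_field_derivative_at_within)
    qed (use t mono in auto)
    then have "integral {0..t} (\<lambda>s. g (\<xi> s) *\<^sub>R (k (\<xi> s) / g (\<xi> s))) = integral {\<xi> 0..\<xi> t} (\<lambda>x. k x / g x)"
      by (rule integral_unique)
    moreover have "integral {0..t} (\<lambda>s. g (\<xi> s) *\<^sub>R (k (\<xi> s) / g (\<xi> s))) = integral {0..t} (\<lambda>s. k (\<xi> s))"
    proof (rule integral_cong)
      fix s assume "s \<in> {0..t}"
      then have "0 < g (\<xi> s)" using g(3) mono by auto
      then show "g (\<xi> s) *\<^sub>R (k (\<xi> s) / g (\<xi> s)) = k (\<xi> s)" by simp
    qed
    ultimately show ?thesis by simp
  qed
qed

definition torus_form :: "real \<Rightarrow> torus \<Rightarrow> real" where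
  "torus_form b x = lattice_form b (rep_torus x)"

lemma abs_rep_torus [simp]: "abs_torus (rep_torus x) = x"
  by (rule Quotient3_abs_rep[OF Quotient3_torus])

lemma torus_form_abs: "torus_form b (abs_torus z) = lattice_form b z"
  unfolding torus_form_def by (rule lattice_form_cong) simp

lemma torus_form_eq_0_iff: "torus_form b x = 0 \<longleftrightarrow> x = abs_torus (0, b)"
  by (simp add: torus_form_def lattice_form_eq_0_iff)

lemma torus_form_nonneg: "0 \<le> torus_form b x"
  by (simp add: torus_form_def lattice_form_bounds)

lemma continuous_on_torus_form: "continuous_on UNIV (torus_form b)"
  by (rule continuous_on_torusI) (simp add: torus_form_abs continuous_on_lattice_form)

text \<open>For each \<open>k\<close> a sufficiently late \<open>q\<close> makes the drift up to
  \<open>k\<close> smaller than the gap, so the forward line never hits the lattice.\<close>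

lemma frequently_approach_imp_lat_pos:
  assumes b: "1 \<le> b" and freq: "\<And>n. \<exists>q\<ge>n. \<exists>p. well_approximated q p \<alpha> \<and> \<eta> \<in> approach b q" and x: "0 < x"
  shows "0 < lat \<eta> \<alpha> x"
proof (rule lat_pos[OF _ x])
  fix k :: nat
  define B where "B = real b"
  have "0 < B" using b by (simp add: B_def)
  then have "eventually (\<lambda>q :: nat. real k * exp (- (real q ^ 3)) < 1 / (4 * B)) at_top" by real_asymp
  then obtain n where n: "\<And>q. q \<ge> n \<Longrightarrow> real k * exp (- (real q ^ 3)) < 1 / (4 * real b)"
    unfolding eventually_at_top_linorder B_def by auto
  obtain q p where "q \<ge> n" "well_approximated q p \<alpha>" "\<eta> \<in> approach b q" using freq by blast
  then show "\<eta> + \<alpha> * real k \<notin> \<int>" using approach_imp_not_Ints b n by blast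
qed

text \<open>Near one stopping point the orbit is so slow that the time spent there swamps, along a
  sequence of times, the integral of the form vanishing at that point.\<close>

lemma slow_passage:
  fixes g \<xi> :: "real \<Rightarrow> real"
  assumes \<xi>: "\<And>t. (\<xi> has_real_derivative g (\<xi> t)) (at t)" and g: "continuous_on UNIV g"
    "\<And>x. 0 \<le> g x" "\<And>x. \<xi> 0 \<le> x \<Longrightarrow> 0 < g x"
    and C: "0 < C" "\<And>x. lat \<eta> \<alpha> x * lat (\<eta> - \<beta>) \<alpha> x \<le> C * g x" "\<And>x. g x \<le> C * (lat \<eta> \<alpha> x * lat (\<eta> - \<beta>) \<alpha> x)"
    and \<xi>0: "0 < \<xi> 0" "\<xi> 0 \<le> 1" and b: "1 \<le> b" "real b * \<beta> \<in> \<int>"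
    and freq: "\<And>n. \<exists>q\<ge>n. \<exists>p. well_approximated q p \<alpha> \<and> real q * \<beta> \<notin> \<int> \<and> \<eta> \<in> approach b q"
    and pos: "\<And>x. 0 < x \<Longrightarrow> 0 < lat (\<eta> - \<beta>) \<alpha> x"
  shows "((\<lambda>t. (\<xi> t - \<xi> 0) / t) \<longlongrightarrow> 0) at_top"
    and "0 < \<epsilon> \<Longrightarrow> \<exists>t\<ge>T. integral {0..t} (\<lambda>s. lat \<eta> \<alpha> (\<xi> s)) \<le> \<epsilon> * t"
proof -
  note ode = autonomous_ode_facts[OF \<xi> g]
  have pos': "0 < lat \<eta> \<alpha> x" if "0 < x" for x
    using frequently_approach_imp_lat_pos[OF b(1) _ that] freq by blast
  \<comment> \<open>The other form is at most 2, hence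
    \<open>g \<le> 2 * C * lat \<eta> \<alpha>\<close>, and the integral of \<open>1 / g\<close> is
    the elapsed time.\<close>
  have time: "integral {\<xi> 0..\<xi> t} (\<lambda>x. 1 / lat \<eta> \<alpha> x) \<le> 2 * C * t" if t: "0 \<le> t" for t
  proof -
    have "integral {\<xi> 0..\<xi> t} (\<lambda>x. 1 / lat \<eta> \<alpha> x) \<le> integral {\<xi> 0..\<xi> t} (\<lambda>x. 2 * C * (1 / g x))"
    proof (rule integral_le)
      show "(\<lambda>x. 1 / lat \<eta> \<alpha> x) integrable_on {\<xi> 0..\<xi> t}"
        using \<xi>0 pos' by (intro integrable_inverse_lat) auto
      show "(\<lambda>x. 2 * C * (1 / g x)) integrable_on {\<xi> 0..\<xi> t}"
        using g(3) by (intro integrable_continuous_interval continuous_intros continuous_on_subset[OF g(1)])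
          (auto simp: less_imp_neq[symmetric])
      fix x assume "x \<in> {\<xi> 0..\<xi> t}"
      then have x: "0 < lat \<eta> \<alpha> x" "0 < g x" using \<xi>0 pos' g(3) by auto
      have "lat (\<eta> - \<beta>) \<alpha> x \<le> 2" using lattice_form_bounds by (simp add: lat_eq_lattice_form)
      then have "lat \<eta> \<alpha> x * lat (\<eta> - \<beta>) \<alpha> x \<le> lat \<eta> \<alpha> x * 2" using x by (intro mult_left_mono) auto
      then have "C * (lat \<eta> \<alpha> x * lat (\<eta> - \<beta>) \<alpha> x) \<le> C * (lat \<eta> \<alpha> x * 2)"
        by (rule mult_left_mono) (use C(1) in simp)
      then have "g x \<le> 2 * C * lat \<eta> \<alpha> x" using C(3)[of x] by linarith
      then show "1 / lat \<eta> \<alpha> x \<le> 2 * C * (1 / g x)" using x by (simp add: field_simps)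
    qed
    also have "\<dots> = 2 * C * integral {\<xi> 0..\<xi> t} (\<lambda>x. 1 / g x)" by (rule integral_mult_right)
    also have "integral {\<xi> 0..\<xi> t} (\<lambda>x. 1 / g x) = t" using ode(3)[of "\<lambda>_. 1" t] t by simp
    finally show ?thesis .
  qed
  have ex_T: "\<exists>T. \<forall>t\<ge>T. X \<le> \<xi> t" for X using ode(1,2) by (meson order_trans)
  show "((\<lambda>t. (\<xi> t - \<xi> 0) / t) \<longlongrightarrow> 0) at_top"
  proof (rule tendstoI)
    fix e :: real assume e: "0 < e"
    \<comment> \<open>Time grows superlinearly in position, hence position sublinearly in time: with
      \<open>time\<close> the factor \<open>4 * C / e\<close> yields
      \<open>2 * \<xi> t \<le> e * t\<close>.\<close>
    have "\<exists>X0. \<forall>X\<ge>X0. 4 * C / e * X \<le> integral {\<xi> 0..X} (\<lambda>x. 1 / lat \<eta> \<alpha> x)"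
    proof (rule integral_inverse_lat_superlinear)
      show "\<exists>q\<ge>n. \<exists>p. well_approximated q p \<alpha>" for n using freq by blast
    qed (use pos' \<xi>0 C(1) e in auto)
    then obtain X0 where X0: "\<And>X. X0 \<le> X \<Longrightarrow> 4 * C / e * X \<le> integral {\<xi> 0..X} (\<lambda>x. 1 / lat \<eta> \<alpha> x)"
      by blast
    obtain T where T: "\<And>t. T \<le> t \<Longrightarrow> X0 \<le> \<xi> t" using ex_T by blast
    show "\<forall>\<^sub>F t in at_top. dist ((\<xi> t - \<xi> 0) / t) 0 < e"
      unfolding eventually_at_top_linorder
    proof (intro exI allI impI)
      fix t assume t: "max 1 T \<le> t"
      have "4 * C / e * \<xi> t \<le> 2 * C * t" using X0[OF T, of t] time[of t] t by auto
      then have "2 * \<xi> t \<le> e * t" using C(1) e by (simp add: field_simps)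
      moreover have "\<xi> 0 \<le> \<xi> t" using ode(1)[of 0 t] t by simp
      moreover have "0 < e * t" using e t by simp
      ultimately have "0 \<le> \<xi> t - \<xi> 0" "\<xi> t - \<xi> 0 < e * t" using \<xi>0 by linarith+
      then show "dist ((\<xi> t - \<xi> 0) / t) 0 < e" using t by (simp add: divide_less_eq)
    qed
  qed
  show "\<exists>t\<ge>T. integral {0..t} (\<lambda>s. lat \<eta> \<alpha> (\<xi> s)) \<le> \<epsilon> * t" if \<epsilon>: "0 < \<epsilon>"
  proof -
    \<comment> \<open>The denominator \<open>2 * C\<^sup>2\<close> cancels the factor
      \<open>C\<close> from the bound on \<open>lat \<eta> \<alpha> x / g x\<close> and the factor
      \<open>2 * C\<close> from \<open>time\<close>. Requiring \<open>X\<close> beyond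
      \<open>\<xi> (max 0 T)\<close> makes the time of arrival at \<open>X\<close> at least
      \<open>T\<close>.\<close>
    have "\<exists>X\<ge>max (\<xi> 0) (\<xi> (max 0 T) + 1). integral {\<xi> 0..X} (\<lambda>x. 1 / lat (\<eta> - \<beta>) \<alpha> x) \<le> \<epsilon> / (2 * C\<^sup>2) * integral {\<xi> 0..X} (\<lambda>x. 1 / lat \<eta> \<alpha> x)"
      using \<epsilon> C(1) by (intro integral_inverse_lat_dominates[OF b _ freq pos' \<xi>0]) auto
    then obtain X where X: "\<xi> 0 \<le> X" "\<xi> (max 0 T) < X"
      "integral {\<xi> 0..X} (\<lambda>x. 1 / lat (\<eta> - \<beta>) \<alpha> x) \<le> \<epsilon> / (2 * C\<^sup>2) * integral {\<xi> 0..X} (\<lambda>x. 1 / lat \<eta> \<alpha> x)"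
      by auto
    obtain t1 where t1: "0 \<le> t1" "X \<le> \<xi> t1" using ode(2) by blast
    have "continuous_on {0..t1} \<xi>" using \<xi> by (meson DERIV_isCont continuous_at_imp_continuous_on)
    then obtain t where t: "0 \<le> t" "\<xi> t = X" using IVT'[of \<xi> 0 X t1] X(1) t1 by blast
    have "T \<le> t" using ode(1)[of t "max 0 T"] X(2) t by (cases "t \<le> max 0 T") auto
    have "integral {0..t} (\<lambda>s. lat \<eta> \<alpha> (\<xi> s)) = integral {\<xi> 0..X} (\<lambda>x. lat \<eta> \<alpha> x / g x)"
      using ode(3)[of "lat \<eta> \<alpha>" t] t continuous_on_lat by simp
    also have "\<dots> \<le> integral {\<xi> 0..X} (\<lambda>x. C * (1 / lat (\<eta> - \<beta>) \<alpha> x))"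
    proof (rule integral_le)
      show "(\<lambda>x. lat \<eta> \<alpha> x / g x) integrable_on {\<xi> 0..X}"
        using g(3) by (intro integrable_continuous_interval continuous_intros continuous_on_subset[OF g(1)])
          (auto simp: less_imp_neq[symmetric])
      show "(\<lambda>x. C * (1 / lat (\<eta> - \<beta>) \<alpha> x)) integrable_on {\<xi> 0..X}"
        using \<xi>0 pos by (intro integrable_on_mult_right integrable_inverse_lat) auto
      fix x assume "x \<in> {\<xi> 0..X}"
      then have "0 < lat (\<eta> - \<beta>) \<alpha> x" "0 < g x" using \<xi>0 pos g(3) by auto
      then show "lat \<eta> \<alpha> x / g x \<le> C * (1 / lat (\<eta> - \<beta>) \<alpha> x)"
        using C(2)[of x] by (simp add: field_simps)
    qed
    also have "\<dots> = C * integral {\<xi> 0..X} (\<lambda>x. 1 / lat (\<eta> - \<beta>) \<alpha> x)" by (rule integral_mult_right)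
    also have "\<dots> \<le> C * (\<epsilon> / (2 * C\<^sup>2) * (2 * C * t))"
    proof (rule mult_left_mono[OF order.trans[OF X(3) mult_left_mono]])
      show "integral {\<xi> 0..X} (\<lambda>x. 1 / lat \<eta> \<alpha> x) \<le> 2 * C * t" using time[of t] t by simp
    qed (use \<epsilon> C(1) in auto)
    also have "\<dots> = \<epsilon> * t" using C(1) by (simp add: power2_eq_square)
    finally show ?thesis using \<open>T \<le> t\<close> by blast
  qed
qed

text \<open>The orbit lifts to the line of slope \<alpha> through \<open>z\<close>, and its abscissa
  \<xi> solves an autonomous equation whose right-hand side is \<phi> on the line. The average of
  \<phi> is therefore \<open>(\<xi> t - \<xi> 0) / t\<close>, and the averages of the two forms are
  instances of \<open>slow_passage\<close>.\<close>

lemma orbit_averages: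
  fixes \<phi> :: "torus \<Rightarrow> real"
  assumes \<phi>: "C_k 3 (\<lambda>z. \<phi> (abs_torus z))" "\<phi> (abs_torus (0, 0)) = 0" "\<phi> (abs_torus (0, \<beta>)) = 0"
    "\<And>x. x \<noteq> abs_torus (0, 0) \<Longrightarrow> x \<noteq> abs_torus (0, \<beta>) \<Longrightarrow> 0 < \<phi> x"
    "\<And>z. abs_torus z \<in> {abs_torus (0, 0), abs_torus (0, \<beta>)} \<Longrightarrow> positive_definite (hessian (\<lambda>z. \<phi> (abs_torus z)) z)"
    and \<beta>: "abs_torus (0, 0) \<noteq> abs_torus (0, \<beta>)"
    and flow: "flow_generated_by (\<lambda>x. \<phi> x *\<^sub>R (1, \<alpha>)) \<Phi>"
    and x: "x = abs_torus z" "0 < fst z" "fst z \<le> 1"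
    and b: "1 \<le> b" "real b * \<beta> \<in> \<int>"
    and freq: "\<And>n. \<exists>q\<ge>n. \<exists>p. well_approximated q p \<alpha> \<and> real q * \<beta> \<notin> \<int> \<and> snd z - \<alpha> * fst z \<in> approach b q"
      "\<And>n. \<exists>q\<ge>n. \<exists>p. well_approximated q p \<alpha> \<and> real q * \<beta> \<notin> \<int> \<and> snd z - \<alpha> * fst z - \<beta> \<in> approach b q"
  shows "((\<lambda>t. 1 / t * integral {0..t} (\<lambda>s. \<phi> (\<Phi> s x))) \<longlongrightarrow> 0) at_top"
    and "0 < \<epsilon> \<Longrightarrow> \<exists>t\<ge>T. integral {0..t} (\<lambda>s. torus_form 0 (\<Phi> s x)) \<le> \<epsilon> * t"
    and "0 < \<epsilon> \<Longrightarrow> \<exists>t\<ge>T. integral {0..t} (\<lambda>s. torus_form \<beta> (\<Phi> s x)) \<le> \<epsilon> * t"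
proof -
  obtain c0 where c0: "\<And>t. abs_torus (c0 t) = \<Phi> t x" "\<And>t. (c0 has_vector_derivative \<phi> (\<Phi> t x) *\<^sub>R (1, \<alpha>)) (at t)"
    using flow unfolding flow_generated_by_def by blast
  have "\<Phi> 0 x = x" using flow unfolding flow_generated_by_def is_flow_def by blast
  then have z0: "abs_torus (c0 0) = abs_torus z" using c0(1)[of 0] x(1) by simp
  \<comment> \<open>The given lift may start at another representative of \<open>x\<close>; an
    integer translation moves its start to \<open>z\<close>.\<close>
  define c where "c t = c0 t + (z - c0 0)" for t
  have c1: "abs_torus (c t) = \<Phi> t x" for t
  proof -
    have "abs_torus (c t) = abs_torus (c0 t)"
      using z0 by (simp add: c_def abs_torus_eq_iff) (metis Ints_minus minus_diff_eq)
    then show ?thesis using c0(1) by simp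
  qed
  have c2: "(c has_vector_derivative \<phi> (abs_torus (c t)) *\<^sub>R (1, \<alpha>)) (at t)" for t
    unfolding c1 unfolding c_def using c0(2)[of t] by (simp add: has_vector_derivative_add_const)
  define \<eta> where "\<eta> = snd z - \<alpha> * fst z"
  define \<xi> where "\<xi> t = fst (c t)" for t
  have f1: "((\<lambda>t. fst (c t)) has_real_derivative \<phi> (abs_torus (c t))) (at t)" for t
    using has_derivative_fst[OF c2[of t, unfolded has_vector_derivative_def]]
    by (simp add: has_field_derivative_def mult.commute[of _ "\<phi> _"])
  have f2: "((\<lambda>t. snd (c t)) has_real_derivative \<phi> (abs_torus (c t)) * \<alpha>) (at t)" for t
  proof -
    have "(\<lambda>s. s * (\<phi> (abs_torus (c t)) * \<alpha>)) = (*) (\<phi> (abs_torus (c t)) * \<alpha>)" by (simp add: fun_eq_iff)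
    then show ?thesis using has_derivative_snd[OF c2[of t, unfolded has_vector_derivative_def]]
      by (simp add: has_field_derivative_def)
  qed
  have "((\<lambda>t. snd (c t) - \<alpha> * fst (c t)) has_real_derivative 0) (at t)" for t
    using DERIV_diff[OF f2[of t] DERIV_cmult[OF f1[of t], of \<alpha>]] by (simp add: mult.commute)
  then have "snd (c t) - \<alpha> * fst (c t) = snd (c 0) - \<alpha> * fst (c 0)" for t
    using DERIV_isconst_all[of "\<lambda>t. snd (c t) - \<alpha> * fst (c t)" t 0] by blast
  then have line: "c t = (\<xi> t, \<eta> + \<alpha> * \<xi> t)" for t
    by (simp add: prod_eq_iff \<xi>_def \<eta>_def c_def algebra_simps)
  define g where "g y = \<phi> (abs_torus (y, \<eta> + \<alpha> * y))" for y
  have \<xi>: "(\<xi> has_real_derivative g (\<xi> t)) (at t)" for t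
    using f1[of t] unfolding \<xi>_def[symmetric] g_def line[symmetric] .
  have \<Phi>: "\<Phi> t x = abs_torus (\<xi> t, \<eta> + \<alpha> * \<xi> t)" for t using c1 line by metis
  have \<xi>0: "\<xi> 0 = fst z" by (simp add: \<xi>_def c_def)
  have F0: "0 \<le> \<phi> x" for x using \<phi>(2,3) \<phi>(4)[of x] by (cases "x = abs_torus (0, 0)"; cases "x = abs_torus (0, \<beta>)") auto
  have contF: "continuous_on UNIV (\<lambda>z. \<phi> (abs_torus z))" using \<phi>(1) by (rule C_k_imp_continuous_on)
  have contg: "continuous_on UNIV g" unfolding g_def
    by (rule continuous_on_compose2[OF contF]) (auto intro!: continuous_intros)
  obtain C where C: "0 < C" "\<And>z. lattice_form 0 z * lattice_form \<beta> z \<le> C * \<phi> (abs_torus z)"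
    "\<And>z. \<phi> (abs_torus z) \<le> C * (lattice_form 0 z * lattice_form \<beta> z)"
    using speed_comparable[OF \<phi> \<beta>] by blast
  have lat0: "lat \<eta> \<alpha> y = lattice_form 0 (y, \<eta> + \<alpha> * y)" for y
    using lat_eq_lattice_form[of \<eta> 0] by simp
  have C': "lat \<eta> \<alpha> y * lat (\<eta> - \<beta>) \<alpha> y \<le> C * g y" "g y \<le> C * (lat \<eta> \<alpha> y * lat (\<eta> - \<beta>) \<alpha> y)" for y
    using C(2,3) unfolding lat0 lat_eq_lattice_form g_def by blast+
  have pos: "0 < lat \<eta> \<alpha> y" "0 < lat (\<eta> - \<beta>) \<alpha> y" if "0 < y" for y
    using frequently_approach_imp_lat_pos[OF b(1) _ that] freq unfolding \<eta>_def by blast+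
  have gpos: "0 < g y" if "\<xi> 0 \<le> y" for y
  proof -
    have "0 < lat \<eta> \<alpha> y * lat (\<eta> - \<beta>) \<alpha> y" using pos[of y] that x \<xi>0 by simp
    then have "0 < C * g y" using C'(1)[of y] by linarith
    then show ?thesis using C(1) by (simp add: zero_less_mult_iff)
  qed
  have g0: "0 \<le> g y" for y by (simp add: g_def F0)
  have tf: "torus_form 0 (\<Phi> s x) = lat \<eta> \<alpha> (\<xi> s)" "torus_form \<beta> (\<Phi> s x) = lat (\<eta> - \<beta>) \<alpha> (\<xi> s)" for s
    unfolding \<Phi> torus_form_abs lat0 lat_eq_lattice_form by simp_all
  note freq = freq[folded \<eta>_def]
  \<comment> \<open>The stopping points exchange roles: the phase becomes
    \<open>\<eta> - \<beta>\<close> and the offset \<open>- \<beta>\<close>, with the same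
    denominator \<open>b\<close>.\<close>
  have 2: "\<exists>t\<ge>T. integral {0..t} (\<lambda>s. lat (\<eta> - \<beta>) \<alpha> (\<xi> s)) \<le> \<epsilon> * t" if "0 < \<epsilon>" for \<epsilon> T
  proof (rule slow_passage(2)[of \<xi> g C "\<eta> - \<beta>" \<alpha> "- \<beta>" b])
    show "\<exists>q\<ge>n. \<exists>p. well_approximated q p \<alpha> \<and> real q * - \<beta> \<notin> \<int> \<and> \<eta> - \<beta> \<in> approach b q" for n
      using freq(2)[of n] by simp
    show "real b * - \<beta> \<in> \<int>" using b(2) by simp
    show "lat (\<eta> - \<beta>) \<alpha> x * lat (\<eta> - \<beta> - - \<beta>) \<alpha> x \<le> C * g x" "g x \<le> C * (lat (\<eta> - \<beta>) \<alpha> x * lat (\<eta> - \<beta> - - \<beta>) \<alpha> x)" for x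
      using C'[of x] by (simp_all add: mult.commute)
  qed (use \<xi> contg g0 gpos C(1) \<xi>0 x b(1) pos(1) that in auto)
  show "((\<lambda>t. 1 / t * integral {0..t} (\<lambda>s. \<phi> (\<Phi> s x))) \<longlongrightarrow> 0) at_top"
  proof (rule Lim_transform_eventually)
    show "((\<lambda>t. (\<xi> t - \<xi> 0) / t) \<longlongrightarrow> 0) at_top"
      by (rule slow_passage(1)[OF \<xi> contg g0 gpos C(1) C' _ _ b freq(1) pos(2)]) (use \<xi>0 x in auto)
    show "\<forall>\<^sub>F t in at_top. (\<xi> t - \<xi> 0) / t = 1 / t * integral {0..t} (\<lambda>s. \<phi> (\<Phi> s x))"
      using eventually_ge_at_top[of 0]
    proof eventually_elim
      case (elim t)
      have "((\<lambda>s. g (\<xi> s)) has_integral \<xi> t - \<xi> 0) {0..t}"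
        using elim \<xi> by (intro fundamental_theorem_of_calculus)
          (auto simp flip: has_real_derivative_iff_has_vector_derivative intro: has_field_derivative_at_within)
      then have "integral {0..t} (\<lambda>s. g (\<xi> s)) = \<xi> t - \<xi> 0" by (rule integral_unique)
      then show ?case by (simp add: \<Phi> g_def)
    qed
  qed
  show "\<exists>t\<ge>T. integral {0..t} (\<lambda>s. torus_form 0 (\<Phi> s x)) \<le> \<epsilon> * t" if "0 < \<epsilon>"
    unfolding tf by (rule slow_passage(2)[OF \<xi> contg g0 gpos C(1) C' _ _ b freq(1) pos(2) that]) (use \<xi>0 x in auto)
  show "\<exists>t\<ge>T. integral {0..t} (\<lambda>s. torus_form \<beta> (\<Phi> s x)) \<le> \<epsilon> * t" if "0 < \<epsilon>"
    unfolding tf by (rule 2[OF that])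
qed

section \<open>Limits of empirical measures\<close>

text \<open>At a zero of \<open>g\<close> continuity keeps \<open>\<bar>f\<bar>\<close> below
  \<epsilon>, elsewhere a multiple of \<open>g\<close> dominates, and compactness combines the two.
  Small time averages of \<open>g\<close> thus make those of \<open>f\<close> small.\<close>

lemma bound_by_nonneg_function:
  fixes f g :: "'a::topological_space \<Rightarrow> real"
  assumes "compact (UNIV :: 'a set)" and f: "continuous_on UNIV f" and g: "continuous_on UNIV g" "\<And>y. 0 \<le> g y"
    and zero: "\<And>y. g y = 0 \<Longrightarrow> f y = 0" and \<epsilon>: "0 < \<epsilon>"
  shows "\<exists>C>0. \<forall>y. \<bar>f y\<bar> \<le> \<epsilon> + C * g y"
proof -
  have "\<exists>C. \<forall>\<^sub>F w in nhds y. \<bar>f w\<bar> \<le> \<epsilon> + C * g w" for y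
  proof (cases "g y = 0")
    case True
    have "((\<lambda>y. \<bar>f y\<bar>) \<longlongrightarrow> \<bar>f y\<bar>) (nhds y)"
      by (intro continuous_on_UNIV_tendsto_nhds continuous_intros f)
    then have "\<forall>\<^sub>F w in nhds y. \<bar>f w\<bar> < \<epsilon>" using zero[OF True] \<epsilon> by (intro order_tendstoD(2)) auto
    then have "\<forall>\<^sub>F w in nhds y. \<bar>f w\<bar> \<le> \<epsilon> + 0 * g w" by eventually_elim simp
    then show ?thesis by blast
  next
    case False
    then have "0 < g y" using g(2)[of y] by simp
    then obtain C where C: "\<forall>\<^sub>F w in nhds y. \<bar>f w\<bar> \<le> 0 + C * g w"
      using continuous_bound_near[of "\<lambda>y. \<bar>f y\<bar>" g y] f g(1) by (auto intro: continuous_intros)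
    then have "\<forall>\<^sub>F w in nhds y. \<bar>f w\<bar> \<le> \<epsilon> + C * g w" by eventually_elim (use \<epsilon> in simp)
    then show ?thesis by blast
  qed
  then show ?thesis using compact_local_bound[OF assms(1), of g "\<lambda>y. \<bar>f y\<bar>" "\<lambda>_. \<epsilon>"] g(2) by simp
qed

lemma integrable_continuous_compact:
  fixes f :: "'a::topological_space \<Rightarrow> real"
  assumes "compact (UNIV :: 'a set)" "continuous_on UNIV f" "\<mu> \<in> borel_probs"
  shows "integrable \<mu> f"
proof -
  interpret prob_space \<mu> using assms(3) by (simp add: borel_probs_def)
  have "bounded (range f)" using compact_continuous_image[OF assms(2,1)] by (rule compact_imp_bounded)
  then obtain B where "\<And>y. norm (f y) \<le> B" by (auto simp: bounded_iff)
  moreover have "f \<in> borel_measurable \<mu>"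
    using borel_measurable_continuous_onI[OF assms(2)] assms(3) by (simp add: borel_probs_def cong: measurable_cong_sets)
  ultimately show ?thesis by (intro integrable_const_bound[of _ B]) auto
qed

text \<open>The witness is the image of normalised Lebesgue measure on \<open>{0..t}\<close> under
  the orbit map.\<close>

lemma ex_empirical_measure:
  fixes \<Phi> :: "real \<Rightarrow> 'a::topological_space \<Rightarrow> 'a"
  assumes cont: "continuous_on UNIV (\<lambda>s. \<Phi> s x)" and t: "0 < t"
  shows "\<exists>\<mu>. is_empirical_measure \<Phi> t x \<mu>"
proof -
  define M where "M = density lborel (\<lambda>s. ennreal (indicator {0..t} s / t))"
  define \<mu> where "\<mu> = distr M borel (\<lambda>s. \<Phi> s x)"
  have meas: "(\<lambda>s. \<Phi> s x) \<in> measurable M borel"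
    using borel_measurable_continuous_onI[OF cont] by (simp add: M_def)
  have "emeasure M (space M) = (\<integral>\<^sup>+ s. ennreal (1 / t) * indicator {0..t} s \<partial>lborel)"
    unfolding M_def by (subst emeasure_density) (auto intro!: nn_integral_cong split: split_indicator)
  also have "\<dots> = 1" using t by (simp add: nn_integral_cmult_indicator flip: ennreal_mult)
  finally have "prob_space M" by (rule prob_spaceI)
  then have "\<mu> \<in> borel_probs"
    using meas by (simp add: \<mu>_def borel_probs_def prob_space.prob_space_distr)
  moreover have "(\<integral>y. f y \<partial>\<mu>) = 1 / t * integral {0..t} (\<lambda>s. f (\<Phi> s x))" if f: "continuous_on UNIV f" for f :: "'a \<Rightarrow> real"
  proof -
    have cf: "continuous_on UNIV (\<lambda>s. f (\<Phi> s x))"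
      by (rule continuous_on_compose2[OF f cont]) simp
    then have mf: "(\<lambda>s. f (\<Phi> s x)) \<in> borel_measurable borel" by (rule borel_measurable_continuous_onI)
    have int: "set_integrable lborel {0..t} (\<lambda>s. f (\<Phi> s x))"
      by (intro borel_integrable_atLeastAtMost' continuous_on_subset[OF cf]) simp
    have "(\<integral>y. f y \<partial>\<mu>) = (\<integral>s. f (\<Phi> s x) \<partial>M)"
      unfolding \<mu>_def using meas borel_measurable_continuous_onI[OF f] by (rule integral_distr)
    also have "\<dots> = (\<integral>s. (indicator {0..t} s / t) *\<^sub>R f (\<Phi> s x) \<partial>lborel)"
      unfolding M_def using t mf by (intro integral_density) auto
    also have "\<dots> = (\<integral>s. 1 / t * (indicator {0..t} s *\<^sub>R f (\<Phi> s x)) \<partial>lborel)" by simp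
    also have "\<dots> = 1 / t * (\<integral>s. indicator {0..t} s *\<^sub>R f (\<Phi> s x) \<partial>lborel)" by (rule integral_mult_right_zero)
    also have "(\<integral>s. indicator {0..t} s *\<^sub>R f (\<Phi> s x) \<partial>lborel) = integral {0..t} (\<lambda>s. f (\<Phi> s x))"
      using set_borel_integral_eq_integral(2)[OF int] by (simp add: set_lebesgue_integral_def)
    finally show ?thesis .
  qed
  ultimately show ?thesis unfolding is_empirical_measure_def by blast
qed

section \<open>The weak-* topology and convex combinations of two Dirac measures\<close>

lemma topspace_weak_star: "topspace weak_star_topology = (borel_probs :: 'a::topological_space measure set)"
proof -
  have "(\<Union>{{\<mu> \<in> borel_probs. (\<integral>x. f x \<partial>\<mu>) \<in> U} | (f :: 'a \<Rightarrow> real) U. continuous_on UNIV f \<and> open U}) = borel_probs"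
  proof (intro equalityI subsetI)
    fix \<mu> :: "'a measure" assume \<mu>: "\<mu> \<in> borel_probs"
    have "{\<mu> \<in> borel_probs. (\<integral>x. (\<lambda>_. 0) x \<partial>\<mu>) \<in> UNIV} \<in>
        {{\<mu> \<in> borel_probs. (\<integral>x. f x \<partial>\<mu>) \<in> U} | (f :: 'a \<Rightarrow> real) U. continuous_on UNIV f \<and> open U}"
      by (intro CollectI exI[of _ "\<lambda>_. 0"] exI[of _ UNIV]) auto
    then show "\<mu> \<in> \<Union>{{\<mu> \<in> borel_probs. (\<integral>x. f x \<partial>\<mu>) \<in> U} | (f :: 'a \<Rightarrow> real) U. continuous_on UNIV f \<and> open U}"
      using \<mu> by (intro UnionI) auto
  qed auto
  then show ?thesis unfolding weak_star_topology_def by simp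
qed

text \<open>Convergence of all integrals handles the subbasic sets; induction over the generation of
  the topology extends this to every open set.\<close>

lemma weak_star_eventually_in:
  fixes \<nu> :: "'a::topological_space measure" and \<mu> :: "nat \<Rightarrow> 'a measure"
  assumes W: "openin weak_star_topology W" "\<nu> \<in> W" and \<mu>: "\<And>n. \<mu> n \<in> borel_probs"
    and lim: "\<And>f :: 'a \<Rightarrow> real. continuous_on UNIV f \<Longrightarrow> (\<lambda>n. \<integral>x. f x \<partial>\<mu> n) \<longlonglongrightarrow> (\<integral>x. f x \<partial>\<nu>)"
  shows "\<forall>\<^sub>F n in sequentially. \<mu> n \<in> W"
proof -
  have "generate_topology_on {{\<mu> \<in> borel_probs. (\<integral>x. f x \<partial>\<mu>) \<in> U} | (f :: 'a \<Rightarrow> real) U. continuous_on UNIV f \<and> open U} W"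
    using W(1) unfolding weak_star_topology_def openin_topology_generated_by_iff .
  then show ?thesis using W(2)
  proof induction
    case (Int a b)
    then have "\<forall>\<^sub>F n in sequentially. \<mu> n \<in> a" "\<forall>\<^sub>F n in sequentially. \<mu> n \<in> b" by auto
    then show ?case by eventually_elim auto
  next
    case (UN K)
    then obtain k where "k \<in> K" "\<forall>\<^sub>F n in sequentially. \<mu> n \<in> k" by auto
    then show ?case by (auto elim: eventually_mono)
  next
    case (Basis s)
    then obtain f :: "'a \<Rightarrow> real" and U where s: "s = {\<mu> \<in> borel_probs. (\<integral>x. f x \<partial>\<mu>) \<in> U}" "continuous_on UNIV f" "open U"
      by auto
    then have "\<forall>\<^sub>F n in sequentially. (\<integral>x. f x \<partial>\<mu> n) \<in> U"
      using topological_tendstoD[OF lim[OF s(2)] s(3)] Basis(2) by auto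
    then show ?case by eventually_elim (use \<mu> s(1) in auto)
  qed auto
qed

lemma integral_dirac_segment:
  fixes f :: "'a::topological_space \<Rightarrow> real"
  assumes \<nu>: "\<nu> \<in> borel_probs" and pq: "p \<noteq> q" "{p} \<in> sets borel" "{q} \<in> sets borel"
    and s: "\<And>B. B \<in> sets borel \<Longrightarrow> measure \<nu> B = s * measure (return borel p) B + (1 - s) * measure (return borel q) B"
    and f: "continuous_on UNIV f"
  shows "(\<integral>y. f y \<partial>\<nu>) = s * f p + (1 - s) * f q"
proof -
  interpret prob_space \<nu> using \<nu> by (simp add: borel_probs_def)
  have sets: "sets \<nu> = sets borel" using \<nu> by (simp add: borel_probs_def)
  then have space: "space \<nu> = UNIV" using sets_eq_imp_space_eq by fastforce
  have mp: "measure \<nu> {p} = s" and mq: "measure \<nu> {q} = 1 - s"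
    using s[OF pq(2)] s[OF pq(3)] pq by (simp_all add: measure_return indicator_def)
  have pq': "{p, q} \<in> sets \<nu>" using pq sets by (metis insert_is_Un sets.Un)
  have "measure \<nu> {p, q} = 1"
    using s[of "{p, q}"] pq' sets by (simp add: measure_return)
  then have "AE y in \<nu>. y \<in> {p, q}" by (rule AE_prob_1)
  then have "AE y in \<nu>. f y = f p * indicator {p} y + f q * indicator {q} y"
    by eventually_elim (use pq(1) in auto)
  moreover have "f \<in> borel_measurable \<nu>"
    using borel_measurable_continuous_onI[OF f] sets by (simp cong: measurable_cong_sets)
  ultimately have "(\<integral>y. f y \<partial>\<nu>) = (\<integral>y. f p * indicator {p} y + f q * indicator {q} y \<partial>\<nu>)"
    using pq sets by (intro integral_cong_AE) auto
  also have "\<dots> = f p * s + f q * (1 - s)"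
    using pq sets mp mq by (subst Bochner_Integration.integral_add) (auto simp: space emeasure_eq_measure intro!: integrable_mult_right)
  finally show ?thesis by (simp add: mult.commute)
qed

lemma mem_dirac_segmentI:
  assumes \<mu>: "\<mu> \<in> borel_probs" and pq: "p \<noteq> q" "{p} \<in> sets borel" "{q} \<in> sets borel"
    and AE: "AE y in \<mu>. y \<in> {p, q}"
  shows "\<mu> \<in> dirac_segment p q"
proof -
  interpret prob_space \<mu> using \<mu> by (simp add: borel_probs_def)
  have sets: "sets \<mu> = sets borel" using \<mu> by (simp add: borel_probs_def)
  have m: "measure \<mu> B = measure \<mu> {p} * indicator B p + measure \<mu> {q} * indicator B q" if B: "B \<in> sets borel" for B
  proof -
    have "measure \<mu> B = measure \<mu> ((B \<inter> {p}) \<union> (B \<inter> {q}))"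
      using AE B pq sets by (intro measure_eq_AE) auto
    also have "\<dots> = measure \<mu> (B \<inter> {p}) + measure \<mu> (B \<inter> {q})"
      using B pq sets by (intro finite_measure_Union) auto
    also have "\<dots> = measure \<mu> {p} * indicator B p + measure \<mu> {q} * indicator B q"
      by (auto split: split_indicator simp: Int_insert_right)
    finally show ?thesis .
  qed
  have "measure \<mu> UNIV = 1" using prob_space sets sets_eq_imp_space_eq[OF sets] by simp
  then have q: "measure \<mu> {q} = 1 - measure \<mu> {p}" using m[of UNIV] by simp
  have "\<forall>B\<in>sets borel. measure \<mu> B = measure \<mu> {p} * measure (return borel p) B
      + (1 - measure \<mu> {p}) * measure (return borel q) B"
    using m unfolding q by (simp add: measure_return)
  moreover have "measure \<mu> {p} \<in> {0..1}" by simp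
  ultimately show ?thesis unfolding dirac_segment_def using \<mu> by blast
qed

text \<open>If the time averages of a function vanishing exactly at \<open>p\<close> and \<open>q\<close> tend to zero, all limit
  measures live on \<open>{p, q}\<close>; if the orbit moreover is at times almost entirely near \<open>p\<close> and at times
  almost entirely near \<open>q\<close>, every intermediate proportion occurs, as the proportion varies
  continuously with time.\<close>

lemma p_omega_eq_dirac_segment:
  fixes \<Phi> :: "real \<Rightarrow> 'a::topological_space \<Rightarrow> 'a" and \<phi> P Q :: "'a \<Rightarrow> real"
  assumes cmp: "compact (UNIV :: 'a set)" and cont: "continuous_on UNIV (\<lambda>s. \<Phi> s x)" and pq: "p \<noteq> q"
    and \<phi>: "continuous_on UNIV \<phi>" "\<And>y. 0 \<le> \<phi> y" "\<And>y. \<phi> y = 0 \<longleftrightarrow> y = p \<or> y = q"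
    and P: "continuous_on UNIV P" "\<And>y. 0 \<le> P y" "\<And>y. P y = 0 \<longleftrightarrow> y = p"
    and Q: "continuous_on UNIV Q" "\<And>y. 0 \<le> Q y" "\<And>y. Q y = 0 \<longleftrightarrow> y = q"
    and av\<phi>: "((\<lambda>t. 1 / t * integral {0..t} (\<lambda>s. \<phi> (\<Phi> s x))) \<longlongrightarrow> 0) at_top"
    and avP: "\<And>\<epsilon> T. 0 < \<epsilon> \<Longrightarrow> \<exists>t\<ge>T. integral {0..t} (\<lambda>s. P (\<Phi> s x)) \<le> \<epsilon> * t"
    and avQ: "\<And>\<epsilon> T. 0 < \<epsilon> \<Longrightarrow> \<exists>t\<ge>T. integral {0..t} (\<lambda>s. Q (\<Phi> s x)) \<le> \<epsilon> * t"
  shows "p_omega \<Phi> x = dirac_segment p q"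
proof (intro equalityI subsetI)
  define av where "av t f = 1 / t * integral {0..t} (\<lambda>s. f (\<Phi> s x))" for t and f :: "'a \<Rightarrow> real"
  \<comment> \<open>Being zero sets of continuous functions, the singletons of \<open>p\<close> and
    \<open>q\<close> are closed, hence Borel.\<close>
  have "closed (P -` {0})" "closed (Q -` {0})"
    using P(1) Q(1) by (auto simp: continuous_on_closed_vimage[OF closed_UNIV])
  then have "closed {p}" "closed {q}" using P(3) Q(3) by (auto simp: vimage_def)
  then have bpq: "{p} \<in> sets borel" "{q} \<in> sets borel" by auto
  {
    fix \<mu> assume \<mu>: "\<mu> \<in> p_omega \<Phi> x"
    have cl: "\<mu> \<in> weak_star_topology closure_of {\<mu>. \<exists>t\<ge>T. is_empirical_measure \<Phi> t x \<mu>}" if "0 < T" for T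
      using \<mu> that unfolding p_omega_def by blast
    then have \<mu>p: "\<mu> \<in> borel_probs" using closure_of_subset_topspace topspace_weak_star by (metis subsetD zero_less_one)
    have "(\<integral>y. \<phi> y \<partial>\<mu>) \<le> 0 + e" if e: "0 < e" for e
    proof -
      have "\<forall>\<^sub>F t in at_top. av t \<phi> < e / 2"
        unfolding av_def using av\<phi> e by (intro order_tendstoD(2)[OF av\<phi>]) auto
      then obtain T where T: "\<And>t. T \<le> t \<Longrightarrow> av t \<phi> < e / 2" unfolding eventually_at_top_linorder by auto
      \<comment> \<open>A neighbourhood of \<open>\<mu>\<close> on which the integral of \<phi>
        drops by less than \<open>e / 2\<close>; it contains an empirical measure so late that its
        integral is below \<open>e / 2\<close>.\<close>
      define W where "W = {\<nu> \<in> borel_probs. (\<integral>y. \<phi> y \<partial>\<nu>) \<in> {(\<integral>y. \<phi> y \<partial>\<mu>) - e / 2<..}}"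
      have "openin weak_star_topology W" unfolding weak_star_topology_def W_def
        by (intro topology_generated_by_Basis CollectI exI[of _ \<phi>]
            exI[of _ "{(\<integral>y. \<phi> y \<partial>\<mu>) - e / 2<..}"] conjI refl \<phi>(1) open_greaterThan)
      moreover have "\<mu> \<in> W" using \<mu>p e by (simp add: W_def)
      ultimately obtain \<nu> where "\<nu> \<in> {\<mu>. \<exists>t\<ge>max 1 T. is_empirical_measure \<Phi> t x \<mu>}" "\<nu> \<in> W"
        using cl[OF less_le_trans[OF zero_less_one max.cobounded1[of 1 T]]] unfolding in_closure_of by blast
      then obtain t where t: "T \<le> t" "is_empirical_measure \<Phi> t x \<nu>" "(\<integral>y. \<phi> y \<partial>\<mu>) - e / 2 < (\<integral>y. \<phi> y \<partial>\<nu>)"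
        by (auto simp: W_def)
      have "(\<integral>y. \<phi> y \<partial>\<nu>) = av t \<phi>" using t(2) \<phi>(1) unfolding is_empirical_measure_def av_def by blast
      then show ?thesis using T[OF t(1)] t(3) by linarith
    qed
    then have "(\<integral>y. \<phi> y \<partial>\<mu>) \<le> 0" by (rule field_le_epsilon)
    moreover have "0 \<le> (\<integral>y. \<phi> y \<partial>\<mu>)" using \<phi>(2) by simp
    ultimately have "(\<integral>y. \<phi> y \<partial>\<mu>) = 0" by linarith
    then have "AE y in \<mu>. \<phi> y = 0"
      using integral_nonneg_eq_0_iff_AE[OF integrable_continuous_compact[OF cmp \<phi>(1) \<mu>p]] \<phi>(2) by simp
    then have "AE y in \<mu>. y \<in> {p, q}" by eventually_elim (simp add: \<phi>(3))
    then show "\<mu> \<in> dirac_segment p q" by (rule mem_dirac_segmentI[OF \<mu>p pq bpq])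
  }
  have contf: "continuous_on A (\<lambda>s. f (\<Phi> s x))" if "continuous_on UNIV f" for f :: "'a \<Rightarrow> real" and A
    by (rule continuous_on_compose2[OF that continuous_on_subset[OF cont]]) auto
  have int: "(\<lambda>s. f (\<Phi> s x)) integrable_on {0..t}" if "continuous_on UNIV f" for f :: "'a \<Rightarrow> real" and t
    by (intro integrable_continuous_interval contf that)
  have av_bound: "\<bar>av t f\<bar> \<le> \<epsilon> + C * av t g"
    if "0 < t" "continuous_on UNIV f" "continuous_on UNIV g" "\<And>y. \<bar>f y\<bar> \<le> \<epsilon> + C * g y" for t f g \<epsilon> C
  proof -
    have "norm (integral {0..t} (\<lambda>s. f (\<Phi> s x))) \<le> integral {0..t} (\<lambda>s. \<epsilon> + C * g (\<Phi> s x))"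
    proof (rule integral_norm_bound_integral)
      show "(\<lambda>s. \<epsilon> + C * g (\<Phi> s x)) integrable_on {0..t}"
        using that(3) by (intro integrable_add integrable_on_mult_right int integrable_const_ivl)
    qed (use that int in auto)
    also have "\<dots> = \<epsilon> * t + C * integral {0..t} (\<lambda>s. g (\<Phi> s x))"
      using that int[of g t] by (subst Henstock_Kurzweil_Integration.integral_add) (auto intro: integrable_on_mult_right)
    finally show ?thesis using that(1) by (simp add: av_def abs_mult field_simps)
  qed
  \<comment> \<open>A test function with values 1 at \<open>p\<close> and 0 at \<open>q\<close>:
    against a combination of the two Dirac measures it integrates to the weight of \<open>p\<close>,
    so it suffices to steer \<open>av t h\<close> towards \<open>s\<close>.\<close>
  define h where "h y = 1 - P y / P q" for y
  have Pq: "0 < P q" using P(2)[of q] P(3)[of q] pq by (metis less_eq_real_def)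
  have conth: "continuous_on UNIV h" unfolding h_def using Pq by (intro continuous_intros P(1)) auto
  have h: "h p = 1" "h q = 0" using P(3)[of p] Pq by (auto simp: h_def)
  have avh: "av t h = 1 - av t P / P q" if "0 < t" for t
  proof -
    have "integral {0..t} (\<lambda>s. h (\<Phi> s x)) = t - integral {0..t} (\<lambda>s. P (\<Phi> s x)) / P q"
      unfolding h_def using that int[OF P(1), of t]
      by (subst Henstock_Kurzweil_Integration.integral_diff) (auto intro: integrable_on_divide)
    then show ?thesis using that by (simp add: av_def field_simps)
  qed
  {
    fix \<nu> assume "\<nu> \<in> dirac_segment p q"
    then obtain s where \<nu>: "\<nu> \<in> borel_probs" and s: "0 \<le> s" "s \<le> 1"
      "\<And>B. B \<in> sets borel \<Longrightarrow> measure \<nu> B = s * measure (return borel p) B + (1 - s) * measure (return borel q) B"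
      unfolding dirac_segment_def by auto
    have "\<exists>t\<ge>real n + 1. \<bar>av t h - s\<bar> \<le> 1 / (real n + 1)" for n
    proof -
      define e where "e = 1 / (real n + 1)"
      have e: "0 < e" by (simp add: e_def)
      have "0 < e * P q" using e Pq by simp
      then obtain t1 where t1: "t1 \<ge> real n + 1" "integral {0..t1} (\<lambda>s. P (\<Phi> s x)) \<le> e * P q * t1"
        using avP by blast
      have t1p: "0 < t1" using t1(1) by linarith
      have "av t1 P \<le> e * P q" using t1(2) t1p by (simp add: av_def pos_divide_le_eq)
      then have "av t1 P / P q \<le> e" using Pq by (simp add: pos_divide_le_eq)
      then have 1: "1 - e \<le> av t1 h" using avh[OF t1p] by linarith
      obtain C where C: "0 < C" "\<And>y. \<bar>h y\<bar> \<le> e / 2 + C * Q y"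
        using bound_by_nonneg_function[OF cmp conth Q(1,2), of "e / 2"] h(2) Q(3) e by auto
      have "0 < e / (2 * C)" using e C by simp
      then obtain t2 where t2: "t2 \<ge> real n + 1" "integral {0..t2} (\<lambda>s. Q (\<Phi> s x)) \<le> e / (2 * C) * t2"
        using avQ by blast
      have t2p: "0 < t2" using t2(1) by linarith
      have "av t2 Q \<le> e / (2 * C)" using t2(2) t2p by (simp add: av_def pos_divide_le_eq)
      then have "C * av t2 Q \<le> C * (e / (2 * C))" using C(1) by (intro mult_left_mono) auto
      then have 2: "av t2 h \<le> e" using av_bound[OF t2p conth Q(1) C(2)] C(1) by simp
      \<comment> \<open>In the first case \<open>s\<close> lies between 0 and
        \<open>av t2 h \<le> e\<close>, in the second between \<open>av t1 h \<ge> 1 - e\<close> and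
        1, so one of the two times already serves. In the third the intermediate value theorem gives
        equality.\<close>
      consider "s \<le> av t2 h" | "av t1 h \<le> s" | "av t2 h \<le> s" "s \<le> av t1 h" by linarith
      then show ?thesis
      proof cases
        case 1
        then show ?thesis using 2 s t2(1) by (intro exI[of _ t2]) (auto simp: e_def)
      next
        case 2
        then show ?thesis using 1 s t1(1) by (intro exI[of _ t1]) (auto simp: e_def)
      next
        case 3
        have cont_av: "continuous_on {real n + 1..max t1 t2} (\<lambda>t. av t h)"
        proof -
          have "continuous_on {0..max t1 t2} (\<lambda>t. integral {0..t} (\<lambda>s. h (\<Phi> s x)))"
            by (intro indefinite_integral_continuous_1 int conth)
          then have "continuous_on {real n + 1..max t1 t2} (\<lambda>t. integral {0..t} (\<lambda>s. h (\<Phi> s x)))"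
            by (rule continuous_on_subset) auto
          then show ?thesis unfolding av_def by (intro continuous_intros) auto
        qed
        have conn: "connected ((\<lambda>t. av t h) ` {real n + 1..max t1 t2})"
          using cont_av by (rule connected_continuous_image) simp
        have "av t1 h \<in> (\<lambda>t. av t h) ` {real n + 1..max t1 t2}" "av t2 h \<in> (\<lambda>t. av t h) ` {real n + 1..max t1 t2}"
          using t1(1) t2(1) by auto
        then have "s \<in> (\<lambda>t. av t h) ` {real n + 1..max t1 t2}"
          using connectedD_interval[OF conn _ _ 3] by blast
        then show ?thesis by auto
      qed
    qed
    then obtain t where t: "\<And>n. t n \<ge> real n + 1" "\<And>n. \<bar>av (t n) h - s\<bar> \<le> 1 / (real n + 1)" by metis
    have tp: "0 < t n" for n using t(1)[of n] by linarith
    have "filterlim t at_top sequentially"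
      by (rule filterlim_at_top_mono[of "\<lambda>n. real n + 1"]) (use t(1) in \<open>auto intro: filterlim_tendsto_add_at_top filterlim_real_sequentially simp: add.commute\<close>)
    note t_lim = this
    have lim_h: "(\<lambda>n. av (t n) h) \<longlonglongrightarrow> s"
    proof (rule LIM_zero_cancel, rule Lim_null_comparison)
      show "\<forall>\<^sub>F n in sequentially. norm (av (t n) h - s) \<le> 1 / (real n + 1)" using t(2) by simp
      show "(\<lambda>n. 1 / (real n + 1)) \<longlonglongrightarrow> 0" by real_asymp
    qed
    have "\<exists>\<mu>. is_empirical_measure \<Phi> (t n) x \<mu>" for n
      using cont tp by (rule ex_empirical_measure)
    then obtain \<mu> where \<mu>: "\<And>n. is_empirical_measure \<Phi> (t n) x (\<mu> n)" by metis
    have \<mu>p: "\<mu> n \<in> borel_probs" for n using \<mu> unfolding is_empirical_measure_def by blast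
    have lim: "(\<lambda>n. \<integral>y. f y \<partial>\<mu> n) \<longlonglongrightarrow> (\<integral>y. f y \<partial>\<nu>)" if f: "continuous_on UNIV f" for f :: "'a \<Rightarrow> real"
    proof -
      \<comment> \<open>Subtracting the affine function of \<open>h\<close> that agrees with
        \<open>f\<close> at \<open>p\<close> and \<open>q\<close> leaves a function vanishing at
        both, whose averages tend to 0 with those of \<phi>. The limit for \<open>f\<close> is then
        determined by the limit for \<open>h\<close>.\<close>
      define r where "r y = f y - (f q + (f p - f q) * h y)" for y
      have contr: "continuous_on UNIV r" unfolding r_def by (intro continuous_intros f conth)
      have r0: "r y = 0" if "\<phi> y = 0" for y using that h by (auto simp: \<phi>(3) r_def)
      have avr: "av u f = av u r + f q + (f p - f q) * av u h" if "0 < u" for u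
      proof -
        have "integral {0..u} (\<lambda>s. r (\<Phi> s x)) = integral {0..u} (\<lambda>s. f (\<Phi> s x)) - (f q * u + (f p - f q) * integral {0..u} (\<lambda>s. h (\<Phi> s x)))"
          unfolding r_def using that int[OF f, of u] int[OF conth, of u]
          by (subst Henstock_Kurzweil_Integration.integral_diff, simp, intro integrable_add integrable_const_ivl integrable_on_mult_right, simp,
              subst Henstock_Kurzweil_Integration.integral_add) (auto intro: integrable_on_mult_right)
        then have eq: "integral {0..u} (\<lambda>s. f (\<Phi> s x)) =
            integral {0..u} (\<lambda>s. r (\<Phi> s x)) + f q * u + (f p - f q) * integral {0..u} (\<lambda>s. h (\<Phi> s x))"
          by linarith
        show ?thesis unfolding av_def eq using that by (simp add: add_divide_distrib)
      qed
      have lim_r: "((\<lambda>u. av u r) \<longlongrightarrow> 0) at_top"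
      proof (rule tendstoI)
        fix e :: real assume e: "0 < e"
        obtain C where C: "0 < C" "\<And>y. \<bar>r y\<bar> \<le> e / 2 + C * \<phi> y"
          using bound_by_nonneg_function[OF cmp contr \<phi>(1,2) r0, of "e / 2"] e by auto
        have "\<forall>\<^sub>F u in at_top. av u \<phi> < e / (2 * C)"
          unfolding av_def using e C by (intro order_tendstoD(2)[OF av\<phi>]) auto
        then show "\<forall>\<^sub>F u in at_top. dist (av u r) 0 < e" using eventually_gt_at_top[of 0]
        proof eventually_elim
          case (elim u)
          have "\<bar>av u r\<bar> \<le> e / 2 + C * av u \<phi>" by (rule av_bound[OF elim(2) contr \<phi>(1) C(2)])
          also have "C * av u \<phi> < C * (e / (2 * C))" using elim(1) C(1) by (intro mult_strict_left_mono)
          also have "C * (e / (2 * C)) = e / 2" using C(1) by simp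
          finally show ?case by simp
        qed
      qed
      have "(\<lambda>n. av (t n) r + f q + (f p - f q) * av (t n) h) \<longlonglongrightarrow> 0 + f q + (f p - f q) * s"
        by (intro tendsto_intros lim_h filterlim_compose[OF lim_r t_lim])
      moreover have "(\<integral>y. f y \<partial>\<mu> n) = av (t n) r + f q + (f p - f q) * av (t n) h" for n
        using \<mu>[of n] f avr[OF tp[of n]] unfolding is_empirical_measure_def av_def by metis
      moreover have "(\<integral>y. f y \<partial>\<nu>) = 0 + f q + (f p - f q) * s"
        using integral_dirac_segment[OF \<nu> pq bpq s(3) f] by (simp add: algebra_simps)
      ultimately show ?thesis by simp
    qed
    have "\<nu> \<in> weak_star_topology closure_of {\<mu>. \<exists>t\<ge>T. is_empirical_measure \<Phi> t x \<mu>}" for T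
    proof -
      have "\<exists>y. y \<in> {\<mu>. \<exists>t\<ge>T. is_empirical_measure \<Phi> t x \<mu>} \<and> y \<in> W"
        if W: "\<nu> \<in> W" "openin weak_star_topology W" for W
      proof -
        have "\<forall>\<^sub>F n in sequentially. \<mu> n \<in> W" by (rule weak_star_eventually_in[OF W(2,1) \<mu>p lim])
        moreover have "\<forall>\<^sub>F n in sequentially. T \<le> t n" using t_lim by (simp add: filterlim_at_top)
        ultimately have "\<forall>\<^sub>F n in sequentially. \<mu> n \<in> W \<and> T \<le> t n" by (rule eventually_conj)
        then obtain n where "\<mu> n \<in> W" "T \<le> t n" by (auto simp: eventually_sequentially)
        then show ?thesis using \<mu> by blast
      qed
      then show ?thesis using \<nu> unfolding in_closure_of topspace_weak_star by blast
    qed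
    then show "\<nu> \<in> p_omega \<Phi> x" unfolding p_omega_def by blast
  }
qed

section \<open>Generic angles\<close>

definition well_approximable :: "real set" where
  "well_approximable = (\<Inter>n. \<Union>q\<in>{n..}. {\<alpha>. \<exists>p. well_approximated q p \<alpha>})"

lemma open_well_approximated: "open {\<alpha>. \<exists>p. well_approximated q p \<alpha>}"
proof -
  have "{\<alpha>. \<exists>p. well_approximated q p \<alpha>} = (\<Union>p\<in>{p. prime q \<and> coprime p (int q)}.
      {\<alpha>. 0 < real q * \<alpha> - of_int p} \<inter> {\<alpha>. real q * \<alpha> - of_int p < exp (- (real q ^ 3))})"
    by (auto simp: well_approximated_def)
  also have "open \<dots>" by (intro open_UN ballI open_Int open_Collect_less continuous_intros)
  finally show ?thesis .
qed

lemma gdelta_well_approximable: "gdelta well_approximable"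
  unfolding well_approximable_def by (intro gdelta.intros open_UN ballI open_well_approximated)

text \<open>For a large prime \<open>q\<close>, one of the two consecutive integers next to
  \<open>q * x\<close> is not divisible by \<open>q\<close>; it serves as \<open>p\<close>, and
  \<alpha> is placed just above \<open>p / q\<close>, at half the permitted distance.\<close>

lemma ex_well_approximated_near:
  fixes x e :: real assumes e: "0 < e"
  shows "\<exists>q\<ge>n. \<exists>p \<alpha>. well_approximated q p \<alpha> \<and> \<bar>\<alpha> - x\<bar> < e"
proof -
  obtain m :: nat where m: "real m > 3 / e" using reals_Archimedean2 by blast
  obtain q where q: "prime q" "q > max n m" using bigger_prime by blast
  then have q1: "0 < q" "3 / e < real q" using m by (auto simp: prime_gt_0_nat)
  define k where "k = \<lfloor>real q * x\<rfloor>"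
  obtain p where p: "p \<in> {k, k + 1}" "\<not> int q dvd p"
  proof (cases "int q dvd k")
    case True
    have "\<not> int q dvd k + 1"
    proof
      assume "int q dvd k + 1"
      then have "int q dvd (k + 1) - k" using True by (rule dvd_diff)
      then show False using q(1) by simp
    qed
    then show ?thesis using that by blast
  qed (use that in blast)
  have cop: "coprime p (int q)"
    using p(2) q(1) by (metis coprime_commute prime_imp_coprime prime_nat_int_transfer)
  define d where "d = exp (- (real q ^ 3)) / 2"
  have "exp (- (real q ^ 3)) \<le> 1" by simp
  then have d: "0 < d" "d < 1" unfolding d_def by (simp, linarith)
  define \<alpha> where "\<alpha> = (of_int p + d) / real q"
  have eq: "real q * \<alpha> - of_int p = d" using q1 by (simp add: \<alpha>_def)
  have "well_approximated q p \<alpha>" unfolding well_approximated_def eq using q(1) cop by (simp add: d_def)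
  moreover have "\<bar>\<alpha> - x\<bar> < e"
  proof -
    have "of_int k \<le> real q * x" "real q * x < of_int k + 1" by (simp_all add: k_def)
    moreover have "real_of_int p = of_int k \<or> real_of_int p = of_int k + 1" using p(1) by auto
    ultimately have "\<bar>of_int p + d - real q * x\<bar> < 3" using d by auto
    moreover have "of_int p + d - real q * x = real q * (\<alpha> - x)" using eq by (simp add: algebra_simps)
    ultimately have "real q * \<bar>\<alpha> - x\<bar> < 3" by (simp add: abs_mult)
    also have "3 < real q * e" using q1(2) e by (simp add: field_simps)
    finally show ?thesis using q1 by simp
  qed
  ultimately show ?thesis using q(2) by (intro exI[of _ q] conjI exI[of _ p] exI[of _ \<alpha>]) auto
qed

lemma closure_well_approximable: "closure well_approximable = UNIV"
proof -
  have dense: "closure (\<Union>q\<in>{n..}. {\<alpha>. \<exists>p. well_approximated q p \<alpha>}) = UNIV" for n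
  proof (intro equalityI subset_UNIV subsetI)
    fix x :: real
    show "x \<in> closure (\<Union>q\<in>{n..}. {\<alpha>. \<exists>p. well_approximated q p \<alpha>})"
      unfolding closure_approachable
    proof (intro allI impI)
      fix e :: real assume "0 < e"
      then obtain q p \<alpha> where "q \<ge> n" "well_approximated q p \<alpha>" "\<bar>\<alpha> - x\<bar> < e"
        using ex_well_approximated_near by blast
      then show "\<exists>y\<in>\<Union>q\<in>{n..}. {\<alpha>. \<exists>p. well_approximated q p \<alpha>}. dist y x < e"
        by (intro bexI[of _ \<alpha>]) (auto simp: dist_real_def)
    qed
  qed
  have "UNIV \<subseteq> closure (\<Inter>(range (\<lambda>n. \<Union>q\<in>{n..}. {\<alpha>. \<exists>p. well_approximated q p \<alpha>})))"
  proof (rule Baire)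
    fix T :: "real set" assume "T \<in> range (\<lambda>n. \<Union>q\<in>{n..}. {\<alpha>. \<exists>p. well_approximated q p \<alpha>})"
    then show "openin (top_of_set UNIV) T \<and> UNIV \<subseteq> closure T"
      using dense open_well_approximated by (auto simp: open_UN)
  qed auto
  then show ?thesis unfolding well_approximable_def by blast
qed

text \<open>This is applied with \<open>c = 0\<close> and \<open>c = \<beta>\<close>; quantifying
  over all representatives \<open>z\<close> in the strip lets both instances speak of the same
  \<open>z\<close>. Two such representatives differ by a vertical integer vector, which
  \<open>approach\<close> does not see.\<close>

lemma AE_torus_frequently_approach:
  assumes b: "1 \<le> b" and Q: "\<And>n. \<exists>q\<ge>n. q \<in> Q"
  shows "AE x in torus_lebesgue. (\<exists>z. x = abs_torus z \<and> 0 < fst z \<and> fst z < 1) \<and>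
     (\<forall>z. x = abs_torus z \<longrightarrow> 0 < fst z \<longrightarrow> fst z < 1 \<longrightarrow>
       (\<forall>n. \<exists>q\<ge>n. q \<in> Q \<and> snd z - \<alpha> * fst z - c \<in> approach b q))"
proof -
  define S where "S = (\<Inter>n. \<Union>q\<in>Q \<inter> {n..}. {\<eta>. \<eta> - c \<in> approach b q})"
  have S_shift: "\<eta> + of_int m \<in> S \<longleftrightarrow> \<eta> \<in> S" for \<eta> m
    using approach_add_int[of "\<eta> - c" m b] by (simp add: S_def algebra_simps)
  have op: "open {z :: real \<times> real. 0 < fst z \<and> fst z < 1 \<and> snd z - \<alpha> * fst z - c \<in> approach b q}" for q
  proof -
    have "{z :: real \<times> real. 0 < fst z \<and> fst z < 1 \<and> snd z - \<alpha> * fst z - c \<in> approach b q} =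
      {z. 0 < fst z} \<inter> {z. fst z < 1} \<inter> (\<lambda>z. snd z - \<alpha> * fst z - c) -` approach b q" by auto
    also have "open \<dots>"
      by (intro open_Int open_Collect_less open_vimage open_approach continuous_intros)
    finally show ?thesis .
  qed
  \<comment> \<open>Built from images of open sets under the open projection, so that it is
    Borel.\<close>
  define G where "G = (\<Inter>n. \<Union>q\<in>Q \<inter> {n..}. abs_torus ` {z. 0 < fst z \<and> fst z < 1 \<and> snd z - \<alpha> * fst z - c \<in> approach b q})"
  have "G \<in> sets borel" unfolding G_def
    by (intro sets.countable_INT'' borel_open open_UN ballI open_abs_torus_image op open_UNIV countableI_type)
  have GD: "(\<exists>z. x = abs_torus z \<and> 0 < fst z \<and> fst z < 1) \<and>
     (\<forall>z. x = abs_torus z \<longrightarrow> 0 < fst z \<longrightarrow> fst z < 1 \<longrightarrow>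
       (\<forall>n. \<exists>q\<ge>n. q \<in> Q \<and> snd z - \<alpha> * fst z - c \<in> approach b q))" if "x \<in> G" for x
  proof -
    have "\<exists>q\<ge>n. q \<in> Q \<and> snd z0 - \<alpha> * fst z0 - c \<in> approach b q"
      if z0: "x = abs_torus z0" "0 < fst z0" "fst z0 < 1" for n z0
    proof -
      obtain q z where q: "q \<ge> n" "q \<in> Q" and z: "x = abs_torus z" "0 < fst z" "fst z < 1"
        "snd z - \<alpha> * fst z - c \<in> approach b q"
        using \<open>x \<in> G\<close> unfolding G_def by blast
      have i: "fst z - fst z0 \<in> \<int>" "snd z0 - snd z \<in> \<int>"
        using z(1) z0(1) abs_torus_eq_iff by metis+
      obtain k where k: "fst z - fst z0 = of_int k" using i(1) by (auto elim: Ints_cases)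
      then have "real_of_int k < 1" "- 1 < real_of_int k" using z(2,3) z0(2,3) by linarith+
      then have "k = 0" by linarith
      then have "fst z = fst z0" using k by simp
      moreover obtain m where "snd z0 - snd z = of_int m" using i(2) by (auto elim: Ints_cases)
      ultimately have "snd z0 - \<alpha> * fst z0 - c = snd z - \<alpha> * fst z - c + of_int m" by simp
      then show ?thesis using q z(4) approach_add_int by metis
    qed
    moreover have "\<exists>z. x = abs_torus z \<and> 0 < fst z \<and> fst z < 1"
    proof -
      obtain q where "x \<in> abs_torus ` {z. 0 < fst z \<and> fst z < 1 \<and> snd z - \<alpha> * fst z - c \<in> approach b q}"
        using \<open>x \<in> G\<close> unfolding G_def by blast
      then show ?thesis by blast
    qed
    ultimately show ?thesis by blast
  qed
  have Sae: "AE y in lborel. y + d \<in> S" for d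
  proof -
    have "AE \<eta> in lborel. \<forall>n. \<exists>q\<ge>n. q \<in> Q \<and> \<eta> + (d - c) \<in> approach b q"
      by (rule AE_lborel_shift[OF AE_frequently_approach[OF b Q]])
    then show ?thesis by eventually_elim (auto simp: S_def algebra_simps)
  qed
  have Sb: "S \<in> sets borel"
  proof -
    have "open {\<eta>. \<eta> - c \<in> approach b q}" for q
    proof -
      have "continuous_on UNIV (\<lambda>\<eta> :: real. \<eta> - c)" by (intro continuous_intros)
      then show ?thesis using open_vimage[OF open_approach[of b q]] by (simp add: vimage_def)
    qed
    then show ?thesis unfolding S_def by (intro sets.countable_INT'' borel_open open_UN ballI open_UNIV countableI_type) auto
  qed
  \<comment> \<open>Fubini: for fixed \<open>x\<close> the condition on \<open>y\<close> says that a
    translate of \<open>y\<close> lies in the conull set \<open>S\<close>.\<close>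
  have "AE z in lborel \<Otimes>\<^sub>M lborel. (\<lambda>z :: real \<times> real. fst z \<noteq> 0 \<and> snd z - \<alpha> * fst z \<in> S) z"
  proof (rule lborel_pair.AE_pair_measure)
    have "{z :: real \<times> real. fst z \<noteq> 0} \<in> sets borel" by (intro borel_open open_Collect_neq continuous_intros)
    moreover have "(\<lambda>z :: real \<times> real. snd z - \<alpha> * fst z) -` S \<inter> space borel \<in> sets borel"
      by (rule measurable_sets[OF borel_measurable_continuous_onI Sb]) (intro continuous_intros)
    ultimately have "{z :: real \<times> real. fst z \<noteq> 0} \<inter> ((\<lambda>z :: real \<times> real. snd z - \<alpha> * fst z) -` S \<inter> space borel) \<in> sets borel"
      by (rule sets.Int)
    also have "{z :: real \<times> real. fst z \<noteq> 0} \<inter> ((\<lambda>z :: real \<times> real. snd z - \<alpha> * fst z) -` S \<inter> space borel) =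
        {z \<in> space (lborel \<Otimes>\<^sub>M lborel). fst z \<noteq> 0 \<and> snd z - \<alpha> * fst z \<in> S}" by (auto simp: space_pair_measure)
    finally show "{z \<in> space (lborel \<Otimes>\<^sub>M lborel). fst z \<noteq> 0 \<and> snd z - \<alpha> * fst z \<in> S} \<in> sets (lborel \<Otimes>\<^sub>M lborel)"
      unfolding lborel_prod sets_lborel .
    have "AE y in lborel. x \<noteq> 0 \<longrightarrow> y - \<alpha> * x \<in> S" for x
      using Sae[of "- \<alpha> * x"] by eventually_elim simp
    moreover have "AE x in lborel. x \<noteq> (0 :: real)" by (rule AE_lborel_singleton)
    ultimately show "AE x in lborel. AE y in lborel. fst (x, y) \<noteq> 0 \<and> snd (x, y) - \<alpha> * fst (x, y) \<in> S"
      by (auto elim!: eventually_mono)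
  qed
  then have ae2: "AE z in lborel. fst z \<noteq> 0 \<and> snd z - \<alpha> * fst z \<in> S" by (simp only: lborel_prod)
  have "AE x in torus_lebesgue. x \<in> G"
    unfolding torus_lebesgue_def
  proof (subst AE_distr_iff)
    show "abs_torus \<in> measurable (restrict_space lborel ({0..<1} \<times> {0..<1})) borel"
      by (rule measurable_restrict_space1) (simp add: borel_measurable_continuous_onI[OF continuous_on_abs_torus])
    show "{x \<in> space borel. x \<in> G} \<in> sets borel" using \<open>G \<in> sets borel\<close> by simp
    have "{0..<1 :: real} \<times> {0..<1 :: real} \<inter> space lborel \<in> sets lborel" by (simp add: borel_Times)
    then have "AE z in restrict_space lborel ({0..<1} \<times> {0..<1}). (fst z \<noteq> 0 \<and> snd z - \<alpha> * fst z \<in> S) \<and> z \<in> {0..<1} \<times> {0..<1}"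
    proof (subst AE_restrict_space_iff)
      show "AE z in lborel. z \<in> {0..<1} \<times> {0..<1} \<longrightarrow> (fst z \<noteq> 0 \<and> snd z - \<alpha> * fst z \<in> S) \<and> z \<in> {0..<1} \<times> {0..<1}"
        using ae2 by eventually_elim blast
    qed
    then show "AE z in restrict_space lborel ({0..<1} \<times> {0..<1}). abs_torus z \<in> G"
    proof eventually_elim
      case (elim z)
      then have z: "0 < fst z" "fst z < 1" "snd z - \<alpha> * fst z \<in> S" by (auto simp: less_le)
      have "\<exists>q\<in>Q \<inter> {n..}. snd z - \<alpha> * fst z - c \<in> approach b q" for n using z(3) unfolding S_def by blast
      then show ?case unfolding G_def using z(1,2) by blast
    qed
  qed
  then show ?thesis by eventually_elim (rule GD)
qed

theorem theorem2:
  shows "\<exists>A :: real set. gdelta A \<and> closure A = UNIV \<and>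
    (\<forall>\<alpha>\<in>A. \<forall>\<beta>\<in>\<rat> - {0}. \<forall>\<Phi>.
      reparametrized_linear_flow \<alpha> (abs_torus (0, 0)) (abs_torus (0, \<beta>)) \<Phi> \<longrightarrow>
      extreme_historic_behaviour (abs_torus (0, 0)) (abs_torus (0, \<beta>)) \<Phi>)"
proof (intro exI[of _ well_approximable] conjI ballI allI impI)
  show "gdelta well_approximable" by (rule gdelta_well_approximable)
  show "closure well_approximable = UNIV" by (rule closure_well_approximable)
next
  fix \<alpha> \<beta> :: real and \<Phi>
  assume \<alpha>: "\<alpha> \<in> well_approximable" and \<beta>: "\<beta> \<in> \<rat> - {0}"
    and flow: "reparametrized_linear_flow \<alpha> (abs_torus (0, 0)) (abs_torus (0, \<beta>)) \<Phi>"
  define p q where "p = abs_torus (0, 0)" and "q = abs_torus (0, \<beta>)"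
  obtain \<phi> :: "torus \<Rightarrow> real" where pq: "p \<noteq> q" and \<phi>: "C_k 3 (\<lambda>z. \<phi> (abs_torus z))" "\<phi> p = 0" "\<phi> q = 0"
    "\<And>x. x \<noteq> p \<Longrightarrow> x \<noteq> q \<Longrightarrow> 0 < \<phi> x"
    "\<And>z. abs_torus z \<in> {p, q} \<Longrightarrow> positive_definite (hessian (\<lambda>z. \<phi> (abs_torus z)) z)"
    and gen: "flow_generated_by (\<lambda>x. \<phi> x *\<^sub>R (1, \<alpha>)) \<Phi>"
    using flow unfolding reparametrized_linear_flow_def p_def[symmetric] q_def[symmetric] by blast
  have \<beta>Z: "\<beta> \<notin> \<int>" using pq by (simp add: p_def q_def abs_torus_eq_iff)
  obtain a b where ab: "\<beta> = of_int a / of_int b" "b > 0" using \<beta> by (auto elim: Rats_cases')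
  define B where "B = nat b"
  have B: "1 \<le> B" "real B * \<beta> \<in> \<int>" using ab by (simp_all add: B_def)
  define Q where "Q = {q. (\<exists>p. well_approximated q p \<alpha>) \<and> real q * \<beta> \<notin> \<int>}"
  have Q: "\<exists>q\<ge>n. q \<in> Q" for n
  proof -
    obtain q p where q: "q \<ge> max n (B + 1)" "well_approximated q p \<alpha>"
      using \<alpha> unfolding well_approximable_def by blast
    have "prime q" using q(2) by (simp add: well_approximated_def)
    moreover have "\<not> q dvd B" using q(1) B(1) by (auto dest: dvd_imp_le)
    ultimately have "coprime (int q) (int B)" using prime_imp_coprime by auto
    then obtain u v where uv: "u * int q + v * int B = 1" using bezout_int[of "int q" "int B"] by auto
    \<comment> \<open>By Bezout \<beta> is an integer combination of \<open>q * \<beta>\<close> and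
      \<open>B * \<beta>\<close>; were both integers, \<beta> would be one, and the stopping points
      would coincide.\<close>
    have "real q * \<beta> \<notin> \<int>"
    proof
      assume *: "real q * \<beta> \<in> \<int>"
      have "of_int u * (real q * \<beta>) + of_int v * (real B * \<beta>) \<in> \<int>" 
        by (intro Ints_add Ints_mult[OF Ints_of_int] * B(2))
      also have "of_int u * (real q * \<beta>) + of_int v * (real B * \<beta>) = of_int (u * int q + v * int B) * \<beta>"
        by (simp add: algebra_simps)
      finally show False using uv \<beta>Z by simp
    qed
    then show ?thesis using q by (auto simp: Q_def)
  qed
  have contF: "continuous_on UNIV \<phi>"
    using \<phi>(1) by (intro continuous_on_torusI C_k_imp_continuous_on)
  have F: "0 \<le> \<phi> y" "\<phi> y = 0 \<longleftrightarrow> y = p \<or> y = q" for y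
    using \<phi>(2,3) \<phi>(4)[of y] by (cases "y = p"; cases "y = q"; simp)+
  have contPhi: "continuous_on UNIV (\<lambda>s. \<Phi> s x)" for x
  proof -
    have "continuous_on UNIV (\<lambda>(t, x). \<Phi> t x)" using gen by (simp add: flow_generated_by_def is_flow_def)
    from continuous_on_compose2[OF this, of UNIV "\<lambda>s. (s, x)"] show ?thesis
      by (simp add: continuous_on_Pair)
  qed
  show "extreme_historic_behaviour (abs_torus (0, 0)) (abs_torus (0, \<beta>)) \<Phi>"
    unfolding extreme_historic_behaviour_def
    using AE_torus_frequently_approach[OF B(1) Q, of \<alpha> 0] AE_torus_frequently_approach[OF B(1) Q, of \<alpha> \<beta>]
  proof eventually_elim
    case (elim x)
    then obtain z where z: "x = abs_torus z" "0 < fst z" "fst z < 1" by blast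
    have 1: "\<exists>q\<ge>n. q \<in> Q \<and> snd z - \<alpha> * fst z \<in> approach B q" for n using elim(1) z by auto
    have 2: "\<exists>q\<ge>n. q \<in> Q \<and> snd z - \<alpha> * fst z - \<beta> \<in> approach B q" for n using elim(2) z by blast
    have f1: "\<exists>q\<ge>n. \<exists>p. well_approximated q p \<alpha> \<and> real q * \<beta> \<notin> \<int> \<and> snd z - \<alpha> * fst z \<in> approach B q" for n
      using 1[of n] unfolding Q_def by blast
    have f2: "\<exists>q\<ge>n. \<exists>p. well_approximated q p \<alpha> \<and> real q * \<beta> \<notin> \<int> \<and> snd z - \<alpha> * fst z - \<beta> \<in> approach B q" for n
      using 2[of n] unfolding Q_def by blast
    note av = orbit_averages[OF \<phi>[unfolded p_def q_def] pq[unfolded p_def q_def] gen z(1,2) less_imp_le[OF z(3)] B f1 f2]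
    show "p_omega \<Phi> x = dirac_segment (abs_torus (0, 0)) (abs_torus (0, \<beta>))"
    proof (rule p_omega_eq_dirac_segment[where \<phi> = \<phi> and P = "torus_form 0" and Q = "torus_form \<beta>"])
      show "\<And>y. \<phi> y = 0 \<longleftrightarrow> y = abs_torus (0, 0) \<or> y = abs_torus (0, \<beta>)" using F by (simp add: p_def q_def)
    qed (use av pq contF F contPhi in \<open>simp_all add: compact_torus continuous_on_torus_form torus_form_nonneg torus_form_eq_0_iff p_def q_def\<close>)
  qed
qed

end
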